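(* Let $X$ and $Y$ be connected, countable CW complexes with non-degenerate basepoints. Let $f \colon X \to Y$ be a based map, and let $0\colon X\to Y$ be the constant map at the basepoint. If $\omega_f \colon \mathrm{map}(X, Y;f) \to Y$ has a section, then $\mathrm{map}(X, Y;f)$ is homotopy equivalent to $\mathrm{map}(X, Y;0)$. If $X$ is a finite complex, then the following are equivalent: (A) The map $f \colon X \to Y$ is cyclic. (B) The evaluation fibration $\omega_f \colon \mathrm{map}(X, Y;f) \to Y$ has a section. (C) The evaluation fibration $\omega_f \colon \mathrm{map}(X, Y;f) \to Y$ is fibre-homotopy equivalent to $\omega_0 \colon \mathrm{map}(X, Y;0) \to Y$.
   Context: $\mathrm{map}(X,Y)$ is the space of all continuous (not necessarily based) maps with the compact-open topology, and $\mathrm{map}(X,Y;f)$ is its path component containing $f$, with basepoint $f$. With $x_0\in X$ the basepoint, $\omega_f\colon \mathrm{map}(X,Y;f)\to Y$ is the evaluation $\omega_f(h)=h(x_0)$, which is a Hurewicz fibration. A based map $f\colon X\to Y$ is cyclic if the map $(f\mid 1)\colon X\vee Y\to Y$ (equal to $f$ on $X$ and the identity on $Y$) extends to a map $\Gamma\colon X\times Y\to Y$. Fibrations $p_1\colon E_1\to B$ and $p_2\colon E_2\to B$ are fibre-homotopy equivalent if there are based maps $h\colon E_1\to E_2$ and $k\colon E_2\to E_1$ over $B$ such that $k\circ h$ and $h\circ k$ are homotopic to the respective identities by based homotopies $F$ and $H$ satisfying $p_1F(x,t)=p_1(x)$ and $p_2H(y,t)=p_2(y)$ for all $x\in E_1$,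 $y\in E_2$, $t\in[0,1]$. *)

theory Defs
  imports "HOL-Analysis.Analysis"
begin

definition unit_disc :: "nat \<Rightarrow> (nat \<Rightarrow> real) topology" where
  "unit_disc n = subtopology (Euclidean_space n) {v. (\<Sum>i<n. (v i)\<^sup>2) \<le> 1}"

definition unit_open_disc :: "nat \<Rightarrow> (nat \<Rightarrow> real) topology" where
  "unit_open_disc n = subtopology (Euclidean_space n) {v. (\<Sum>i<n. (v i)\<^sup>2) < 1}"

text \<open>A CW structure on \<open>X\<close> is given by its set \<open>E\<close> of open cells and their dimensions \<open>d\<close>.
  The boundary of a cell meets only finitely many cells, all of smaller dimension, and \<open>X\<close> has the
  weak topology with respect to the closed cells.\<close>

definition characteristic_map ::
  "'a topology \<Rightarrow> 'a set set \<Rightarrow> ('a set \<Rightarrow> nat) \<Rightarrow> 'a set \<Rightarrow> ((nat \<Rightarrow> real) \<Rightarrow> 'a) \<Rightarrow> bool" where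
  "characteristic_map X E d e \<phi> \<longleftrightarrow>
     continuous_map (unit_disc (d e)) X \<phi> \<and>
     homeomorphic_map (unit_open_disc (d e)) (subtopology X e) \<phi> \<and>
     (\<exists>F. finite F \<and> F \<subseteq> {c \<in> E. d c < d e} \<and>
        \<phi> ` (topspace (unit_disc (d e)) - topspace (unit_open_disc (d e))) \<subseteq> \<Union>F)"

definition CW_complex :: "'a topology \<Rightarrow> 'a set set \<Rightarrow> ('a set \<Rightarrow> nat) \<Rightarrow> bool" where
  "CW_complex X E d \<longleftrightarrow>
     Hausdorff_space X \<and> \<Union>E = topspace X \<and> pairwise disjnt E \<and>
     (\<forall>e\<in>E. \<exists>\<phi>. characteristic_map X E d e \<phi>) \<and>
     (\<forall>A \<subseteq> topspace X. (\<forall>e\<in>E. closedin X (A \<inter> X closure_of e)) \<longrightarrow> closedin X A)"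

text \<open>The basepoint is non-degenerate if the space and the basepoint form an NDR pair.\<close>

definition nondegenerate_basepoint :: "'a topology \<Rightarrow> 'a \<Rightarrow> bool" where
  "nondegenerate_basepoint X x0 \<longleftrightarrow> x0 \<in> topspace X \<and>
     (\<exists>u h. continuous_map X (top_of_set {0..1::real}) u \<and>
        {x \<in> topspace X. u x = 0} = {x0} \<and>
        continuous_map (prod_topology (top_of_set {0..1::real}) X) X h \<and>
        (\<forall>x\<in>topspace X. h (0, x) = x) \<and>
        (\<forall>t\<in>{0..1}. h (t, x0) = x0) \<and>
        (\<forall>x\<in>topspace X. u x < 1 \<longrightarrow> h (1, x) = x0))"

definition based_map :: "'a topology \<Rightarrow> 'a \<Rightarrow> 'b topology \<Rightarrow> 'b \<Rightarrow> ('a \<Rightarrow> 'b) \<Rightarrow> bool" where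
  "based_map X x0 Y y0 f \<longleftrightarrow> continuous_map X Y f \<and> f x0 = y0"

text \<open>Points of the mapping space are the continuous maps, represented by functions that are
  undefined outside the domain, so that each continuous map is exactly one point.\<close>

definition mapping_space :: "'a topology \<Rightarrow> 'b topology \<Rightarrow> ('a \<Rightarrow> 'b) topology" where
  "mapping_space X Y = topology_generated_by
     {{g \<in> extensional (topspace X). continuous_map X Y g \<and> g ` K \<subseteq> U} | K U.
        compactin X K \<and> openin Y U}"

lemma topspace_mapping_space:
  "topspace (mapping_space X Y) = {g \<in> extensional (topspace X). continuous_map X Y g}"
proof
  show "topspace (mapping_space X Y) \<subseteq> {g \<in> extensional (topspace X). continuous_map X Y g}"
    unfolding mapping_space_def topology_generated_by_topspace by (rule Union_least) blast
next
  let ?M = "{g \<in> extensional (topspace X). continuous_map X Y g}"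
  have "?M = {g \<in> extensional (topspace X). continuous_map X Y g \<and> g ` {} \<subseteq> {}}"
    by simp
  moreover have "compactin X {}" "openin Y {}"
    by simp_all
  ultimately show "?M \<subseteq> topspace (mapping_space X Y)"
    unfolding mapping_space_def topology_generated_by_topspace by (intro Union_upper) blast
qed

definition mapping_point :: "'a topology \<Rightarrow> ('a \<Rightarrow> 'b) \<Rightarrow> 'a \<Rightarrow> 'b" where
  "mapping_point X f = restrict f (topspace X)"

definition mapping_component ::
  "'a topology \<Rightarrow> 'b topology \<Rightarrow> ('a \<Rightarrow> 'b) \<Rightarrow> ('a \<Rightarrow> 'b) topology" where
  "mapping_component X Y f = subtopology (mapping_space X Y)
     (path_component_of_set (mapping_space X Y) (mapping_point X f))"

definition evaluation :: "'a \<Rightarrow> ('a \<Rightarrow> 'b) \<Rightarrow> 'b" where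
  "evaluation x0 g = g x0"

definition has_section :: "'e topology \<Rightarrow> 'b topology \<Rightarrow> ('e \<Rightarrow> 'b) \<Rightarrow> bool" where
  "has_section E B p \<longleftrightarrow> (\<exists>s. continuous_map B E s \<and> (\<forall>b\<in>topspace B. p (s b) = b))"

text \<open>The wedge is identified with the union of the two axes in the product.\<close>

definition wedge_set :: "'a topology \<Rightarrow> 'a \<Rightarrow> 'b topology \<Rightarrow> 'b \<Rightarrow> ('a \<times> 'b) set" where
  "wedge_set X x0 Y y0 = topspace X \<times> {y0} \<union> {x0} \<times> topspace Y"

definition cyclic_map :: "'a topology \<Rightarrow> 'a \<Rightarrow> 'b topology \<Rightarrow> 'b \<Rightarrow> ('a \<Rightarrow> 'b) \<Rightarrow> bool" where
  "cyclic_map X x0 Y y0 f \<longleftrightarrow> based_map X x0 Y y0 f \<and>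
     (\<exists>\<Gamma>. continuous_map (prod_topology X Y) Y \<Gamma> \<and>
        (\<forall>(x, y) \<in> wedge_set X x0 Y y0. \<Gamma> (x, y) = (if y = y0 then f x else y)))"

definition based_map_over :: "'e topology \<Rightarrow> 'e \<Rightarrow> ('e \<Rightarrow> 'b) \<Rightarrow>
    'f topology \<Rightarrow> 'f \<Rightarrow> ('f \<Rightarrow> 'b) \<Rightarrow> ('e \<Rightarrow> 'f) \<Rightarrow> bool" where
  "based_map_over E1 e1 p1 E2 e2 p2 h \<longleftrightarrow>
     based_map E1 e1 E2 e2 h \<and> (\<forall>x\<in>topspace E1. p2 (h x) = p1 x)"

text \<open>In \<open>homotopic_with\<close> the first argument is required of every stage of the homotopy, so the
  homotopies below are based and vertical.\<close>

definition fibre_homotopy_equivalent :: "'e topology \<Rightarrow> 'e \<Rightarrow> ('e \<Rightarrow> 'b) \<Rightarrow>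
    'f topology \<Rightarrow> 'f \<Rightarrow> ('f \<Rightarrow> 'b) \<Rightarrow> bool" where
  "fibre_homotopy_equivalent E1 e1 p1 E2 e2 p2 \<longleftrightarrow>
     (\<exists>h k. based_map_over E1 e1 p1 E2 e2 p2 h \<and> based_map_over E2 e2 p2 E1 e1 p1 k \<and>
        homotopic_with (based_map_over E1 e1 p1 E1 e1 p1) E1 E1 (k \<circ> h) id \<and>
        homotopic_with (based_map_over E2 e2 p2 E2 e2 p2) E2 E2 (h \<circ> k) id)"

end

(*
A section s of the evaluation gives a family of self-maps S(x, y) = s(y)(x) of Y, indexed by X, with
S(x0, y) = y. Over a single cell of X this family is homotopic to the constant family of identities,
since the cell is contractible and X is path connected. Working cell by cell one therefore finds a
family T, equal to the identity at x0, and a homotopy rel x0 from the identity to S o T; doing the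
same for T shows that T is a two-sided inverse of S. Hence g |-> (x |-> S(x, g x)) is a vertical
homotopy equivalence of the whole mapping space, which carries the component of the constant map to
the component of f.

For finite X the map s(y0) can be moved to f rel base point, and the homotopy extension property of
the wedge in X x Y turns S into a map which exhibits f as cyclic. To make the vertical equivalence
based one needs that the points f and 0 of the mapping space are non-degenerate. This holds because
the diagonal of the CW complex Y is a neighbourhood deformation retract; the retraction is built over
the products of cells of Y.
*)

theory Submission
  imports Defs
begin

text \<open>Continuity is therefore demanded only over closed cells: on a closed cell times
  \<open>Y\<close>, or on two closed cells times an interval. That is enough. Closed cells are
  compact Hausdorff, so evaluation is continuous over them, and a compact set, which is all that the
  compact-open topology tests, lies in finitely many of them. Inversion is one-sided on purpose: a
  map \<open>T\<close> and a single homotopy to \<open>S \<circ> T\<close> can be extended over a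
  cell by filling a box, whereas both composites would have to be kept compatible at once. The
  second side is then formal. A vertical equivalence moves the point \<open>f\<close> of the mapping
  space along a path in a fibre. Undoing this vertically means extending a homotopy from two axes,
  \<open>X\<close> times a point of the mapping space and \<open>{x0}\<close> times the mapping
  space; this is where non-degeneracy of that point enters.\<close>

abbreviation II :: "real topology" where "II \<equiv> top_of_set {0..1}"

section \<open>Composites, pasting over closed covers, and compact parameters\<close>

lemma continuous_map_comp:
  assumes "continuous_map A B f" and "continuous_map W A g"
  shows "continuous_map W B (\<lambda>w. f (g w))"
  using continuous_map_compose[OF assms(2,1)] by (simp add: o_def)

lemma continuous_map_fstI:
  "continuous_map W (prod_topology A B) f \<Longrightarrow> continuous_map W A (\<lambda>w. fst (f w))"
  using continuous_map_comp[OF continuous_map_fst] .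

lemma continuous_map_sndI:
  "continuous_map W (prod_topology A B) f \<Longrightarrow> continuous_map W B (\<lambda>w. snd (f w))"
  using continuous_map_comp[OF continuous_map_snd] .

lemma continuous_map_into_sub:
  "continuous_map W Z f \<Longrightarrow> (\<And>x. x \<in> topspace W \<Longrightarrow> f x \<in> A) \<Longrightarrow> continuous_map W (subtopology Z A) f"
  by (auto simp: continuous_map_in_subtopology)

lemma continuous_map_II_I:
  "continuous_map W euclideanreal f \<Longrightarrow> (\<And>x. x \<in> topspace W \<Longrightarrow> 0 \<le> f x) \<Longrightarrow>
    (\<And>x. x \<in> topspace W \<Longrightarrow> f x \<le> 1) \<Longrightarrow> continuous_map W II f"
  by (rule continuous_map_into_sub) auto

lemma continuous_map_II_D:
  "continuous_map W II f \<Longrightarrow> continuous_map W euclideanreal f"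
  using continuous_map_into_fulltopology by blast

lemmas cm_intros = continuous_map_pairedI continuous_map_id[unfolded id_def]
  continuous_map_fst continuous_map_snd

lemma continuous_map_openD:
  assumes "continuous_map A B f" "openin B U"
  shows "openin A {x \<in> topspace A. f x \<in> U}"
  using assms by (simp add: openin_continuous_map_preimage)

lemma continuous_map_union_closed:
  assumes "closedin X S" "closedin X T"
    and "continuous_map (subtopology X S) Y f" "continuous_map (subtopology X T) Y f"
  shows "continuous_map (subtopology X (S \<union> T)) Y f"
proof (rule pasting_lemma_closed[where I = "{S,T}" and T = "\<lambda>x. x" and f = "\<lambda>_. f"])
  show "closedin (subtopology X (S \<union> T)) i" if "i \<in> {S,T}" for i
    using that assms by (auto simp: closedin_closed_subtopology closedin_Un)
  show "continuous_map (subtopology (subtopology X (S \<union> T)) i) Y f" if "i \<in> {S,T}" for i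
    using that assms by (auto simp: subtopology_subtopology Int_Un_distrib2 Int_absorb1 Int_commute
        inf_sup_absorb sup_commute)
qed auto

lemma continuous_map_Union_closed:
  assumes "finite I" "\<And>i. i \<in> I \<Longrightarrow> closedin X (T i)"
    and "\<And>i. i \<in> I \<Longrightarrow> continuous_map (subtopology X (T i)) Y f"
  shows "continuous_map (subtopology X (\<Union>i\<in>I. T i)) Y f"
proof (rule pasting_lemma_closed[where I = I and T = T and f = "\<lambda>_. f"])
  fix i assume i: "i \<in> I"
  show "closedin (subtopology X (\<Union>i\<in>I. T i)) (T i)"
    using assms i by (intro closedin_subset_topspace) auto
  have "(\<Union>i\<in>I. T i) \<inter> T i = T i" using i by auto
  then show "continuous_map (subtopology (subtopology X (\<Union>i\<in>I. T i)) (T i)) Y f"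
    using assms i by (simp add: subtopology_subtopology)
qed (use assms in auto)

lemma prod_topology_subtopology_left:
  "prod_topology (subtopology X S) Y = subtopology (prod_topology X Y) (S \<times> topspace Y)"
proof -
  have "prod_topology (subtopology X S) (subtopology Y (topspace Y))
      = subtopology (prod_topology X Y) (S \<times> topspace Y)"
    by (simp add: prod_topology_subtopology subtopology_subtopology Times_Int_Times)
  then show ?thesis by simp
qed

text \<open>Tube lemma. The parameters violating the condition are the projection of a closed set
  along the compact factor, and that projection is a closed map.\<close>

lemma openin_compact_forall:
  assumes "compact_space C" and "continuous_map (prod_topology C W) Y F" and "openin Y U"
  shows "openin W {w \<in> topspace W. \<forall>c\<in>topspace C. F (c,w) \<in> U}"
proof -
  let ?B = "{p \<in> topspace (prod_topology C W). F p \<in> topspace Y - U}"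
  have "closedin (prod_topology C W) ?B"
    using assms by (intro closedin_continuous_map_preimage) auto
  then have "closedin W (snd ` ?B)"
    using closed_map_snd[OF assms(1)] by (auto simp: closed_map_def)
  moreover have "topspace W - snd ` ?B = {w \<in> topspace W. \<forall>c\<in>topspace C. F (c,w) \<in> U}"
    using assms(2) by (force simp: continuous_map_def image_iff Pi_iff)
  moreover have "openin W (topspace W - snd ` ?B)"
    using \<open>closedin W (snd ` ?B)\<close> by blast
  ultimately show ?thesis by simp
qed

text \<open>The sets where the supremum is below \<open>a\<close> are open by the tube lemma,
  because the supremum is attained; the sets where it is above \<open>a\<close> are unions of open
  sets over \<open>c\<close>. Attainment is exported as well, to compute the supremum at a given
  parameter.\<close>

lemma continuous_map_Sup_compact:
  fixes F :: "'c \<times> 'w \<Rightarrow> real"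
  assumes C: "compact_space C" "topspace C \<noteq> {}"
    and F: "continuous_map (prod_topology C W) euclideanreal F"
  shows "continuous_map W euclideanreal (\<lambda>w. SUP c\<in>topspace C. F (c,w))"
    and "w \<in> topspace W \<Longrightarrow> \<exists>c\<in>topspace C. (SUP c\<in>topspace C. F (c,w)) = F (c,w)"
    and "w \<in> topspace W \<Longrightarrow> c \<in> topspace C \<Longrightarrow> F (c,w) \<le> (SUP c\<in>topspace C. F (c,w))"
proof -
  let ?S = "\<lambda>w. SUP c\<in>topspace C. F (c,w)"
  have att: "\<exists>c0\<in>topspace C. \<forall>c\<in>topspace C. F (c,w) \<le> F (c0,w)" if w: "w \<in> topspace W" for w
  proof -
    have "continuous_map C euclideanreal (\<lambda>c. F (c,w))"
      using w by (intro continuous_map_comp[OF F] cm_intros) auto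
    then have "compactin euclideanreal ((\<lambda>c. F (c,w)) ` topspace C)"
      using C by (metis compact_space_def image_compactin)
    then have "compact ((\<lambda>c. F (c,w)) ` topspace C)" by simp
    from compact_attains_sup[OF this] C(2) show ?thesis by force
  qed
  have eq: "\<exists>c0\<in>topspace C. ?S w = F (c0,w) \<and> (\<forall>c\<in>topspace C. F (c,w) \<le> F (c0,w))"
    if w: "w \<in> topspace W" for w
  proof -
    obtain c0 where c0: "c0 \<in> topspace C" "\<forall>c\<in>topspace C. F (c,w) \<le> F (c0,w)"
      using att[OF w] by blast
    then have "?S w = F (c0,w)" by (intro cSup_eq_maximum) auto
    with c0 show ?thesis by blast
  qed
  then show "w \<in> topspace W \<Longrightarrow> \<exists>c\<in>topspace C. ?S w = F (c,w)"
    and "w \<in> topspace W \<Longrightarrow> c \<in> topspace C \<Longrightarrow> F (c,w) \<le> ?S w"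
    by fastforce+
  have lt: "openin W {w \<in> topspace W. ?S w \<in> {..<a}}" for a
  proof -
    have "{w \<in> topspace W. ?S w \<in> {..<a}} = {w \<in> topspace W. \<forall>c\<in>topspace C. F (c,w) \<in> {..<a}}"
      using eq by fastforce
    then show ?thesis using openin_compact_forall[OF C(1) F, of "{..<a}"] by auto
  qed
  have gt: "openin W {w \<in> topspace W. ?S w \<in> {a<..}}" for a
  proof -
    have "{w \<in> topspace W. ?S w \<in> {a<..}}
       = (\<Union>c\<in>topspace C. {w \<in> topspace W. F (c,w) \<in> {a<..}})"
      using eq by fastforce
    moreover have "openin W {w \<in> topspace W. F (c,w) \<in> {a<..}}" if "c \<in> topspace C" for c
      using that by (intro continuous_map_openD[of _ euclideanreal] continuous_map_comp[OF F] cm_intros) auto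
    ultimately show ?thesis by auto
  qed
  show "continuous_map W euclideanreal ?S"
    using lt gt by (auto simp: continuous_map_upper_lower_semicontinuous_lt)
qed

section \<open>Mapping spaces\<close>

text \<open>A subbasic open set of the mapping space tests a map on one compact set, so joint
  continuity over compact subsets of \<open>X\<close>, together with continuity of each slice, makes
  the adjoint continuous. This form also serves spaces \<open>X\<close> that are not locally
  compact.\<close>

lemma continuous_map_curry:
  assumes "\<And>w. w \<in> topspace W \<Longrightarrow> continuous_map X Y (F w)"
    and "\<And>K. compactin X K \<Longrightarrow>
       continuous_map (prod_topology (subtopology X K) W) Y (\<lambda>p. F (snd p) (fst p))"
  shows "continuous_map W (mapping_space X Y) (\<lambda>w. restrict (F w) (topspace X))"
  unfolding mapping_space_def
proof (rule continuous_on_generated_topo)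
  fix N
  assume "N \<in> {{g \<in> extensional (topspace X). continuous_map X Y g \<and> g ` K \<subseteq> U} | K U.
        compactin X K \<and> openin Y U}"
  then obtain K U where K: "compactin X K" "openin Y U"
    and N: "N = {g \<in> extensional (topspace X). continuous_map X Y g \<and> g ` K \<subseteq> U}"
    by blast
  have KX: "K \<subseteq> topspace X" using K by (simp add: compactin_subset_topspace)
  have "continuous_map X Y (restrict (F w) (topspace X))" if "w \<in> topspace W" for w
    using assms(1)[OF that] by (simp add: continuous_map_eq)
  then have "(\<lambda>w. restrict (F w) (topspace X)) -` N \<inter> topspace W
      = {w \<in> topspace W. \<forall>c\<in>topspace (subtopology X K). (\<lambda>p. F (snd p) (fst p)) (c,w) \<in> U}"
    using KX by (auto simp: N image_subset_iff subset_iff)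
  moreover have "compact_space (subtopology X K)" using K by (simp add: compact_space_subtopology)
  ultimately show "openin W ((\<lambda>w. restrict (F w) (topspace X)) -` N \<inter> topspace W)"
    using openin_compact_forall[OF _ assms(2)[OF K(1)] K(2)] by presburger
next
  have "continuous_map X Y (restrict (F w) (topspace X))" if "w \<in> topspace W" for w
    using assms(1)[OF that] by (simp add: continuous_map_eq)
  then have "(\<lambda>w. restrict (F w) (topspace X)) ` topspace W \<subseteq> topspace (mapping_space X Y)"
    by (auto simp: topspace_mapping_space)
  then show "(\<lambda>w. restrict (F w) (topspace X)) ` topspace W
    \<subseteq> \<Union> {{g \<in> extensional (topspace X). continuous_map X Y g \<and> g ` K \<subseteq> U} | K U.
        compactin X K \<and> openin Y U}"
    unfolding mapping_space_def topology_generated_by_topspace .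
qed

lemma continuous_map_curry':
  assumes "continuous_map (prod_topology X W) Y F"
  shows "continuous_map W (mapping_space X Y) (\<lambda>w. \<lambda>x\<in>topspace X. F (x,w))"
proof (rule continuous_map_curry)
  show "continuous_map X Y (\<lambda>x. F (x,w))" if "w \<in> topspace W" for w
    using that by (intro continuous_map_comp[OF assms] cm_intros) auto
  show "continuous_map (prod_topology (subtopology X K) W) Y (\<lambda>p. F (fst p, snd p))" for K
    using assms by (simp add: prod_topology_subtopology_left continuous_map_from_subtopology)
qed

lemma mapping_space_continuous: "g \<in> topspace (mapping_space X Y) \<Longrightarrow> continuous_map X Y g"
  by (simp add: topspace_mapping_space)

lemma mapping_space_ext: "g \<in> topspace (mapping_space X Y) \<Longrightarrow> restrict g (topspace X) = g"
  by (simp add: topspace_mapping_space extensional_restrict)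

text \<open>A compact Hausdorff \<open>C\<close> is regular, so \<open>x\<close> has in
  \<open>C\<close> a closed, hence compact, neighbourhood \<open>K\<close> inside the preimage of
  \<open>U\<close> under \<open>g\<close>; the maps carrying \<open>K\<close> into \<open>U\<close>
  form the required neighbourhood of \<open>g\<close>.\<close>

lemma continuous_map_eval_compact:
  assumes "Hausdorff_space X" "compactin X C"
  shows "continuous_map (prod_topology (subtopology X C) (mapping_space X Y)) Y (\<lambda>p. snd p (fst p))"
  unfolding continuous_map_def
proof (intro conjI allI impI)
  let ?P = "prod_topology (subtopology X C) (mapping_space X Y)"
  show "(\<lambda>p. snd p (fst p)) \<in> topspace ?P \<rightarrow> topspace Y"
    by (auto simp: topspace_mapping_space continuous_map_def)
  fix U assume U: "openin Y U"
  have reg: "regular_space (subtopology X C)"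
    by (meson assms Hausdorff_space_subtopology compact_Hausdorff_imp_regular_space
        compact_space_subtopology)
  have cpt: "compact_space (subtopology X C)" using assms by (simp add: compact_space_subtopology)
  show "openin ?P {p \<in> topspace ?P. snd p (fst p) \<in> U}"
  proof (subst openin_subopen, clarify)
    fix x g assume xg: "(x,g) \<in> topspace ?P" and gU: "snd (x,g) (fst (x,g)) \<in> U"
    then have x: "x \<in> topspace (subtopology X C)" and g: "g \<in> topspace (mapping_space X Y)" by auto
    have cg: "continuous_map (subtopology X C) Y g"
      using g mapping_space_continuous continuous_map_from_subtopology by blast
    have "openin (subtopology X C) {c \<in> topspace (subtopology X C). g c \<in> U}"
      using cg U by (rule continuous_map_openD)
    then obtain V K where V: "openin (subtopology X C) V" "closedin (subtopology X C) K" "x \<in> V" "V \<subseteq> K"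
       "K \<subseteq> {c \<in> topspace (subtopology X C). g c \<in> U}"
      using reg x gU unfolding neighbourhood_base_of_closedin[symmetric] neighbourhood_base_of
      by (smt (verit, best) fst_conv mem_Collect_eq snd_conv)
    have "compactin (subtopology X C) K" using V cpt closedin_compact_space by blast
    then have K: "compactin X K" by (simp add: compactin_subtopology)
    let ?N = "{h \<in> extensional (topspace X). continuous_map X Y h \<and> h ` K \<subseteq> U}"
    have N: "openin (mapping_space X Y) ?N"
      unfolding mapping_space_def by (rule topology_generated_by_Basis) (use K U in blast)
    have "g \<in> ?N" using g V by (auto simp: topspace_mapping_space)
    then have "(x,g) \<in> V \<times> ?N" using V by auto
    moreover have "openin ?P (V \<times> ?N)" using V N by (simp add: openin_prod_Times_iff)
    moreover have "V \<times> ?N \<subseteq> {p \<in> topspace ?P. snd p (fst p) \<in> U}"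
    proof
      fix p assume p: "p \<in> V \<times> ?N"
      then have "snd p (fst p) \<in> U" using V(4) by (auto simp: image_subset_iff subset_iff)
      then show "p \<in> {p \<in> topspace ?P. snd p (fst p) \<in> U}"
        using p openin_subset[OF V(1)] openin_subset[OF N] by (cases p) auto
    qed
    ultimately show "\<exists>T. openin ?P T \<and> (x,g) \<in> T \<and> T \<subseteq> {p \<in> topspace ?P. snd p (fst p) \<in> U}"
      by blast
  qed
qed

lemma continuous_map_eval:
  assumes "Hausdorff_space X" "compact_space X"
  shows "continuous_map (prod_topology X (mapping_space X Y)) Y (\<lambda>p. snd p (fst p))"
  using continuous_map_eval_compact[OF assms(1), of "topspace X" Y] assms(2)
  by (simp add: compact_space_def)

lemma continuous_map_evaluation:
  assumes "x \<in> topspace X"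
  shows "continuous_map (mapping_space X Y) Y (\<lambda>g. g x)"
  unfolding continuous_map_def
proof (intro conjI allI impI)
  show "(\<lambda>g. g x) \<in> topspace (mapping_space X Y) \<rightarrow> topspace Y"
    using assms by (auto simp: topspace_mapping_space continuous_map_def)
  fix U assume U: "openin Y U"
  have "{g \<in> topspace (mapping_space X Y). g x \<in> U}
     = {h \<in> extensional (topspace X). continuous_map X Y h \<and> h ` {x} \<subseteq> U}"
    by (auto simp: topspace_mapping_space)
  moreover have "openin (mapping_space X Y) {h \<in> extensional (topspace X). continuous_map X Y h \<and> h ` {x} \<subseteq> U}"
    unfolding mapping_space_def
    by (rule topology_generated_by_Basis) (use U assms in \<open>auto intro!: exI[of _ "{x}"]\<close>)
  ultimately show "openin (mapping_space X Y) {g \<in> topspace (mapping_space X Y). g x \<in> U}" by simp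
qed

lemma continuous_map_in:
  "continuous_map A B f \<Longrightarrow> x \<in> topspace A \<Longrightarrow> f x \<in> topspace B"
  by (auto simp: continuous_map_def)

lemma cm_proj:
  "continuous_map (prod_topology (prod_topology A B) C) A (\<lambda>x. fst (fst x))"
  "continuous_map (prod_topology (prod_topology A B) C) B (\<lambda>x. snd (fst x))"
  "continuous_map (prod_topology C (prod_topology A B)) A (\<lambda>x. fst (snd x))"
  "continuous_map (prod_topology C (prod_topology A B)) B (\<lambda>x. snd (snd x))"
  by (rule continuous_map_fstI[OF continuous_map_fst] continuous_map_sndI[OF continuous_map_fst]
      continuous_map_fstI[OF continuous_map_snd] continuous_map_sndI[OF continuous_map_snd])+

section \<open>NDR pairs\<close>

text \<open>A Strom structure of a closed cofibration: \<open>w z\<close> bounds the time of arrival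
  in \<open>A\<close>, and the deformation stays in \<open>A\<close> afterwards. Values of
  \<open>w\<close> above 1 are allowed; they promise no arrival within the unit interval.\<close>

definition ndr_pair :: "'a topology \<Rightarrow> 'a set \<Rightarrow> bool" where
  "ndr_pair Z A \<longleftrightarrow> (\<exists>w D. continuous_map Z euclideanreal w \<and> (\<forall>z\<in>topspace Z. 0 \<le> w z) \<and>
     A = {z \<in> topspace Z. w z = 0} \<and>
     continuous_map (prod_topology Z II) Z D \<and>
     (\<forall>z\<in>topspace Z. D (z,0) = z) \<and> (\<forall>a\<in>A. \<forall>t\<in>{0..1}. D (a,t) = a) \<and>
     (\<forall>z\<in>topspace Z. \<forall>t\<in>{0..1}. w z \<le> t \<longrightarrow> D (z,t) \<in> A))"

lemma ndr_pairE:
  assumes "ndr_pair Z A"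
  obtains w D where "continuous_map Z euclideanreal w" "\<And>z. z \<in> topspace Z \<Longrightarrow> 0 \<le> w z"
    "A = {z \<in> topspace Z. w z = 0}" "continuous_map (prod_topology Z II) Z D"
    "\<And>z. z \<in> topspace Z \<Longrightarrow> D (z,0) = z"
    "\<And>z t. z \<in> A \<Longrightarrow> 0 \<le> t \<Longrightarrow> t \<le> 1 \<Longrightarrow> D (z,t) = z"
    "\<And>z t. z \<in> topspace Z \<Longrightarrow> 0 \<le> t \<Longrightarrow> t \<le> 1 \<Longrightarrow> w z \<le> t \<Longrightarrow> D (z,t) \<in> A"
proof -
  from assms obtain w D where *: "continuous_map Z euclideanreal w" "\<forall>z\<in>topspace Z. 0 \<le> w z"
    "A = {z \<in> topspace Z. w z = 0}" "continuous_map (prod_topology Z II) Z D"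
    "\<forall>z\<in>topspace Z. D (z,0) = z" "\<forall>a\<in>A. \<forall>t\<in>{0..1}. D (a,t) = a"
    "\<forall>z\<in>topspace Z. \<forall>t\<in>{0..1}. w z \<le> t \<longrightarrow> D (z,t) \<in> A"
    unfolding ndr_pair_def by (elim exE conjE)
  show thesis by (rule that[of w D]) (use *(1,2,4-7) in \<open>simp_all add: *(3)[symmetric]\<close>)
qed

lemma ndr_pair_subset: "ndr_pair Z A \<Longrightarrow> A \<subseteq> topspace Z"
  unfolding ndr_pair_def by auto

lemma ndr_pair_closedin: "ndr_pair Z A \<Longrightarrow> closedin Z A"
proof (elim ndr_pairE)
  fix w :: "'a \<Rightarrow> real" assume w: "continuous_map Z euclideanreal w" "A = {z \<in> topspace Z. w z = 0}"
  have "closedin Z {z \<in> topspace Z. w z \<in> {0}}"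
    by (rule closedin_continuous_map_preimage[OF w(1)]) auto
  then show "closedin Z A" using w by simp
qed

text \<open>From the classical NDR data \<open>(u, h)\<close> one obtains a deformation that reaches \<open>A\<close> no later than
  at time \<open>w z\<close> by running \<open>h\<close> at the speed \<open>1 / u z\<close>. With this normalisation
  products need no division.\<close>

lemma ndr_pairI:
  fixes u :: "'a \<Rightarrow> real"
  assumes u: "continuous_map Z euclideanreal u" "\<And>z. z \<in> topspace Z \<Longrightarrow> 0 \<le> u z"
    and A: "A = {z \<in> topspace Z. u z = 0}"
    and h: "continuous_map (prod_topology II Z) Z h"
    and h0: "\<And>z. z \<in> topspace Z \<Longrightarrow> h (0,z) = z"
    and hA: "\<And>z t. z \<in> A \<Longrightarrow> 0 \<le> t \<Longrightarrow> t \<le> 1 \<Longrightarrow> h (t,z) = z"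
    and h1: "\<And>z. z \<in> topspace Z \<Longrightarrow> u z < 1 \<Longrightarrow> h (1,z) \<in> A"
  shows "ndr_pair Z A"
proof -
  define D where "D = (\<lambda>(z,t). if u z = 0 then z else h (min 1 (t / u z), z))"
  let ?P = "prod_topology Z II"
  have "continuous_map ?P Z D"
    unfolding continuous_map_def
  proof (intro conjI allI impI)
    have hT: "h (s,z) \<in> topspace Z" if "0 \<le> s" "s \<le> 1" "z \<in> topspace Z" for s z
      using continuous_map_in[OF h] that by simp
    show "D \<in> topspace ?P \<rightarrow> topspace Z"
      using u(2) by (auto simp: D_def hT)
    fix U assume U: "openin Z U"
    show "openin ?P {p \<in> topspace ?P. D p \<in> U}"
    proof (subst openin_subopen, clarify)
      fix z t assume zt: "(z,t) \<in> topspace ?P" and DU: "D (z,t) \<in> U"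
      then have z: "z \<in> topspace Z" and t: "0 \<le> t" "t \<le> 1" by auto
      show "\<exists>T. openin ?P T \<and> (z,t) \<in> T \<and> T \<subseteq> {p \<in> topspace ?P. D p \<in> U}"
      proof (cases "u z = 0")
        case True
        \<comment> \<open>At a zero of \<open>u\<close> the quotient \<open>t / u z\<close> has no
          limit. Since \<open>h (c,z) = z\<close> for every \<open>c\<close>, the tube lemma yields
          a neighbourhood on which all stages of \<open>h\<close> stay in \<open>U\<close>, whatever
          the quotient is.\<close>
        let ?V = "{y \<in> topspace Z. \<forall>c\<in>topspace II. h (c,y) \<in> U}"
        have "openin Z ?V" using openin_compact_forall[OF _ h U] by (simp add: compact_space_subtopology)
        moreover have zV: "z \<in> ?V" using True z A hA DU by (auto simp: D_def)
        moreover have sub: "?V \<times> {0..1} \<subseteq> {p \<in> topspace ?P. D p \<in> U}"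
        proof (rule subsetI)
          fix p :: "'a \<times> real" assume p: "p \<in> ?V \<times> {0..1}"
          obtain y and s :: real where ps: "p = (y,s)" by (cases p)
          have y: "y \<in> topspace Z" "\<And>c. c \<in> {0..1} \<Longrightarrow> h (c,y) \<in> U" and s: "s \<in> {0..1}"
            using p by (auto simp: ps)
          have "0 \<le> s / u y" using s u(2)[OF y(1)] by simp
          then have "h (0,y) \<in> U" "h (min 1 (s / u y), y) \<in> U" using y(2) by simp_all
          then have "D (y,s) \<in> U" by (simp add: D_def h0[OF y(1)])
          then show "p \<in> {p \<in> topspace ?P. D p \<in> U}" using y s by (simp add: ps)
        qed
        moreover have "openin ?P (?V \<times> {0..1})"
          using \<open>openin Z ?V\<close> openin_topspace[of II] by (simp add: openin_prod_Times_iff)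
        moreover have "(z,t) \<in> ?V \<times> {0..1}" using zV t by simp
        ultimately show ?thesis by (intro exI[of _ "?V \<times> {0..1}"] conjI sub)
      next
        case False
        let ?Q = "{p \<in> topspace ?P. u (fst p) \<in> {0<..}}"
        have opQ: "openin ?P ?Q"
          by (rule continuous_map_openD[where B = euclideanreal])
             (auto intro!: continuous_map_comp[OF u(1)] cm_intros)
        have "continuous_map (subtopology ?P ?Q) Z (\<lambda>p. h (min 1 (snd p / u (fst p)), fst p))"
        proof (intro continuous_map_comp[OF h] continuous_map_pairedI continuous_map_II_I continuous_map_real_min continuous_map_real_divide)
          show "continuous_map (subtopology ?P ?Q) euclideanreal (\<lambda>p. u (fst p))"
            by (intro continuous_map_from_subtopology continuous_map_comp[OF u(1)] cm_intros)
          show "continuous_map (subtopology ?P ?Q) euclideanreal snd"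
            by (intro continuous_map_from_subtopology continuous_map_II_D[OF continuous_map_snd])
          show "continuous_map (subtopology ?P ?Q) Z fst"
            by (intro continuous_map_from_subtopology cm_intros)
        qed auto
        then have "continuous_map (subtopology ?P ?Q) Z D"
          by (rule continuous_map_eq) (auto simp: D_def)
        then have "openin (subtopology ?P ?Q) {p \<in> topspace (subtopology ?P ?Q). D p \<in> U}"
          using U by (rule continuous_map_openD)
        then have "openin ?P {p \<in> topspace (subtopology ?P ?Q). D p \<in> U}"
          using opQ by (simp add: openin_open_subtopology)
        moreover have "(z,t) \<in> {p \<in> topspace (subtopology ?P ?Q). D p \<in> U}"
          using zt DU False u(2)[OF z] by auto
        moreover have "{p \<in> topspace (subtopology ?P ?Q). D p \<in> U} \<subseteq> {p \<in> topspace ?P. D p \<in> U}"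
          by auto
        ultimately show ?thesis by blast
      qed
    qed
  qed
  \<comment> \<open>With \<open>2 * u\<close> as the new \<open>w\<close>, arrival at a point
    outside \<open>A\<close> means both \<open>t / u z \<ge> 2\<close>, so that \<open>h\<close> has
    run to its end, and \<open>u z < 1\<close>, strictly as \<open>h1\<close> demands.\<close>
  moreover have "continuous_map Z euclideanreal (\<lambda>z. 2 * u z)"
    using u(1) by (intro continuous_intros) auto
  moreover have "D (z,t) \<in> A" if "z \<in> topspace Z" "t \<in> {0..1}" "2 * u z \<le> t" for z t
  proof (cases "u z = 0")
    case False
    then have "0 < u z" using u(2)[OF that(1)] by simp
    then have "t / u z \<ge> 2" "u z < 1" using that by (auto simp: field_simps)
    then show ?thesis using that h1 False by (simp add: D_def min_def)
  qed (use that A in \<open>simp add: D_def\<close>)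
  moreover have "D (z,t) = z" if "z \<in> A" "t \<in> {0..1}" for z t
    using that A by (simp add: D_def)
  ultimately show ?thesis
    unfolding ndr_pair_def
    by (intro exI[of _ "\<lambda>z. 2 * u z"] exI[of _ D]) (use u A h0 in \<open>auto simp: D_def\<close>)
qed

text \<open>The constant 2 exceeds every time in the unit interval, so the arrival condition is
  vacuous. The product with this pair turns \<open>(D, A)\<close> into
  \<open>(D \<times> Y, A \<times> Y)\<close>.\<close>

lemma ndr_pair_empty: "ndr_pair Z {}"
  unfolding ndr_pair_def
  by (intro exI[of _ "\<lambda>_. 2"] exI[of _ fst]) (auto intro: cm_intros)

text \<open>Each coordinate is stopped at the arrival time of the other one. If
  \<open>w1 \<le> w2\<close>, the first coordinate is allowed to run up to time \<open>w2\<close>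
  and so gets into \<open>A\<close>. On \<open>Z \<times> B\<close> the first clock stops at 0 and
  the second coordinate does not move, so the subspace is fixed.\<close>

lemma ndr_pair_prod:
  assumes "ndr_pair Z A" "ndr_pair W B"
  shows "ndr_pair (prod_topology Z W) (topspace Z \<times> B \<union> A \<times> topspace W)"
proof -
  from assms(1) obtain w1 D1 where
    w1: "continuous_map Z euclideanreal w1" "\<And>z. z \<in> topspace Z \<Longrightarrow> 0 \<le> w1 z"
    and A: "A = {z \<in> topspace Z. w1 z = 0}" and D1: "continuous_map (prod_topology Z II) Z D1"
    "\<And>z. z \<in> topspace Z \<Longrightarrow> D1 (z,0) = z"
    "\<And>z t. z \<in> A \<Longrightarrow> 0 \<le> t \<Longrightarrow> t \<le> 1 \<Longrightarrow> D1 (z,t) = z"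
    "\<And>z t. z \<in> topspace Z \<Longrightarrow> 0 \<le> t \<Longrightarrow> t \<le> 1 \<Longrightarrow> w1 z \<le> t \<Longrightarrow> D1 (z,t) \<in> A"
    by (rule ndr_pairE) blast
  from assms(2) obtain w2 D2 where
    w2: "continuous_map W euclideanreal w2" "\<And>z. z \<in> topspace W \<Longrightarrow> 0 \<le> w2 z"
    and B: "B = {z \<in> topspace W. w2 z = 0}" and D2: "continuous_map (prod_topology W II) W D2"
    "\<And>z. z \<in> topspace W \<Longrightarrow> D2 (z,0) = z"
    "\<And>z t. z \<in> B \<Longrightarrow> 0 \<le> t \<Longrightarrow> t \<le> 1 \<Longrightarrow> D2 (z,t) = z"
    "\<And>z t. z \<in> topspace W \<Longrightarrow> 0 \<le> t \<Longrightarrow> t \<le> 1 \<Longrightarrow> w2 z \<le> t \<Longrightarrow> D2 (z,t) \<in> B"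
    by (rule ndr_pairE) blast
  have T1: "D1 (z,t) \<in> topspace Z" if "z \<in> topspace Z" "0 \<le> t" "t \<le> 1" for z t
    using continuous_map_in[OF D1(1)] that by simp
  have T2: "D2 (z,t) \<in> topspace W" if "z \<in> topspace W" "0 \<le> t" "t \<le> 1" for z t
    using continuous_map_in[OF D2(1)] that by simp
  let ?w = "\<lambda>p. min (w1 (fst p)) (w2 (snd p))"
  let ?D = "\<lambda>p. (D1 (fst (fst p), min (snd p) (w2 (snd (fst p)))),
                 D2 (snd (fst p), min (snd p) (w1 (fst (fst p)))))"
  let ?P = "prod_topology Z W"
  have c1: "continuous_map ?P euclideanreal ?w"
    by (intro continuous_intros continuous_map_comp[OF w1(1)] continuous_map_comp[OF w2(1)] cm_intros)
  have cs: "continuous_map (prod_topology ?P II) euclideanreal snd"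
    by (intro continuous_map_II_D[OF continuous_map_snd])
  have c2: "continuous_map (prod_topology ?P II) ?P ?D"
  proof (intro continuous_map_pairedI continuous_map_comp[OF D1(1)] continuous_map_comp[OF D2(1)]
      continuous_map_II_I continuous_map_real_min)
    show "continuous_map (prod_topology ?P II) euclideanreal (\<lambda>x. w2 (snd (fst x)))"
      by (intro continuous_map_comp[OF w2(1)] cm_proj)
    show "continuous_map (prod_topology ?P II) euclideanreal (\<lambda>x. w1 (fst (fst x)))"
      by (intro continuous_map_comp[OF w1(1)] cm_proj)
    show "continuous_map (prod_topology ?P II) Z (\<lambda>x. fst (fst x))"
      "continuous_map (prod_topology ?P II) W (\<lambda>x. snd (fst x))"
      by (rule cm_proj)+
  qed (use cs w1(2) w2(2) in auto)
  let ?C = "topspace Z \<times> B \<union> A \<times> topspace W"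
  have c3: "?D (p,t) \<in> ?C" if p: "p \<in> topspace ?P" and t: "t \<in> {0..1}" and le: "?w p \<le> t" for p t
  proof -
    obtain z w where [simp]: "p = (z,w)" by (cases p)
    have z: "z \<in> topspace Z" "w \<in> topspace W" using p by auto
    show ?thesis
    proof (cases "w1 z \<le> w2 w")
      case True
      then have "D1 (z, min t (w2 w)) \<in> A" using le t z w2 by (intro D1(4)) auto
      then show ?thesis using z t w1 by (auto intro!: T2)
    next
      case False
      then have "D2 (w, min t (w1 z)) \<in> B" using le t z w1 by (intro D2(4)) auto
      then show ?thesis using z t w2 by (auto intro!: T1)
    qed
  qed
  have c4: "?D (p,t) = p" if p: "p \<in> ?C" and t: "t \<in> {0..1}" for p t
    using p t w1 w2 A B D1 D2 by (auto simp: min_def)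
  show ?thesis
    unfolding ndr_pair_def
  proof (rule exI[of _ ?w], rule exI[of _ ?D], intro conjI ballI impI)
    have "min (w1 z) (w2 w) = 0 \<longleftrightarrow> w1 z = 0 \<or> w2 w = 0"
      if "z \<in> topspace Z" "w \<in> topspace W" for z w
      using w1(2)[OF that(1)] w2(2)[OF that(2)] by (auto simp: min_def)
    note m0 = this
    show "?C = {z \<in> topspace ?P. ?w z = 0}"
    proof (rule set_eqI)
      fix p :: "'a \<times> 'b" obtain z w where [simp]: "p = (z,w)" by (cases p)
      show "p \<in> ?C \<longleftrightarrow> p \<in> {z \<in> topspace ?P. ?w z = 0}"
        using m0[of z w] by (auto simp: A B simp del: min_def)
    qed
    show "?D (z,0) = z" if "z \<in> topspace ?P" for z
      using that w1 w2 D1 D2 by (auto simp: min_def)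
  qed (use c1 c2 c3 c4 w1 w2 in auto)
qed

text \<open>Only the deformation towards the nearer set runs, and its clock stops at the difference
  of \<open>w1\<close> and \<open>w2\<close>. Where they are equal nothing moves, so the two regimes
  fit together.\<close>

lemma ndr_pair_Un_disjoint:
  assumes "ndr_pair Z A" "ndr_pair Z B" "A \<inter> B = {}"
  shows "ndr_pair Z (A \<union> B)"
proof -
  from assms(1) obtain w1 D1 where
    w1: "continuous_map Z euclideanreal w1" "\<And>z. z \<in> topspace Z \<Longrightarrow> 0 \<le> w1 z"
    and A: "A = {z \<in> topspace Z. w1 z = 0}" and D1: "continuous_map (prod_topology Z II) Z D1"
    "\<And>z. z \<in> topspace Z \<Longrightarrow> D1 (z,0) = z"
    "\<And>z t. z \<in> A \<Longrightarrow> 0 \<le> t \<Longrightarrow> t \<le> 1 \<Longrightarrow> D1 (z,t) = z"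
    "\<And>z t. z \<in> topspace Z \<Longrightarrow> 0 \<le> t \<Longrightarrow> t \<le> 1 \<Longrightarrow> w1 z \<le> t \<Longrightarrow> D1 (z,t) \<in> A"
    by (rule ndr_pairE) blast
  from assms(2) obtain w2 D2 where
    w2: "continuous_map Z euclideanreal w2" "\<And>z. z \<in> topspace Z \<Longrightarrow> 0 \<le> w2 z"
    and B: "B = {z \<in> topspace Z. w2 z = 0}" and D2: "continuous_map (prod_topology Z II) Z D2"
    "\<And>z. z \<in> topspace Z \<Longrightarrow> D2 (z,0) = z"
    "\<And>z t. z \<in> B \<Longrightarrow> 0 \<le> t \<Longrightarrow> t \<le> 1 \<Longrightarrow> D2 (z,t) = z"
    "\<And>z t. z \<in> topspace Z \<Longrightarrow> 0 \<le> t \<Longrightarrow> t \<le> 1 \<Longrightarrow> w2 z \<le> t \<Longrightarrow> D2 (z,t) \<in> B"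
    by (rule ndr_pairE) blast
  have pos: "max (w1 z) (w2 z) > 0" if "z \<in> topspace Z" for z
    using assms(3) that w1(2)[OF that] w2(2)[OF that] by (auto simp: A B)
  \<comment> \<open>The denominator is positive because \<open>A\<close> and \<open>B\<close> are
    disjoint. The quotient forces twice the smaller value to be at most the larger one on arrival;
    then their difference is at least the smaller value, and the clock does not stop before the
    nearer set is reached.\<close>
  let ?w = "\<lambda>z. max (min (w1 z) (w2 z)) (2 * min (w1 z) (w2 z) / max (w1 z) (w2 z))"
  let ?t2 = "\<lambda>p. min (snd p) (max 0 (w1 (fst p) - w2 (fst p)))"
  let ?t1 = "\<lambda>p. min (snd p) (max 0 (w2 (fst p) - w1 (fst p)))"
  let ?D = "\<lambda>p. D1 (D2 (fst p, ?t2 p), ?t1 p)"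
  have c1: "continuous_map Z euclideanreal ?w"
  proof (intro continuous_map_real_max continuous_map_real_min continuous_map_real_divide
      continuous_map_real_mult_left w1(1) w2(1))
    show "max (w1 z) (w2 z) \<noteq> 0" if "z \<in> topspace Z" for z using pos[OF that] by simp
  qed
  have ct: "continuous_map (prod_topology Z II) II ?t1" "continuous_map (prod_topology Z II) II ?t2"
    by (auto intro!: continuous_map_II_I continuous_intros continuous_map_comp[OF w1(1)]
        continuous_map_comp[OF w2(1)] cm_intros continuous_map_II_D[OF continuous_map_snd])
  have c2: "continuous_map (prod_topology Z II) Z ?D"
    by (intro continuous_map_comp[OF D1(1)] continuous_map_comp[OF D2(1)] continuous_map_pairedI ct cm_intros)
  have D_le: "?D (z,t) = (if w1 z \<le> w2 z then D1 (z, min t (w2 z - w1 z)) else D2 (z, min t (w1 z - w2 z)))"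
    if "z \<in> topspace Z" "t \<in> {0..1}" for z t
  proof -
    have D2Z: "D2 (z, s) \<in> topspace Z" if "0 \<le> s" "s \<le> 1" for s
      using continuous_map_in[OF D2(1), of "(z,s)"] that \<open>z \<in> topspace Z\<close> by simp
    show ?thesis
    proof (cases "w1 z \<le> w2 z")
      case True
      then have "max 0 (w1 z - w2 z) = 0" "max 0 (w2 z - w1 z) = w2 z - w1 z" by auto
      then show ?thesis using True that D2(2)[OF that(1)] by simp
    next
      case False
      then have m: "max 0 (w1 z - w2 z) = w1 z - w2 z" "max 0 (w2 z - w1 z) = 0" "0 \<le> min t (w1 z - w2 z)"
        "min t (w1 z - w2 z) \<le> 1" using that by auto
      show ?thesis using False that m(1,2) D1(2)[OF D2Z[OF m(3,4)]] by simp
    qed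
  qed
  have c3: "?D (z,t) \<in> A \<union> B" if z: "z \<in> topspace Z" and t: "t \<in> {0..1}" and le: "?w z \<le> t" for z t
  proof (cases "w1 z \<le> w2 z")
    case True
    then have mm: "min (w1 z) (w2 z) = w1 z" "max (w1 z) (w2 z) = w2 z" by auto
    have m: "0 < w2 z" "w1 z \<le> t" "2 * w1 z / w2 z \<le> t"
      using pos[OF z] le unfolding mm max.bounded_iff by auto
    then have "2 * w1 z / w2 z \<le> 1" using m(3) t unfolding atLeastAtMost_iff by linarith
    then have "2 * w1 z \<le> w2 z" using pos_divide_le_eq[OF m(1), of "2 * w1 z" 1] by simp
    then have "D1 (z, min t (w2 z - w1 z)) \<in> A" using m t z w1(2)[OF z] by (intro D1(4)) auto
    then show ?thesis using D_le[OF z t] True by simp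
  next
    case False
    then have mm: "min (w1 z) (w2 z) = w2 z" "max (w1 z) (w2 z) = w1 z" by auto
    have m: "0 < w1 z" "w2 z \<le> t" "2 * w2 z / w1 z \<le> t"
      using pos[OF z] le unfolding mm max.bounded_iff by auto
    then have "2 * w2 z / w1 z \<le> 1" using m(3) t unfolding atLeastAtMost_iff by linarith
    then have "2 * w2 z \<le> w1 z" using pos_divide_le_eq[OF m(1), of "2 * w2 z" 1] by simp
    then have "D2 (z, min t (w1 z - w2 z)) \<in> B" using m t z w2(2)[OF z] by (intro D2(4)) auto
    then show ?thesis using D_le[OF z t] False by simp
  qed
  have c4: "?D (z,t) = z" if z: "z \<in> A \<union> B" and t: "t \<in> {0..1}" for z t
  proof -
    have zZ: "z \<in> topspace Z" using z A B by auto
    show ?thesis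
    proof (cases "w1 z \<le> w2 z")
      case True
      then have "z \<in> A" using z w1(2)[OF zZ] by (auto simp: A B)
      then show ?thesis using True D_le[OF zZ t] D1(3) t by auto
    next
      case False
      then have "z \<in> B" using z w2(2)[OF zZ] by (auto simp: A B)
      then show ?thesis using False D_le[OF zZ t] D2(3) t by auto
    qed
  qed
  show ?thesis
    unfolding ndr_pair_def
  proof (rule exI[of _ ?w], rule exI[of _ ?D], intro conjI ballI impI)
    show "0 \<le> ?w z" if "z \<in> topspace Z" for z
      using w1(2)[OF that] w2(2)[OF that] by (auto simp: max_def)
    show "A \<union> B = {z \<in> topspace Z. ?w z = 0}"
    proof (intro set_eqI iffI)
      fix z assume "z \<in> A \<union> B"
      then show "z \<in> {z \<in> topspace Z. ?w z = 0}" using w1(2)[of z] w2(2)[of z] by (auto simp: A B min_def)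
    next
      fix z assume z: "z \<in> {z \<in> topspace Z. ?w z = 0}"
      then have "min (w1 z) (w2 z) \<le> 0" by (metis (mono_tags, lifting) max.cobounded1 mem_Collect_eq)
      then show "z \<in> A \<union> B" using z w1(2)[of z] w2(2)[of z] by (auto simp: A B min_def split: if_splits)
    qed
    show "?D (z,0) = z" if "z \<in> topspace Z" for z
      using that D_le[OF that, of 0] D1 D2 by (auto simp: min_def split: if_splits)
  qed (use c1 c2 c3 c4 in auto)
qed

text \<open>Up to time \<open>w z\<close> the deformation is followed by \<open>F\<close>; from then
  on \<open>D (z,t)\<close> lies in \<open>A\<close>, and \<open>G\<close> acts on it with a clock
  started at \<open>w z\<close>. On \<open>A\<close> itself \<open>w\<close> vanishes and
  \<open>D\<close> rests, so \<open>G\<close> appears unchanged.\<close>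

lemma ndr_pair_HEP:
  assumes ndr: "ndr_pair Z A"
    and F: "continuous_map Z Y F" and G: "continuous_map (prod_topology (subtopology Z A) II) Y G"
    and FG: "\<And>a. a \<in> A \<Longrightarrow> G (a,0) = F a"
  obtains H where "continuous_map (prod_topology Z II) Y H"
    "\<And>z. z \<in> topspace Z \<Longrightarrow> H (z,0) = F z" "\<And>a t. a \<in> A \<Longrightarrow> 0 \<le> t \<Longrightarrow> t \<le> 1 \<Longrightarrow> H (a,t) = G (a,t)"
proof -
  from ndr obtain w D where
    w: "continuous_map Z euclideanreal w" "\<And>z. z \<in> topspace Z \<Longrightarrow> 0 \<le> w z"
    and A: "A = {z \<in> topspace Z. w z = 0}" and D: "continuous_map (prod_topology Z II) Z D"
    "\<And>z. z \<in> topspace Z \<Longrightarrow> D (z,0) = z"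
    "\<And>z t. z \<in> A \<Longrightarrow> 0 \<le> t \<Longrightarrow> t \<le> 1 \<Longrightarrow> D (z,t) = z"
    "\<And>z t. z \<in> topspace Z \<Longrightarrow> 0 \<le> t \<Longrightarrow> t \<le> 1 \<Longrightarrow> w z \<le> t \<Longrightarrow> D (z,t) \<in> A"
    by (rule ndr_pairE) blast
  let ?P = "prod_topology Z II"
  let ?H = "\<lambda>p. if snd p \<le> w (fst p) then F (D p) else G (D p, snd p - w (fst p))"
  have cs: "continuous_map ?P euclideanreal snd" by (rule continuous_map_II_D[OF continuous_map_snd])
  have cw: "continuous_map ?P euclideanreal (\<lambda>p. w (fst p))" by (intro continuous_map_comp[OF w(1)] cm_intros)
  have "continuous_map ?P Y ?H"
  proof (rule continuous_map_cases_le[OF cs cw])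
    show "continuous_map (subtopology ?P {x \<in> topspace ?P. snd x \<le> w (fst x)}) Y (\<lambda>p. F (D p))"
      by (intro continuous_map_from_subtopology continuous_map_comp[OF F] D(1))
    show "continuous_map (subtopology ?P {x \<in> topspace ?P. w (fst x) \<le> snd x}) Y (\<lambda>p. G (D p, snd p - w (fst p)))"
    proof (intro continuous_map_comp[OF G] continuous_map_pairedI continuous_map_into_sub)
      show "continuous_map (subtopology ?P {x \<in> topspace ?P. w (fst x) \<le> snd x}) euclideanreal (\<lambda>p. snd p - w (fst p))"
        by (intro continuous_map_diff continuous_map_from_subtopology cs cw)
      show "continuous_map (subtopology ?P {x \<in> topspace ?P. w (fst x) \<le> snd x}) Z D"
        by (intro continuous_map_from_subtopology D(1))
      show "D x \<in> A" if "x \<in> topspace (subtopology ?P {x \<in> topspace ?P. w (fst x) \<le> snd x})" for x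
        using that D(4)[of "fst x" "snd x"] by auto
      show "snd x - w (fst x) \<in> {0..1}" if "x \<in> topspace (subtopology ?P {x \<in> topspace ?P. w (fst x) \<le> snd x})" for x
        using that w(2)[of "fst x"] by auto
    qed
    show "F (D x) = G (D x, snd x - w (fst x))" if "x \<in> topspace ?P" "snd x = w (fst x)" for x
      using that FG D(4)[of "fst x" "snd x"] by auto
  qed
  moreover have "?H (z,0) = F z" if "z \<in> topspace Z" for z
    using that D(2) w(2) by auto
  moreover have "?H (a,t) = G (a,t)" if "a \<in> A" "0 \<le> t" "t \<le> 1" for a t
    using that D(3) FG A by (cases "t = 0") auto
  ultimately show thesis by (rule that)
qed

text \<open>Expansion away from 1/2, clipped to the interval. At time 1 everything outside
  [1/3, 2/3] has arrived at an end, and the factor 4 makes \<open>?u t < 1\<close> mean distance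
  less than 1/4 from an end.\<close>

lemma ndr_pair_II: "ndr_pair II {0,1}"
proof (rule ndr_pairI)
  let ?u = "\<lambda>t::real. 4 * min t (1 - t)"
  let ?h = "\<lambda>p::real\<times>real. max 0 (min 1 (snd p + fst p * (2 * snd p - 1)))"
  show "continuous_map II euclideanreal ?u"
    by (auto intro!: continuous_intros)
  show "continuous_map (prod_topology II II) II ?h"
    by (auto intro!: continuous_map_II_I continuous_intros continuous_map_II_D[OF continuous_map_snd]
        continuous_map_II_D[OF continuous_map_fst])
  show "{0,1} = {z \<in> topspace II. ?u z = 0}" by (auto simp: min_def)
  show "?h (1,z) \<in> {0,1}" if "z \<in> topspace II" "?u z < 1" for z
    using that by (auto simp: min_def max_def split: if_splits)
qed (auto simp: min_def max_def)

text \<open>Filling an open box: \<open>N\<close> is the floor, \<open>P0\<close>, \<open>P1\<close>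
  and \<open>B\<close> are the walls over \<open>Z \<times> {0}\<close>,
  \<open>Z \<times> {1}\<close> and \<open>A \<times> I\<close>, and \<open>M\<close> is the lid.
  This is homotopy extension for the product of \<open>(Z, A)\<close> with the interval and its two
  ends.\<close>

lemma ndr_rel_fill:
  assumes ndr: "ndr_pair Z A"
    and N: "continuous_map (prod_topology Z II) Y N"
    and P: "continuous_map (prod_topology Z II) Y P0" "continuous_map (prod_topology Z II) Y P1"
    and B: "continuous_map (prod_topology (prod_topology (subtopology Z A) II) II) Y B"
    and P0: "\<And>z. z \<in> topspace Z \<Longrightarrow> P0 (z,0) = N (z,0)"
    and P1: "\<And>z. z \<in> topspace Z \<Longrightarrow> P1 (z,0) = N (z,1)"
    and BN: "\<And>a t. a \<in> A \<Longrightarrow> 0 \<le> t \<Longrightarrow> t \<le> 1 \<Longrightarrow> B ((a,t),0) = N (a,t)"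
    and BP: "\<And>a s. a \<in> A \<Longrightarrow> 0 \<le> s \<Longrightarrow> s \<le> 1 \<Longrightarrow> B ((a,0),s) = P0 (a,s)"
      "\<And>a s. a \<in> A \<Longrightarrow> 0 \<le> s \<Longrightarrow> s \<le> 1 \<Longrightarrow> B ((a,1),s) = P1 (a,s)"
  obtains M where "continuous_map (prod_topology Z II) Y M"
    "\<And>z. z \<in> topspace Z \<Longrightarrow> M (z,0) = P0 (z,1)" "\<And>z. z \<in> topspace Z \<Longrightarrow> M (z,1) = P1 (z,1)"
    "\<And>a t. a \<in> A \<Longrightarrow> 0 \<le> t \<Longrightarrow> t \<le> 1 \<Longrightarrow> M (a,t) = B ((a,t),1)"
proof -
  let ?P = "prod_topology Z II"
  let ?C = "topspace Z \<times> {0,1} \<union> A \<times> topspace II"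
  have ndr2: "ndr_pair ?P ?C" by (rule ndr_pair_prod[OF ndr ndr_pair_II])
  define G where "G = (\<lambda>((z,t),s). if t = 0 then P0 (z,s) else if t = 1 then P1 (z,s) else B ((z,t),s))"
  have AZ: "A \<subseteq> topspace Z" using ndr by (rule ndr_pair_subset)
  have cA: "closedin Z A" using ndr by (rule ndr_pair_closedin)
  let ?Q = "prod_topology ?P II"
  have cl: "closedin ?Q ((topspace Z \<times> {0}) \<times> topspace II)" "closedin ?Q ((topspace Z \<times> {1}) \<times> topspace II)"
     "closedin ?Q ((A \<times> topspace II) \<times> topspace II)"
    using cA closed_subset[of "{0::real}" "{0..1}"] closed_subset[of "{1::real}" "{0..1}"]
    by (auto simp: closedin_prod_Times_iff simp del: topspace_euclidean_subtopology)
  have g0: "continuous_map (subtopology ?Q ((topspace Z \<times> {0}) \<times> topspace II)) Y G"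
  proof (rule continuous_map_eq)
    show "continuous_map (subtopology ?Q ((topspace Z \<times> {0}) \<times> topspace II)) Y (\<lambda>p. P0 (fst (fst p), snd p))"
      by (intro continuous_map_from_subtopology continuous_map_comp[OF P(1)] continuous_map_pairedI cm_proj continuous_map_snd)
  qed (auto simp: G_def)
  have g1: "continuous_map (subtopology ?Q ((topspace Z \<times> {1}) \<times> topspace II)) Y G"
  proof (rule continuous_map_eq)
    show "continuous_map (subtopology ?Q ((topspace Z \<times> {1}) \<times> topspace II)) Y (\<lambda>p. P1 (fst (fst p), snd p))"
      by (intro continuous_map_from_subtopology continuous_map_comp[OF P(2)] continuous_map_pairedI cm_proj continuous_map_snd)
  qed (auto simp: G_def)
  have gA: "continuous_map (subtopology ?Q ((A \<times> topspace II) \<times> topspace II)) Y G"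
  proof (rule continuous_map_eq)
    show "continuous_map (subtopology ?Q ((A \<times> topspace II) \<times> topspace II)) Y B"
      using B by (simp add: prod_topology_subtopology_left)
  qed (auto simp: G_def BP)
  have eqC: "(topspace Z \<times> {0}) \<times> topspace II \<union> (topspace Z \<times> {1}) \<times> topspace II \<union> (A \<times> topspace II) \<times> topspace II
      = ?C \<times> topspace II" by auto
  have "continuous_map (subtopology ?Q (?C \<times> topspace II)) Y G"
    unfolding eqC[symmetric]
    by (intro continuous_map_union_closed closedin_Un cl g0 g1 gA)
  then have G: "continuous_map (prod_topology (subtopology ?P ?C) II) Y G"
    by (simp add: prod_topology_subtopology_left)
  have GN: "G (p,0) = N p" if "p \<in> ?C" for p
    using that P0 P1 BN AZ by (auto simp: G_def)
  show thesis
  proof (rule ndr_pair_HEP[OF ndr2 N G GN])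
    fix H assume H: "continuous_map (prod_topology ?P II) Y H"
      and HG: "\<And>a t. a \<in> ?C \<Longrightarrow> 0 \<le> t \<Longrightarrow> t \<le> 1 \<Longrightarrow> H (a,t) = G (a,t)"
    show thesis
    proof (rule that[of "\<lambda>p. H (p,1)"])
      show "continuous_map ?P Y (\<lambda>p. H (p,1))"
        by (intro continuous_map_comp[OF H] cm_intros) auto
      show "H ((z,0),1) = P0 (z,1)" "H ((z,1),1) = P1 (z,1)" if "z \<in> topspace Z" for z
        using that by (auto simp: HG G_def)
      show "H ((a,t),1) = B ((a,t),1)" if "a \<in> A" "0 \<le> t" "t \<le> 1" for a t
        using that by (auto simp: HG G_def BP)
    qed
  qed
qed

text \<open>Over \<open>A\<close> the homotopy \<open>N\<close> runs along \<open>l\<close>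
  backwards and then forwards. In the wall, \<open>max \<bar>2 * t - 1\<bar> s\<close> cuts off the
  part of this loop below level \<open>s\<close>; at \<open>s = 1\<close> only the constant
  \<open>l (a,1)\<close> is left, and the ends \<open>t = 0\<close> and \<open>t = 1\<close> never
  move.\<close>

lemma ndr_straighten:
  assumes ndr: "ndr_pair Z A"
    and N: "continuous_map (prod_topology Z II) Y N"
    and l: "continuous_map (prod_topology (subtopology Z A) II) Y l"
    and Nl: "\<And>a t. a \<in> A \<Longrightarrow> 0 \<le> t \<Longrightarrow> t \<le> 1 \<Longrightarrow> N (a,t) = l (a, \<bar>2 * t - 1\<bar>)"
  obtains M where "continuous_map (prod_topology Z II) Y M"
    "\<And>z. z \<in> topspace Z \<Longrightarrow> M (z,0) = N (z,0)" "\<And>z. z \<in> topspace Z \<Longrightarrow> M (z,1) = N (z,1)"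
    "\<And>a t. a \<in> A \<Longrightarrow> 0 \<le> t \<Longrightarrow> t \<le> 1 \<Longrightarrow> M (a,t) = l (a,1)"
proof -
  let ?B = "\<lambda>p. l (fst (fst p), max \<bar>2 * snd (fst p) - 1\<bar> (snd p))"
  let ?Q = "prod_topology (prod_topology (subtopology Z A) II) II"
  have "continuous_map ?Q Y ?B"
  proof (intro continuous_map_comp[OF l] continuous_map_pairedI continuous_map_fstI continuous_map_II_I)
    show "continuous_map ?Q euclideanreal (\<lambda>x. max \<bar>2 * snd (fst x) - 1\<bar> (snd x))"
      by (intro continuous_intros continuous_map_II_D[OF continuous_map_snd]
          continuous_map_II_D[OF continuous_map_sndI[OF continuous_map_fst]])
  qed (auto intro: cm_intros)
  moreover have "continuous_map (prod_topology Z II) Y (\<lambda>p. N (fst p, 0))"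
    "continuous_map (prod_topology Z II) Y (\<lambda>p. N (fst p, 1))"
    by (intro continuous_map_comp[OF N] cm_intros; simp)+
  moreover note c = calculation
  show thesis
  proof (rule ndr_rel_fill[OF ndr N c(2,3,1)])
    fix M assume M: "continuous_map (prod_topology Z II) Y M"
      "\<And>z. z \<in> topspace Z \<Longrightarrow> M (z,0) = N (fst (z, 1::real), 0)"
      "\<And>z. z \<in> topspace Z \<Longrightarrow> M (z,1) = N (fst (z, 1::real), 1)"
      "\<And>a t. a \<in> A \<Longrightarrow> 0 \<le> t \<Longrightarrow> t \<le> 1 \<Longrightarrow> M (a,t) = ?B ((a,t),1)"
    show thesis by (rule that[of M]) (use M in \<open>auto simp: max_def abs_if\<close>)
  qed (auto simp: Nl max_def)
qed

section \<open>Discs\<close>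

abbreviation l2 :: "nat \<Rightarrow> (nat \<Rightarrow> real) \<Rightarrow> real" where "l2 n v \<equiv> L2_set v {..<n}"

definition disc_boundary :: "nat \<Rightarrow> (nat \<Rightarrow> real) set" where
  "disc_boundary n = topspace (unit_disc n) - topspace (unit_open_disc n)"

lemma l2_le_1: "(\<Sum>i<n. (v i)\<^sup>2) \<le> 1 \<longleftrightarrow> l2 n v \<le> 1"
  by (simp add: L2_set_def)

lemma l2_less_1: "(\<Sum>i<n. (v i)\<^sup>2) < 1 \<longleftrightarrow> l2 n v < 1"
  by (simp add: L2_set_def)

lemma topspace_unit_disc: "topspace (unit_disc n) = {v. (\<forall>i\<ge>n. v i = 0) \<and> l2 n v \<le> 1}"
  unfolding unit_disc_def topspace_subtopology topspace_Euclidean_space l2_le_1 by auto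

lemma topspace_unit_open_disc: "topspace (unit_open_disc n) = {v. (\<forall>i\<ge>n. v i = 0) \<and> l2 n v < 1}"
  unfolding unit_open_disc_def topspace_subtopology topspace_Euclidean_space l2_less_1 by auto

lemma disc_boundary_eq: "disc_boundary n = {v. (\<forall>i\<ge>n. v i = 0) \<and> l2 n v = 1}"
  unfolding disc_boundary_def topspace_unit_disc topspace_unit_open_disc by force

lemma disc_boundary_subset: "disc_boundary n \<subseteq> topspace (unit_disc n)"
  by (auto simp: disc_boundary_def)

lemma zero_in_unit_disc: "(\<lambda>_. 0) \<in> topspace (unit_disc n)"
  by (simp add: topspace_unit_disc L2_set_def)

lemma continuous_map_into_disc:
  assumes "\<And>i. i < n \<Longrightarrow> continuous_map W euclideanreal (\<lambda>w. f w i)"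
    and "\<And>w i. w \<in> topspace W \<Longrightarrow> n \<le> i \<Longrightarrow> f w i = 0"
    and "\<And>w. w \<in> topspace W \<Longrightarrow> l2 n (f w) \<le> 1"
  shows "continuous_map W (unit_disc n) f"
  unfolding unit_disc_def l2_le_1
proof (rule continuous_map_into_sub)
  have "continuous_map W (Euclidean_space n) (\<lambda>w i. if i < n then f w i else 0)"
    using assms(1) by (simp add: continuous_map_componentwise_Euclidean_space)
  then show "continuous_map W (Euclidean_space n) f"
    by (rule continuous_map_eq) (use assms(2) in auto)
qed (use assms(3) in auto)

lemma continuous_map_disc_coord:
  assumes "continuous_map W (unit_disc n) f"
  shows "continuous_map W euclideanreal (\<lambda>w. f w i)"
proof -
  have "continuous_map W (powertop_real UNIV) f"
    using assms unfolding unit_disc_def Euclidean_space_def by (auto simp: continuous_map_in_subtopology)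
  then show ?thesis by (simp add: continuous_map_componentwise_UNIV)
qed

lemma continuous_map_l2:
  assumes "\<And>i. i < n \<Longrightarrow> continuous_map W euclideanreal (\<lambda>w. f w i)"
  shows "continuous_map W euclideanreal (\<lambda>w. l2 n (f w))"
proof -
  have "continuous_map W euclideanreal (\<lambda>w. \<Sum>i<n. (f w i)\<^sup>2)"
    using assms by (intro continuous_intros) auto
  then have "continuous_map W euclideanreal (\<lambda>w. sqrt (\<Sum>i<n. (f w i)\<^sup>2))"
    by (rule continuous_map_comp[rotated]) (simp add: continuous_on_real_sqrt)
  then show ?thesis by (simp add: L2_set_def)
qed

lemma Hausdorff_unit_disc: "Hausdorff_space (unit_disc n)"
  unfolding unit_disc_def by (intro Hausdorff_space_subtopology Hausdorff_Euclidean_space)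

lemma compact_unit_disc: "compact_space (unit_disc n)"
proof -
  let ?S = "topspace (unit_disc n)"
  let ?B = "PiE UNIV (\<lambda>_. {-1..1::real}) :: (nat \<Rightarrow> real) set"
  have cB: "compactin (powertop_real UNIV) ?B"
    by (simp add: compactin_PiE)
  have co: "continuous_map (powertop_real UNIV) euclideanreal (\<lambda>v::nat \<Rightarrow> real. v i)" for i
    by (rule continuous_map_product_projection) simp
  have "closedin (powertop_real UNIV) {v \<in> topspace (powertop_real UNIV). l2 n v \<in> {..1}}"
    by (rule closedin_continuous_map_preimage[where Y = euclideanreal]) (auto intro!: continuous_map_l2 co)
  then have "closedin (powertop_real UNIV) (topspace (Euclidean_space n) \<inter> {v. l2 n v \<le> 1})"
    using closedin_Int[OF closedin_Euclidean_space] by (simp add: topspace_Euclidean_space)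
  moreover have "topspace (Euclidean_space n) \<inter> {v. l2 n v \<le> 1} = ?S"
    by (auto simp: topspace_Euclidean_space topspace_unit_disc)
  ultimately have cS: "closedin (powertop_real UNIV) ?S" by simp
  have "?S \<subseteq> ?B"
  proof
    fix v assume v: "v \<in> ?S"
    have "\<bar>v i\<bar> \<le> 1" for i
    proof (cases "i < n")
      case True
      have "\<bar>v i\<bar> \<le> L2_set (\<lambda>i. \<bar>v i\<bar>) {..<n}" using True by (intro member_le_L2_set) auto
      also have "\<dots> = l2 n v" by (simp add: L2_set_def)
      finally show ?thesis using v by (simp add: topspace_unit_disc)
    qed (use v in \<open>simp add: topspace_unit_disc\<close>)
    then show "v \<in> ?B" by (auto simp: abs_le_iff)
  qed
  then have "compactin (powertop_real UNIV) ?S" using closed_compactin[OF cB _ cS] by blast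
  moreover have "unit_disc n = subtopology (powertop_real UNIV) ?S"
    unfolding unit_disc_def Euclidean_space_def subtopology_subtopology
    by (rule arg_cong[where f = "subtopology (powertop_real UNIV)"]) auto
  ultimately show ?thesis by (metis compact_space_subtopology)
qed

lemma l2_scale: "0 \<le> c \<Longrightarrow> l2 n (\<lambda>i. c * v i) = c * l2 n v"
  by (simp add: L2_set_right_distrib)

lemma l2_div: "0 < c \<Longrightarrow> l2 n (\<lambda>i. v i / c) = l2 n v / c"
  using l2_scale[of "inverse c" v n] by (simp add: divide_inverse mult.commute)

lemma continuous_map_disc_scale:
  "continuous_map (prod_topology II (unit_disc n)) (unit_disc n) (\<lambda>p i. fst p * snd p i)"
proof (rule continuous_map_into_disc)
  show "continuous_map (prod_topology II (unit_disc n)) euclideanreal (\<lambda>p. fst p * snd p i)" for i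
    by (intro continuous_map_real_mult continuous_map_II_D[OF continuous_map_fst]
        continuous_map_disc_coord[OF continuous_map_snd])
  show "l2 n (\<lambda>i. fst p * snd p i) \<le> 1" if "p \<in> topspace (prod_topology II (unit_disc n))" for p
  proof -
    obtain t z where p: "p = (t,z)" by (cases p)
    have "0 \<le> t" "t \<le> 1" "l2 n z \<le> 1" using that by (auto simp: p topspace_unit_disc)
    then show ?thesis using mult_le_one[of t "l2 n z"] by (simp add: p l2_scale L2_set_nonneg)
  qed
qed (auto simp: topspace_unit_disc)

text \<open>Radial expansion by the factor \<open>1 + t\<close>, clipped at the sphere. The
  condition \<open>?u z < 1\<close> says that the norm exceeds 1/2, and doubling pushes such points
  to the sphere. For \<open>n = 0\<close> the boundary is empty and \<open>?u\<close> is constantly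
  2.\<close>

lemma ndr_disc_boundary: "ndr_pair (unit_disc n) (disc_boundary n)"
proof (rule ndr_pairI)
  let ?D = "unit_disc n"
  let ?u = "\<lambda>z. 2 * (1 - l2 n z)"
  let ?h = "\<lambda>p i. (1 + fst p) * snd p i / max 1 ((1 + fst p) * l2 n (snd p))"
  have co: "continuous_map ?D euclideanreal (\<lambda>z. z i)" for i
    by (intro continuous_map_disc_coord[where n = n] cm_intros)
  show "continuous_map ?D euclideanreal ?u"
    by (intro continuous_intros continuous_map_l2 co) auto
  show "0 \<le> ?u z" if "z \<in> topspace ?D" for z using that by (simp add: topspace_unit_disc)
  show "disc_boundary n = {z \<in> topspace ?D. ?u z = 0}"
    by (auto simp: disc_boundary_eq topspace_unit_disc)
  have l: "l2 n (?h (t,z)) = (1 + t) * l2 n z / max 1 ((1 + t) * l2 n z)" if "0 \<le> t" for t z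
    using that by (simp add: l2_div l2_scale)
  show "continuous_map (prod_topology II ?D) ?D ?h"
  proof (rule continuous_map_into_disc)
    let ?P = "prod_topology II ?D"
    have cs: "continuous_map ?P euclideanreal (\<lambda>p. snd p i)" for i
      by (intro continuous_map_disc_coord[where n = n] cm_intros)
    have cf: "continuous_map ?P euclideanreal fst" by (rule continuous_map_II_D[OF continuous_map_fst])
    show "continuous_map ?P euclideanreal (\<lambda>p. ?h p i)" for i
      by (intro continuous_map_real_divide continuous_map_real_mult continuous_map_real_max
          continuous_map_add continuous_map_l2 cs cf) auto
    show "l2 n (?h p) \<le> 1" if "p \<in> topspace ?P" for p
      using that l[of "fst p" "snd p"] by (auto simp: divide_le_eq)
    show "?h p i = 0" if "p \<in> topspace ?P" "n \<le> i" for p i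
      using that by (auto simp: topspace_unit_disc)
  qed
  show "?h (0,z) = z" if "z \<in> topspace ?D" for z
    using that by (auto simp: topspace_unit_disc max_def fun_eq_iff)
  show "?h (t,z) = z" if "z \<in> disc_boundary n" "0 \<le> t" "t \<le> 1" for z t
    using that by (auto simp: disc_boundary_eq max_def fun_eq_iff)
  show "?h (1,z) \<in> disc_boundary n" if "z \<in> topspace ?D" "?u z < 1" for z
  proof -
    have "2 * l2 n z > 1" using that by simp
    then have "l2 n (?h (1,z)) = 1" using l[of 1 z] by (simp add: max_def)
    then show ?thesis using that by (simp add: disc_boundary_eq topspace_unit_disc)
  qed
qed

text \<open>The straight-line contraction brings the whole disc to \<open>z0\<close> at time 1, so
  the distance from \<open>z0\<close> can serve as \<open>?u\<close> without any rescaling.\<close>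

lemma ndr_disc_point:
  assumes z0: "z0 \<in> topspace (unit_disc n)"
  shows "ndr_pair (unit_disc n) {z0}"
proof (rule ndr_pairI)
  let ?D = "unit_disc n"
  let ?u = "\<lambda>z. l2 n (\<lambda>i. z i - z0 i)"
  let ?h = "\<lambda>p i. (1 - fst p) * snd p i + fst p * z0 i"
  have co: "continuous_map ?D euclideanreal (\<lambda>z. z i)" for i
    by (intro continuous_map_disc_coord[where n = n] cm_intros)
  show "continuous_map ?D euclideanreal ?u"
    by (intro continuous_map_l2 continuous_map_diff co) auto
  show "{z0} = {z \<in> topspace ?D. ?u z = 0}"
  proof -
    have "z = z0" if "z \<in> topspace ?D" "?u z = 0" for z
    proof
      fix i show "z i = z0 i"
      proof (cases "i < n")
        case True
        then show ?thesis using that(2) by (auto simp: L2_set_eq_0_iff)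
      qed (use that z0 in \<open>simp add: topspace_unit_disc\<close>)
    qed
    moreover have "?u z0 = 0" by (simp add: L2_set_def)
    ultimately show ?thesis using z0 by blast
  qed
  show "continuous_map (prod_topology II ?D) ?D ?h"
  proof (rule continuous_map_into_disc)
    let ?P = "prod_topology II ?D"
    have cs: "continuous_map ?P euclideanreal (\<lambda>p. snd p i)" for i
      by (intro continuous_map_disc_coord[where n = n] cm_intros)
    have cf: "continuous_map ?P euclideanreal fst" by (rule continuous_map_II_D[OF continuous_map_fst])
    show "continuous_map ?P euclideanreal (\<lambda>p. ?h p i)" for i
      by (intro continuous_map_real_mult continuous_map_add continuous_map_diff cs cf) auto
    show "l2 n (?h p) \<le> 1" if "p \<in> topspace ?P" for p
    proof -
      obtain t z where p: "p = (t,z)" by (cases p)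
      have t: "0 \<le> t" "t \<le> 1" "l2 n z \<le> 1" using that by (auto simp: p topspace_unit_disc)
      have "l2 n (?h p) \<le> l2 n (\<lambda>i. (1-t) * z i) + l2 n (\<lambda>i. t * z0 i)"
        unfolding p by (simp add: L2_set_triangle_ineq)
      also have "\<dots> = (1-t) * l2 n z + t * l2 n z0" using t by (simp add: l2_scale)
      also have "\<dots> \<le> (1-t) * 1 + t * 1"
        using t z0 by (intro add_mono mult_left_mono) (auto simp: topspace_unit_disc)
      finally show ?thesis by simp
    qed
    show "?h p i = 0" if "p \<in> topspace ?P" "n \<le> i" for p i
      using that z0 by (auto simp: topspace_unit_disc)
  qed
qed (auto simp: algebra_simps)

text \<open>The map \<open>(b, t) \<mapsto> ((1 + t) b, t (1 - \<parallel>b\<parallel>))\<close> flattens the bottom and the sides of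
  \<open>(D \<times> D) \<times> I\<close> to height zero. There, the diagonal is reached by soft thresholding the difference of
  the two coordinates by the height. The parameter \<open>t2\<close> below is the inverse of the flattening map,
  a root of a quadratic equation.\<close>

lemma flatten_inverse:
  fixes p q :: real
  assumes "0 \<le> p" "0 \<le> q"
  defines "t2 \<equiv> (p + q - 1 + sqrt ((1 + p + q)\<^sup>2 - 4 * p)) / 2"
  shows "0 \<le> t2" "p \<le> 1 + t2" "q = 0 \<Longrightarrow> t2 = max 0 (p - 1)"
proof -
  \<comment> \<open>Writing \<open>p = (1 + t) * b\<close> and \<open>q = t * (1 - b)\<close> gives
    \<open>b + t = p + q\<close>. Eliminating \<open>b\<close> leaves the equation t^2 - (p + q - 1)
    t - q = 0, whose discriminant is the expression under the root; \<open>t2\<close> is its larger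
    solution.\<close>
  have "\<bar>1 - p - q\<bar> \<le> sqrt ((1 + p + q)\<^sup>2 - 4 * p)"
    using assms by (intro real_le_rsqrt) (simp add: power2_eq_square algebra_simps)
  then show "0 \<le> t2" by (simp add: t2_def)
  have "(p - q - 1)\<^sup>2 \<le> (1 + p + q)\<^sup>2 - 4 * p"
    using mult_nonneg_nonneg[OF assms(1,2)] by (simp add: power2_eq_square algebra_simps)
  then have "p - q - 1 \<le> sqrt ((1 + p + q)\<^sup>2 - 4 * p)"
    by (rule real_le_rsqrt)
  moreover have "p \<le> 1 + (p + q - 1 + s) / 2" if "p - q - 1 \<le> s" for s
    using that by (simp add: field_simps)
  ultimately show "p \<le> 1 + t2" unfolding t2_def by blast
  assume "q = 0"
  then have "(1 + p + q)\<^sup>2 - 4 * p = (1 - p)\<^sup>2" by (simp add: power2_eq_square algebra_simps)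
  then show "t2 = max 0 (p - 1)" using \<open>q = 0\<close> by (simp add: t2_def max_def)
qed

text \<open>A pair of points is measured by the larger of the two norms, whose unit sphere is the
  boundary of the product of discs. On bottom and walls the flattened height is 0 and thresholding
  does nothing; over the diagonal the difference is 0 and the whole height is kept. In both cases
  the inverse flattening returns the original point.\<close>

lemma disc_diagonal_retraction:
  obtains ret where
    "continuous_map (prod_topology (prod_topology (unit_disc n) (unit_disc n)) II)
       (prod_topology (prod_topology (unit_disc n) (unit_disc n)) II) ret"
    "\<And>b. b \<in> topspace (unit_disc n) \<times> topspace (unit_disc n) \<Longrightarrow> ret (b,0) = (b,0)"
    "\<And>z z' t. \<lbrakk>z \<in> topspace (unit_disc n); z' \<in> topspace (unit_disc n); 0 \<le> t; t \<le> 1;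
        z \<in> disc_boundary n \<or> z' \<in> disc_boundary n\<rbrakk> \<Longrightarrow> ret ((z,z'),t) = ((z,z'),t)"
    "\<And>z t. \<lbrakk>z \<in> topspace (unit_disc n); 0 \<le> t; t \<le> 1\<rbrakk> \<Longrightarrow> ret ((z,z),t) = ((z,z),t)"
    "\<And>z z' t. \<lbrakk>z \<in> topspace (unit_disc n); z' \<in> topspace (unit_disc n); 0 \<le> t; t \<le> 1\<rbrakk> \<Longrightarrow>
       snd (ret ((z,z'),t)) = 0 \<or> fst (fst (ret ((z,z'),t))) \<in> disc_boundary n
       \<or> snd (fst (ret ((z,z'),t))) \<in> disc_boundary n
       \<or> fst (fst (ret ((z,z'),t))) = snd (fst (ret ((z,z'),t)))"
proof -
  let ?D = "unit_disc n"
  let ?P = "prod_topology (prod_topology ?D ?D) II"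
  define Z where "Z = (\<lambda>x::((nat\<Rightarrow>real)\<times>(nat\<Rightarrow>real))\<times>real. fst (fst x))"
  define Z' where "Z' = (\<lambda>x::((nat\<Rightarrow>real)\<times>(nat\<Rightarrow>real))\<times>real. snd (fst x))"
  define T where "T = (\<lambda>x::((nat\<Rightarrow>real)\<times>(nat\<Rightarrow>real))\<times>real. snd x)"
  define \<eta> where "\<eta> = (\<lambda>x. T x * (1 - max (l2 n (Z x)) (l2 n (Z' x))))"
  define v where "v = (\<lambda>x i. (1 + T x) * (Z x i - Z' x i) / 2)"
  define m where "m = (\<lambda>x i. (1 + T x) * (Z x i + Z' x i) / 2)"
  \<comment> \<open>Soft thresholding of the half-difference: each coordinate moves towards 0 by at
    most \<open>\<eta>\<close>. The remaining height \<open>q\<close> is positive only if the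
    Euclidean norm of \<open>v\<close> is below \<open>\<eta>\<close>. Then so is each coordinate of
    \<open>v\<close>; hence \<open>s\<close> vanishes and the point is on the diagonal.\<close>
  define s where "s = (\<lambda>x i. max 0 (v x i - \<eta> x) + min 0 (v x i + \<eta> x))"
  define q where "q = (\<lambda>x. max 0 (\<eta> x - l2 n (v x)))"
  define c where "c = (\<lambda>x i. m x i + s x i)"
  define c' where "c' = (\<lambda>x i. m x i - s x i)"
  define p where "p = (\<lambda>x. max (l2 n (c x)) (l2 n (c' x)))"
  define t2 where "t2 = (\<lambda>x. (p x + q x - 1 + sqrt ((1 + p x + q x)\<^sup>2 - 4 * p x)) / 2)"
  define ret where "ret = (\<lambda>x. ((\<lambda>i. c x i / (1 + t2 x), \<lambda>i. c' x i / (1 + t2 x)), min 1 (t2 x)))"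
  note defs = Z_def Z'_def T_def
  have p0: "0 \<le> p x" and q0: "0 \<le> q x" for x
    by (auto simp: p_def q_def L2_set_nonneg le_max_iff_disj)
  have t2: "0 \<le> t2 x" "p x \<le> 1 + t2 x" "q x = 0 \<Longrightarrow> t2 x = max 0 (p x - 1)" for x
    unfolding t2_def using flatten_inverse[OF p0 q0] by blast+
  have cT: "continuous_map ?P euclideanreal T"
    unfolding defs by (rule continuous_map_II_D[OF continuous_map_snd])
  have cZ: "continuous_map ?P euclideanreal (\<lambda>x. Z x i)" "continuous_map ?P euclideanreal (\<lambda>x. Z' x i)" for i
    unfolding defs by (intro continuous_map_disc_coord[where n = n] cm_proj)+
  have c\<eta>: "continuous_map ?P euclideanreal \<eta>"
    unfolding \<eta>_def
    by (intro continuous_map_real_mult continuous_map_diff continuous_map_real_max continuous_map_l2 cT cZ) auto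
  have cv: "continuous_map ?P euclideanreal (\<lambda>x. v x i)" for i
    unfolding v_def
    by (intro continuous_map_real_divide continuous_map_real_mult continuous_map_diff continuous_map_add cT cZ) auto
  have cm: "continuous_map ?P euclideanreal (\<lambda>x. m x i)" for i
    unfolding m_def
    by (intro continuous_map_real_divide continuous_map_real_mult continuous_map_diff continuous_map_add cT cZ) auto
  have cs: "continuous_map ?P euclideanreal (\<lambda>x. s x i)" for i
    unfolding s_def
    by (intro continuous_map_add continuous_map_diff continuous_map_real_max continuous_map_real_min cv c\<eta>) auto
  have cq: "continuous_map ?P euclideanreal q"
    unfolding q_def
    by (intro continuous_map_diff continuous_map_real_max continuous_map_l2 cv c\<eta>) auto
  have cc: "continuous_map ?P euclideanreal (\<lambda>x. c x i)" "continuous_map ?P euclideanreal (\<lambda>x. c' x i)" for i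
    unfolding c_def c'_def by (intro continuous_map_add continuous_map_diff cm cs)+
  have cp: "continuous_map ?P euclideanreal p"
    unfolding p_def by (intro continuous_map_real_max continuous_map_l2 cc)
  have "continuous_map ?P euclideanreal (\<lambda>x. (1 + p x + q x)\<^sup>2 - 4 * p x)"
    by (intro continuous_map_add continuous_map_diff continuous_map_real_pow continuous_map_real_mult cp cq) auto
  then have "continuous_map ?P euclideanreal (\<lambda>x. sqrt ((1 + p x + q x)\<^sup>2 - 4 * p x))"
    by (rule continuous_map_comp[rotated]) (simp add: continuous_on_real_sqrt)
  then have ct2: "continuous_map ?P euclideanreal t2"
    unfolding t2_def
    by (intro continuous_map_add continuous_map_diff continuous_map_real_divide cp cq) auto
  have \<eta>0: "0 \<le> \<eta> x" if "x \<in> topspace ?P" for x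
    using that by (auto simp: \<eta>_def defs topspace_unit_disc intro!: mult_nonneg_nonneg)
  have out0: "c x i / (1 + t2 x) = 0" "c' x i / (1 + t2 x) = 0" if "x \<in> topspace ?P" "n \<le> i" for x i
    using that \<eta>0[OF that(1)] by (auto simp: c_def c'_def m_def s_def v_def defs topspace_unit_disc)
  have n1: "l2 n (\<lambda>i. c x i / (1 + t2 x)) = l2 n (c x) / (1 + t2 x)"
      "l2 n (\<lambda>i. c' x i / (1 + t2 x)) = l2 n (c' x) / (1 + t2 x)" for x
    using t2(1)[of x] by (auto intro!: l2_div)
  have n2: "l2 n (\<lambda>i. c x i / (1 + t2 x)) \<le> 1" "l2 n (\<lambda>i. c' x i / (1 + t2 x)) \<le> 1" for x
    unfolding n1 using t2(1,2)[of x] by (auto simp: p_def divide_le_eq)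
  have cret: "continuous_map ?P ?P ret"
    unfolding ret_def
  proof (intro continuous_map_pairedI)
    show "continuous_map ?P II (\<lambda>x. min 1 (t2 x))"
      using t2(1) by (intro continuous_map_II_I continuous_map_real_min ct2) auto
    have "1 + t2 x \<noteq> 0" for x using t2(1)[of x] by linarith
    then show "continuous_map ?P ?D (\<lambda>x i. c x i / (1 + t2 x))" "continuous_map ?P ?D (\<lambda>x i. c' x i / (1 + t2 x))"
      by (intro continuous_map_into_disc continuous_map_real_divide cc continuous_map_add ct2 n2 out0; simp)+
  qed
  have v_zero: "s x i = v x i" if "\<eta> x = 0" for x i using that by (auto simp: s_def)
  have cc_eq: "c x = (\<lambda>i. (1 + T x) * Z x i)" "c' x = (\<lambda>i. (1 + T x) * Z' x i)" if "\<eta> x = 0" for x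
    unfolding c_def c'_def v_zero[OF that] m_def v_def by (auto simp: fun_eq_iff field_simps)
  have q_zero: "q x = 0" if "\<eta> x = 0" for x using that by (simp add: q_def L2_set_nonneg)
  have r1: "ret (b,0) = (b,0)" if "b \<in> topspace ?D \<times> topspace ?D" for b
  proof -
    let ?x = "(b,0::real)"
    have \<eta>: "\<eta> ?x = 0" by (simp add: \<eta>_def defs)
    have cb: "c ?x = fst b" "c' ?x = snd b" using cc_eq[OF \<eta>] by (auto simp: defs)
    then have "p ?x \<le> 1" using that by (auto simp: p_def topspace_unit_disc)
    then have "t2 ?x = 0" using t2(3)[OF q_zero[OF \<eta>]] by simp
    then show ?thesis by (simp add: ret_def cb)
  qed
  have r2: "ret ((z,z'),t) = ((z,z'),t)" if zz: "z \<in> topspace ?D" "z' \<in> topspace ?D" and t: "0 \<le> t" "t \<le> 1"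
      and bd: "z \<in> disc_boundary n \<or> z' \<in> disc_boundary n" for z z' t
  proof -
    let ?x = "((z,z'),t)"
    have mx: "max (l2 n z) (l2 n z') = 1" using zz bd by (auto simp: topspace_unit_disc disc_boundary_eq max_def)
    then have \<eta>: "\<eta> ?x = 0" by (simp add: \<eta>_def defs)
    have cb: "c ?x = (\<lambda>i. (1 + t) * z i)" "c' ?x = (\<lambda>i. (1 + t) * z' i)" using cc_eq[OF \<eta>] by (auto simp: defs)
    then have "p ?x = max ((1 + t) * l2 n z) ((1 + t) * l2 n z')" using t by (simp add: p_def l2_scale)
    also have "\<dots> = (1 + t) * max (l2 n z) (l2 n z')"
      using t by (auto simp: max_def mult_le_cancel_left)
    finally have "p ?x = 1 + t" using mx by simp
    then have "t2 ?x = t" using t2(3)[OF q_zero[OF \<eta>]] t by simp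
    then show ?thesis using t by (simp add: ret_def cb)
  qed
  have r3: "ret ((z,z),t) = ((z,z),t)" if z: "z \<in> topspace ?D" and t: "0 \<le> t" "t \<le> 1" for z t
  proof -
    let ?x = "((z,z),t)"
    define \<beta> where "\<beta> = l2 n z"
    have \<beta>: "0 \<le> \<beta>" "\<beta> \<le> 1" using z by (auto simp: \<beta>_def topspace_unit_disc L2_set_nonneg)
    have \<eta>: "\<eta> ?x = t * (1 - \<beta>)" by (simp add: \<eta>_def defs \<beta>_def)
    then have \<eta>n: "0 \<le> \<eta> ?x" using t \<beta> by simp
    have v: "v ?x i = 0" for i by (simp add: v_def defs)
    have s: "s ?x i = 0" for i using \<eta>n by (simp add: s_def v)
    have cb: "c ?x = (\<lambda>i. (1 + t) * z i)" "c' ?x = (\<lambda>i. (1 + t) * z i)"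
      by (auto simp: c_def c'_def s m_def defs field_simps)
    have p: "p ?x = (1 + t) * \<beta>" using t by (simp add: p_def cb l2_scale \<beta>_def)
    have "l2 n (v ?x) = 0" by (simp add: L2_set_def v)
    then have q: "q ?x = t * (1 - \<beta>)" using \<eta>n by (simp add: q_def \<eta>)
    have "(1 + p ?x + q ?x)\<^sup>2 - 4 * p ?x = (1 + t - \<beta>)\<^sup>2"
      by (simp add: p q power2_eq_square algebra_simps)
    then have "sqrt ((1 + p ?x + q ?x)\<^sup>2 - 4 * p ?x) = 1 + t - \<beta>" using t \<beta> by simp
    then have "t2 ?x = t" unfolding t2_def by (simp add: p q algebra_simps)
    then show ?thesis using t by (simp add: ret_def cb)
  qed
  have r4: "snd (ret x) = 0 \<or> fst (fst (ret x)) \<in> disc_boundary n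
       \<or> snd (fst (ret x)) \<in> disc_boundary n \<or> fst (fst (ret x)) = snd (fst (ret x))"
    if x: "x \<in> topspace ?P" for x
  proof (cases "q x = 0")
    case False
    then have lt: "l2 n (v x) < \<eta> x" by (auto simp: q_def)
    have "s x i = 0" for i
    proof (cases "i < n")
      case True
      have "\<bar>v x i\<bar> \<le> L2_set (\<lambda>i. \<bar>v x i\<bar>) {..<n}" using True by (intro member_le_L2_set) auto
      also have "\<dots> = l2 n (v x)" by (simp add: L2_set_def)
      finally show ?thesis using lt by (simp add: s_def)
    next
      case False
      then have "v x i = 0" using x by (auto simp: v_def defs topspace_unit_disc)
      then show ?thesis using \<eta>0[OF x] by (simp add: s_def)
    qed
    then have "c x = c' x" by (auto simp: c_def c'_def)
    then show ?thesis by (simp add: ret_def)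
  next
    \<comment> \<open>At remaining height 0 the inverse flattening is explicit: the bottom if
      \<open>p x \<le> 1\<close>, and otherwise division by \<open>p x\<close>, which brings the
      larger of the two norms to exactly 1 and so the point to a wall.\<close>
    case True
    show ?thesis
    proof (cases "p x \<le> 1")
      case True
      then have "t2 x = 0" using t2(3)[OF \<open>q x = 0\<close>] by simp
      then show ?thesis by (simp add: ret_def)
    next
      case False
      then have t2p: "1 + t2 x = p x" using t2(3)[OF \<open>q x = 0\<close>] by simp
      have "l2 n (c x) = p x \<or> l2 n (c' x) = p x" by (auto simp: p_def max_def)
      then have "l2 n (\<lambda>i. c x i / (1 + t2 x)) = 1 \<or> l2 n (\<lambda>i. c' x i / (1 + t2 x)) = 1"
        unfolding n1 unfolding t2p using False by auto
      then show ?thesis using out0[OF x] unfolding ret_def disc_boundary_eq fst_conv snd_conv by blast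
    qed
  qed
  show thesis
    by (rule that[OF cret r1 r2 r3]) (use r4 in auto)
qed

section \<open>Construction of maps cell by cell\<close>

text \<open>A continuous map from a compact to a Hausdorff space is proper, and properness survives
  the product with the identity of an arbitrary \<open>W\<close>. That product is thus a closed
  continuous surjection onto its image times \<open>W\<close>, hence a quotient map.\<close>

lemma continuous_map_prod_quotient:
  assumes "compact_space D" "Hausdorff_space X" "continuous_map D X \<phi>"
    and G: "continuous_map (prod_topology D W) V (\<lambda>p. G (\<phi> (fst p), snd p))"
  shows "continuous_map (prod_topology (subtopology X (\<phi> ` topspace D)) W) V G"
proof -
  let ?S = "subtopology X (\<phi> ` topspace D)"
  let ?q = "\<lambda>(z,w). (\<phi> z, id w)"
  have c: "continuous_map D ?S \<phi>" using assms(3) by (auto simp: continuous_map_in_subtopology)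
  have tS: "topspace ?S = \<phi> ` topspace D"
    using continuous_map_image_subset_topspace[OF assms(3)] by auto
  have "proper_map D ?S \<phi>"
    using assms(1,2) c by (intro continuous_imp_proper_map Hausdorff_imp_kc_space Hausdorff_space_subtopology)
  moreover have "proper_map W W id" by simp
  ultimately have "proper_map (prod_topology D W) (prod_topology ?S W) ?q"
    unfolding proper_map_prod by blast
  then have "closed_map (prod_topology D W) (prod_topology ?S W) ?q"
    by (rule proper_imp_closed_map)
  moreover have "continuous_map (prod_topology D W) (prod_topology ?S W) ?q"
    using continuous_map_pairedI[OF continuous_map_comp[OF c continuous_map_fst] continuous_map_snd]
    by (simp add: case_prod_unfold)
  moreover have "?q ` topspace (prod_topology D W) = topspace (prod_topology ?S W)"
    unfolding topspace_prod_topology tS by (auto simp: image_iff)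
  ultimately have "quotient_map (prod_topology D W) (prod_topology ?S W) ?q"
    by (intro continuous_closed_imp_quotient_map)
  then show ?thesis
    by (rule continuous_compose_quotient_map) (use G in \<open>simp add: o_def case_prod_unfold\<close>)
qed

lemma continuous_map_finite_closed_cover:
  assumes "finite F" "\<And>i. i \<in> F \<Longrightarrow> closedin X (C i)" "K \<subseteq> (\<Union>i\<in>F. C i)"
    and "\<And>i. i \<in> F \<Longrightarrow> continuous_map (prod_topology (subtopology X (C i)) W) V G"
  shows "continuous_map (prod_topology (subtopology X K) W) V G"
proof -
  have "continuous_map (subtopology (prod_topology X W) (\<Union>i\<in>F. C i \<times> topspace W)) V G"
  proof (rule continuous_map_Union_closed[OF assms(1)])
    fix i assume i: "i \<in> F"
    show "closedin (prod_topology X W) (C i \<times> topspace W)"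
      using assms(2)[OF i] by (simp add: closedin_prod_Times_iff)
    show "continuous_map (subtopology (prod_topology X W) (C i \<times> topspace W)) V G"
      using assms(4)[OF i] by (simp add: prod_topology_subtopology_left)
  qed
  then have "continuous_map (subtopology (prod_topology X W) (K \<times> topspace W)) V G"
    by (rule continuous_map_from_subtopology_mono) (use assms(3) in auto)
  then show ?thesis by (simp add: prod_topology_subtopology_left)
qed

text \<open>Turns data over lower closed cells into data over the boundary of the disc being
  attached, the form in which the extension over that disc takes them.\<close>

lemma attach_boundary_continuous:
  assumes "continuous_map D X \<phi>"
    and "finite F" "\<And>i. i \<in> F \<Longrightarrow> closedin X (C i)" "\<phi> ` Bd \<subseteq> (\<Union>i\<in>F. C i)"
    and "\<And>i. i \<in> F \<Longrightarrow> continuous_map (prod_topology (subtopology X (C i)) W) V G"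
  shows "continuous_map (prod_topology (subtopology D Bd) W) V (\<lambda>p. G (\<phi> (fst p), snd p))"
proof -
  have "continuous_map (prod_topology (subtopology X (\<phi> ` Bd)) W) V G"
    by (rule continuous_map_finite_closed_cover[OF assms(2-5)])
  then show ?thesis
  proof (rule continuous_map_comp)
    show "continuous_map (prod_topology (subtopology D Bd) W) (prod_topology (subtopology X (\<phi> ` Bd)) W)
     (\<lambda>p. (\<phi> (fst p), snd p))"
    by (intro continuous_map_pairedI continuous_map_into_sub continuous_map_snd
        continuous_map_comp[OF assms(1)] continuous_map_into_fulltopology[OF continuous_map_fst]) auto
  qed
qed

definition attach :: "('d \<Rightarrow> 'x) \<Rightarrow> 'd set \<Rightarrow> ('d \<Rightarrow> 'v) \<Rightarrow> ('x \<Rightarrow> 'v) \<Rightarrow> 'x \<Rightarrow> 'v" where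
  "attach \<phi> U g G x = (if x \<in> \<phi> ` U then g (inv_into U \<phi> x) else G x)"

lemma attach_inside: "inj_on \<phi> U \<Longrightarrow> z \<in> U \<Longrightarrow> attach \<phi> U g G (\<phi> z) = g z"
  by (simp add: attach_def inv_into_f_f)

lemma attach_outside: "x \<notin> \<phi> ` U \<Longrightarrow> attach \<phi> U g G x = G x"
  by (simp add: attach_def)

text \<open>All cells of one dimension form a single stage: each extension changes \<open>G\<close>
  only on its own cell, so independent choices can be merged. By \<open>loc\<close> a property
  depends only on its own cell and on lower ones and therefore survives later stages. The index set
  is abstract because the lemma serves both cells and pairs of cells, the latter with the sum of
  dimensions as \<open>\<delta>\<close>.\<close>

lemma cell_recursion:
  fixes C :: "'i \<Rightarrow> 'x set" and \<delta> :: "'i \<Rightarrow> nat" and P :: "'i \<Rightarrow> ('x \<Rightarrow> 'v) \<Rightarrow> bool"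
  assumes disj: "\<And>i j. i \<in> I \<Longrightarrow> j \<in> I \<Longrightarrow> i \<noteq> j \<Longrightarrow> C i \<inter> C j = {}"
  and loc: "\<And>i G G'. i \<in> I \<Longrightarrow> (\<And>x. x \<in> C i \<Longrightarrow> G x = G' x) \<Longrightarrow>
      (\<And>j x. j \<in> I \<Longrightarrow> \<delta> j < \<delta> i \<Longrightarrow> x \<in> C j \<Longrightarrow> G x = G' x) \<Longrightarrow> P i G \<Longrightarrow> P i G'"
  and ext: "\<And>i G. i \<in> I \<Longrightarrow> (\<And>j. j \<in> I \<Longrightarrow> \<delta> j < \<delta> i \<Longrightarrow> P j G) \<Longrightarrow>
      \<exists>G'. (\<forall>x. x \<notin> C i \<longrightarrow> G' x = G x) \<and> P i G'"
  shows "\<exists>G. \<forall>i\<in>I. P i G"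
proof -
  have "\<exists>Gs. \<forall>n. (\<forall>i\<in>I. \<delta> i < n \<longrightarrow> P i (Gs n)) \<and>
      (\<forall>x. (\<forall>i\<in>I. \<delta> i = n \<longrightarrow> x \<notin> C i) \<longrightarrow> Gs (Suc n) x = Gs n x)"
  proof (rule dependent_nat_choice)
    show "\<exists>G. \<forall>i\<in>I. \<delta> i < 0 \<longrightarrow> P i G" by simp
    fix G n assume G: "\<forall>i\<in>I. \<delta> i < n \<longrightarrow> P i G"
    have "\<exists>G'. (\<forall>x. x \<notin> C i \<longrightarrow> G' x = G x) \<and> P i G'" if "i \<in> I" "\<delta> i = n" for i
      using ext[OF that(1), of G] G that by auto
    then obtain g where g: "\<And>i x. i \<in> I \<Longrightarrow> \<delta> i = n \<Longrightarrow> x \<notin> C i \<Longrightarrow> g i x = G x"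
      "\<And>i. i \<in> I \<Longrightarrow> \<delta> i = n \<Longrightarrow> P i (g i)"
      by metis
    define G' where "G' x = (if \<exists>i\<in>I. \<delta> i = n \<and> x \<in> C i then g (THE i. i \<in> I \<and> x \<in> C i) x else G x)" for x
    have the: "(THE i. i \<in> I \<and> x \<in> C i) = i" if "i \<in> I" "x \<in> C i" for i x
      using that disj by (intro the_equality) blast+
    have G'n: "G' x = g i x" if "i \<in> I" "\<delta> i = n" "x \<in> C i" for i x
      using that the by (auto simp: G'_def)
    have G'o: "G' x = G x" if "\<forall>i\<in>I. \<delta> i = n \<longrightarrow> x \<notin> C i" for x
      using that by (auto simp: G'_def)
    have G'l: "G' x = G x" if "j \<in> I" "\<delta> j < n" "x \<in> C j" for j x
      by (rule G'o) (use that disj in blast)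
    have "P i G'" if i: "i \<in> I" "\<delta> i < Suc n" for i
    proof (cases "\<delta> i = n")
      case True
      show ?thesis
      proof (rule loc[OF i(1) _ _ g(2)[OF i(1) True]])
        show "g i x = G' x" if "x \<in> C i" for x using G'n[OF i(1) True that] by simp
        show "g i x = G' x" if "j \<in> I" "\<delta> j < \<delta> i" "x \<in> C j" for j x
        proof -
          have "x \<notin> C i" using that disj[OF that(1) i(1)] by auto
          then have "g i x = G x" using g(1)[OF i(1) True] by simp
          then show ?thesis using G'l[OF that(1) _ that(3)] that True by simp
        qed
      qed
    next
      case False
      then have lt: "\<delta> i < n" using i by simp
      show ?thesis
      proof (rule loc[OF i(1)])
        show "P i G" using G i lt by blast
        show "G x = G' x" if "x \<in> C i" for x using G'l[OF i(1) lt that] by simp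
        show "G x = G' x" if "j \<in> I" "\<delta> j < \<delta> i" "x \<in> C j" for j x
          using G'l[OF that(1) _ that(3)] that(2) lt by simp
      qed
    qed
    then show "\<exists>G'. (\<forall>i\<in>I. \<delta> i < Suc n \<longrightarrow> P i G') \<and>
       (\<forall>x. (\<forall>i\<in>I. \<delta> i = n \<longrightarrow> x \<notin> C i) \<longrightarrow> G' x = G x)"
      using G'o by blast
  qed
  then obtain Gs where Gs: "\<And>n i. i \<in> I \<Longrightarrow> \<delta> i < n \<Longrightarrow> P i (Gs n)"
    and step: "\<And>n x. (\<forall>i\<in>I. \<delta> i = n \<longrightarrow> x \<notin> C i) \<Longrightarrow> Gs (Suc n) x = Gs n x"
    by metis
  have stab: "Gs m x = Gs (Suc (\<delta> i)) x" if i: "i \<in> I" "x \<in> C i" and "\<delta> i < m" for i x m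
    using \<open>\<delta> i < m\<close>
  proof (induction m)
    case (Suc m)
    show ?case
    proof (cases "\<delta> i = m")
      case False
      then have "Gs (Suc m) x = Gs m x" using i disj by (intro step) blast
      then show ?thesis using Suc False by simp
    qed simp
  qed simp
  \<comment> \<open>Passing from \<open>Gs n\<close> to \<open>Gs (Suc n)\<close> changes only cells
    with \<open>\<delta> i = n\<close>, so a point of \<open>C i\<close> has its final value at
    \<open>Suc (\<delta> i)\<close>.\<close>
  define G where "G x = Gs (Suc (\<delta> (THE i. i \<in> I \<and> x \<in> C i))) x" for x
  have GGs: "Gs m x = G x" if "i \<in> I" "x \<in> C i" "\<delta> i < m" for i x m
  proof -
    have "(THE i. i \<in> I \<and> x \<in> C i) = i"
      using that disj by (intro the_equality) blast+
    then show ?thesis using stab[OF that] by (simp add: G_def)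
  qed
  have "P i G" if "i \<in> I" for i
    by (rule loc[OF that _ _ Gs[OF that lessI]]) (use GGs that in auto)
  then show ?thesis by blast
qed

section \<open>CW complexes\<close>

lemma path_connected_unit_disc: "path_connected_space (unit_disc n)"
proof -
  have "path_component_of (unit_disc n) (\<lambda>_. 0) z" if z: "z \<in> topspace (unit_disc n)" for z
  proof -
    have "continuous_map II (unit_disc n) (\<lambda>t. (\<lambda>i. fst (t,z) * snd (t,z) i))"
      using z by (intro continuous_map_comp[OF continuous_map_disc_scale] cm_intros) auto
    then have "pathin (unit_disc n) (\<lambda>t i. t * z i)" by (simp add: pathin_def)
    then show ?thesis unfolding path_component_of_def by force
  qed
  then show ?thesis
    unfolding path_connected_space_iff_path_component
    using path_component_of_sym path_component_of_trans by metis
qed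

locale cw =
  fixes X :: "'a topology" and E :: "'a set set" and d :: "'a set \<Rightarrow> nat"
    and \<phi> :: "'a set \<Rightarrow> (nat \<Rightarrow> real) \<Rightarrow> 'a"
  assumes Hausdorff: "Hausdorff_space X" and cover: "\<Union>E = topspace X" and disj: "pairwise disjnt E"
    and char: "\<And>e. e \<in> E \<Longrightarrow> characteristic_map X E d e (\<phi> e)"
    and weak: "\<And>A. A \<subseteq> topspace X \<Longrightarrow> (\<And>e. e \<in> E \<Longrightarrow> closedin X (A \<inter> X closure_of e)) \<Longrightarrow> closedin X A"
begin

text \<open>The closed cell is taken as the image of the closed disc: compactness is then immediate,
  and \<open>closedin_weak\<close> allows closed sets to be tested on it.\<close>

definition cell :: "'a set \<Rightarrow> 'a set" where "cell e = \<phi> e ` topspace (unit_disc (d e))"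

abbreviation disc :: "'a set \<Rightarrow> (nat \<Rightarrow> real) topology" where "disc e \<equiv> unit_disc (d e)"
abbreviation bdry :: "'a set \<Rightarrow> (nat \<Rightarrow> real) set" where "bdry e \<equiv> disc_boundary (d e)"
abbreviation odisc :: "'a set \<Rightarrow> (nat \<Rightarrow> real) set" where "odisc e \<equiv> topspace (unit_open_disc (d e))"

lemma disc_split: "odisc e \<union> bdry e = topspace (disc e)" "odisc e \<inter> bdry e = {}"
  by (auto simp: disc_boundary_def topspace_unit_disc topspace_unit_open_disc)

lemma cont: "e \<in> E \<Longrightarrow> continuous_map (disc e) X (\<phi> e)"
  using char by (simp add: characteristic_map_def)

lemma cell_subset_topspace: "e \<in> E \<Longrightarrow> e \<subseteq> topspace X"
  using cover by blast

lemma image_odisc: "e \<in> E \<Longrightarrow> \<phi> e ` odisc e = e"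
  using char[of e] cell_subset_topspace[of e] homeomorphic_imp_surjective_map[of "unit_open_disc (d e)" "subtopology X e" "\<phi> e"]
  by (auto simp: characteristic_map_def Int_absorb1)

lemma inj_odisc: "e \<in> E \<Longrightarrow> inj_on (\<phi> e) (odisc e)"
  using char[of e] homeomorphic_imp_injective_map by (auto simp: characteristic_map_def)

lemma boundary_cover:
  assumes "e \<in> E"
  shows "\<exists>F. finite F \<and> F \<subseteq> {c \<in> E. d c < d e} \<and> \<phi> e ` bdry e \<subseteq> \<Union>F"
  using char[OF assms] unfolding characteristic_map_def disc_boundary_def by blast

lemma cells_eq: "e \<in> E \<Longrightarrow> c \<in> E \<Longrightarrow> x \<in> e \<Longrightarrow> x \<in> c \<Longrightarrow> e = c"
  using disj by (auto simp: pairwise_def disjnt_def)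

lemma cell_eq: "e \<in> E \<Longrightarrow> cell e = e \<union> \<phi> e ` bdry e"
  unfolding cell_def disc_split(1)[symmetric] image_Un by (simp add: image_odisc)

lemma odisc_bdry_disjoint:
  assumes "e \<in> E" shows "\<phi> e ` odisc e \<inter> \<phi> e ` bdry e = {}"
proof -
  obtain F where F: "F \<subseteq> {c \<in> E. d c < d e}" "\<phi> e ` bdry e \<subseteq> \<Union>F"
    using boundary_cover[OF assms] by blast
  have "c \<in> F \<Longrightarrow> x \<in> e \<Longrightarrow> x \<notin> c" for c x using F(1) cells_eq[OF assms, of c x] by auto
  then show ?thesis unfolding image_odisc[OF assms] using F(2) by blast
qed

lemma subset_cell: "e \<in> E \<Longrightarrow> e \<subseteq> cell e"
  by (simp add: cell_eq)

lemma compactin_cell: "e \<in> E \<Longrightarrow> compactin X (cell e)"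
  unfolding cell_def
  by (rule image_compactin[OF _ cont]) (simp_all add: compact_unit_disc flip: compact_space_def)

lemma closedin_cell: "e \<in> E \<Longrightarrow> closedin X (cell e)"
  by (rule compactin_imp_closedin[OF Hausdorff compactin_cell])

lemma closedin_weak:
  assumes "A \<subseteq> topspace X" "\<And>e. e \<in> E \<Longrightarrow> closedin X (A \<inter> cell e)"
  shows "closedin X A"
proof (rule weak[OF assms(1)])
  fix e assume e: "e \<in> E"
  have "X closure_of e \<subseteq> cell e"
    using e closedin_cell subset_cell by (intro closure_of_minimal)
  then have "A \<inter> X closure_of e = (A \<inter> cell e) \<inter> X closure_of e" by blast
  then show "closedin X (A \<inter> X closure_of e)"
    using assms(2)[OF e] by (metis closedin_Int closedin_closure_of)
qed

lemma cell_cover: "topspace X = (\<Union>e\<in>E. cell e)"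
proof
  show "topspace X \<subseteq> (\<Union>e\<in>E. cell e)" unfolding cover[symmetric] using subset_cell by blast
  show "(\<Union>e\<in>E. cell e) \<subseteq> topspace X" using compactin_subset_topspace[OF compactin_cell] by blast
qed

lemma continuous_map_weak:
  assumes "\<And>e. e \<in> E \<Longrightarrow> continuous_map (subtopology X (cell e)) Y f"
  shows "continuous_map X Y f"
  unfolding continuous_map_closedin
proof (intro conjI allI impI)
  show "f \<in> topspace X \<rightarrow> topspace Y"
  proof
    fix x assume x: "x \<in> topspace X"
    then obtain e where "e \<in> E" "x \<in> cell e" using cell_cover by blast
    then show "f x \<in> topspace Y" using continuous_map_in[OF assms[of e], of x] x by simp
  qed
  fix C assume C: "closedin Y C"
  show "closedin X {x \<in> topspace X. f x \<in> C}"
  proof (rule closedin_weak)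
    fix e assume e: "e \<in> E"
    have "closedin (subtopology X (cell e)) {x \<in> topspace (subtopology X (cell e)). f x \<in> C}"
      by (rule closedin_continuous_map_preimage[OF assms[OF e] C])
    then have "closedin X {x \<in> topspace (subtopology X (cell e)). f x \<in> C}"
      using closedin_trans_full closedin_cell[OF e] by blast
    moreover have "{x \<in> topspace (subtopology X (cell e)). f x \<in> C} = {x \<in> topspace X. f x \<in> C} \<inter> cell e"
      by auto
    ultimately show "closedin X ({x \<in> topspace X. f x \<in> C} \<inter> cell e)" by simp
  qed auto
qed

text \<open>One point is chosen in every open cell that meets \<open>K\<close>. A closed cell is
  covered by finitely many open cells, so any set of chosen points meets it in a finite set and is
  closed in the weak topology. An infinite set of chosen points in \<open>K\<close> would then
  contradict Bolzano-Weierstrass.\<close>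

lemma compactin_finite_cells:
  assumes K: "compactin X K"
  obtains F where "finite F" "F \<subseteq> E" "K \<subseteq> (\<Union>e\<in>F. cell e)"
proof -
  define M where "M = {e \<in> E. e \<inter> K \<noteq> {}}"
  define p where "p e = (SOME x. x \<in> e \<inter> K)" for e
  have p: "p e \<in> e" "p e \<in> K" if "e \<in> M" for e
    using that someI_ex[of "\<lambda>x. x \<in> e \<inter> K"] by (auto simp: M_def p_def)
  have ME: "M \<subseteq> E" by (auto simp: M_def)
  have inj: "inj_on p M"
  proof (rule inj_onI)
    fix e c assume ec: "e \<in> M" "c \<in> M" "p e = p c"
    then have "p e \<in> e" "p e \<in> c" using p(1)[of e] p(1)[of c] by auto
    moreover have "e \<in> E" "c \<in> E" using ec ME by auto
    ultimately show "e = c" by (rule cells_eq[rotated 2])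
  qed
  have PX: "p ` M \<subseteq> topspace X" using p ME cover by blast
  have cl: "closedin X Q" if Q: "Q \<subseteq> p ` M" for Q
  proof (rule closedin_weak)
    show "Q \<subseteq> topspace X" using Q PX by blast
    fix e assume e: "e \<in> E"
    obtain F where F: "finite F" "F \<subseteq> {c \<in> E. d c < d e}" "\<phi> e ` bdry e \<subseteq> \<Union>F"
      using boundary_cover[OF e] by blast
    have "Q \<inter> cell e \<subseteq> p ` (insert e F)"
    proof
      fix x assume x: "x \<in> Q \<inter> cell e"
      then obtain c where c: "c \<in> M" "x = p c" using Q by blast
      have "x \<in> e \<union> \<Union>F" using x F(3) cell_eq[OF e] by blast
      then obtain c' where c': "c' \<in> insert e F" "x \<in> c'" by blast
      have "c \<in> E" "c' \<in> E" using c(1) ME c'(1) F(2) e by auto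
      moreover have "x \<in> c" using p(1)[OF c(1)] c(2) by simp
      ultimately have "c = c'" using cells_eq[of c c' x] c'(2) by simp
      then show "x \<in> p ` (insert e F)" using c c' by blast
    qed
    then have "finite (Q \<inter> cell e)" using F(1) finite_subset by blast
    moreover have "Q \<inter> cell e \<subseteq> topspace X" using Q PX by blast
    ultimately show "closedin X (Q \<inter> cell e)"
      using Hausdorff by (simp add: closedin_Hausdorff_finite)
  qed
  have "finite (p ` M)"
  proof (rule ccontr)
    assume "infinite (p ` M)"
    moreover have "p ` M \<subseteq> K" using p by blast
    ultimately obtain x where x: "x \<in> X derived_set_of (p ` M)"
      using compactin_imp_Bolzano_Weierstrass[OF K] by blast
    have "closedin X (p ` M - {x})" by (rule cl) blast
    then have "openin X (topspace X - (p ` M - {x}))" by (rule openin_diff[OF openin_topspace])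
    moreover have "x \<in> topspace X - (p ` M - {x})" using x by (simp add: in_derived_set_of)
    moreover have "\<forall>T. x \<in> T \<and> openin X T \<longrightarrow> (\<exists>y. y \<noteq> x \<and> y \<in> p ` M \<and> y \<in> T)"
      using x unfolding in_derived_set_of by (rule conjunct2)
    ultimately obtain y where "y \<noteq> x" "y \<in> p ` M" "y \<in> topspace X - (p ` M - {x})" by meson
    then show False by simp
  qed
  then have "finite M" using inj finite_imageD by blast
  moreover have "K \<subseteq> (\<Union>e\<in>M. cell e)"
  proof
    fix x assume "x \<in> K"
    then obtain e where "e \<in> E" "x \<in> e" using cover compactin_subset_topspace[OF K] by blast
    then show "x \<in> (\<Union>e\<in>M. cell e)" using subset_cell[of e] \<open>x \<in> K\<close> by (auto simp: M_def)
  qed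
  ultimately show thesis using that ME by blast
qed

lemma path_connectedin_cell: "e \<in> E \<Longrightarrow> path_connectedin X (cell e)"
  unfolding cell_def
  by (rule path_connectedin_continuous_map_image[OF cont])
     (simp_all add: path_connectedin_topspace path_connected_unit_disc)

text \<open>A closed cell is path connected, so a union of path components contains it or misses it
  and is closed in the weak topology. A path component and its complement are both such
  unions.\<close>

lemma path_connected:
  assumes "connected_space X" shows "path_connected_space X"
proof -
  have clo: "closedin X T" if T: "T \<subseteq> topspace X" "\<And>x y. x \<in> T \<Longrightarrow> path_component_of X x y \<Longrightarrow> y \<in> T" for T
  proof (rule closedin_weak[OF T(1)])
    fix e assume e: "e \<in> E"
    have "T \<inter> cell e = {} \<or> T \<inter> cell e = cell e"
    proof (cases "T \<inter> cell e = {}")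
      case False
      then obtain y where y: "y \<in> T" "y \<in> cell e" by blast
      have "z \<in> T" if "z \<in> cell e" for z
      proof (rule T(2)[OF y(1)])
        show "path_component_of X y z"
          unfolding path_component_of using path_connectedin_cell[OF e] that y(2) by (intro exI[of _ "cell e"]) simp
      qed
      then show ?thesis by auto
    qed auto
    then show "closedin X (T \<inter> cell e)" using closedin_cell[OF e] by auto
  qed
  have "path_component_of X x y" if xy: "x \<in> topspace X" "y \<in> topspace X" for x y
  proof -
    let ?P = "path_component_of_set X x"
    have P: "?P \<subseteq> topspace X" by (rule path_component_of_subset_topspace)
    have c1: "closedin X ?P"
    proof (rule clo[OF P])
      fix y z assume "y \<in> ?P" "path_component_of X y z"
      then show "z \<in> ?P" using path_component_of_trans[of X x y z] by simp
    qed
    have "closedin X (topspace X - ?P)"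
    proof (rule clo)
      fix y z assume y: "y \<in> topspace X - ?P" "path_component_of X y z"
      have "z \<in> topspace X" using y(2) path_component_in_topspace[of X y z] by simp
      moreover have "\<not> path_component_of X x z"
        using y path_component_of_trans[of X x z y] path_component_of_sym[of X y z] by auto
      ultimately show "z \<in> topspace X - ?P" by simp
    qed simp
    then have "openin X ?P" using P by (simp add: openin_closedin)
    then have "?P = {} \<or> ?P = topspace X"
      using assms c1 unfolding connected_space_clopen_in by blast
    moreover have "x \<in> ?P" using xy(1) by (simp add: path_component_of_refl)
    ultimately have "?P = topspace X" by auto
    then show ?thesis using xy(2) by auto
  qed
  then show ?thesis by (simp add: path_connected_space_iff_path_component)
qed

lemma compact_finite: "finite E \<Longrightarrow> compact_space X"
  unfolding compact_space_def cell_cover using compactin_cell by (intro compactin_Union) auto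

lemma continuous_map_compact_cells:
  assumes "\<And>e. e \<in> E \<Longrightarrow> continuous_map (prod_topology (subtopology X (cell e)) W) V G"
    and "compactin X K"
  shows "continuous_map (prod_topology (subtopology X K) W) V G"
proof -
  obtain F where F: "finite F" "F \<subseteq> E" "K \<subseteq> (\<Union>e\<in>F. cell e)"
    using compactin_finite_cells[OF assms(2)] .
  show ?thesis
  proof (rule continuous_map_finite_closed_cover[OF F(1) _ F(3)])
    fix e assume "e \<in> F"
    then have e: "e \<in> E" using F(2) by blast
    show "closedin X (cell e)" by (rule closedin_cell[OF e])
    show "continuous_map (prod_topology (subtopology X (cell e)) W) V G" by (rule assms(1)[OF e])
  qed
qed

text \<open>The weak topology makes each slice continuous, and a compact subset of \<open>X\<close>
  lies in finitely many closed cells; these are the two hypotheses of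
  \<open>continuous_map_curry\<close>.\<close>

lemma continuous_map_curry_cells:
  assumes G: "\<And>e. e \<in> E \<Longrightarrow> continuous_map (prod_topology (subtopology X (cell e)) W) V G"
  shows "continuous_map W (mapping_space X V) (\<lambda>w. \<lambda>x\<in>topspace X. G (x,w))"
proof (rule continuous_map_curry)
  show "continuous_map X V (\<lambda>x. G (x,w))" if "w \<in> topspace W" for w
  proof (rule continuous_map_weak)
    show "continuous_map (subtopology X (cell e)) V (\<lambda>x. G (x,w))" if "e \<in> E" for e
      using \<open>w \<in> topspace W\<close> by (intro continuous_map_comp[OF G[OF that]] cm_intros) auto
  qed
  show "continuous_map (prod_topology (subtopology X K) W) V (\<lambda>p. G (fst p, snd p))"
    if "compactin X K" for K
    using continuous_map_compact_cells[OF G that] by simp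
qed

text \<open>The compact Hausdorff factor is moved to the other side: \<open>X\<close> maps to
  \<open>mapping_space C V\<close>, where continuity is checked cell by cell, and evaluation at the
  points of \<open>C\<close> brings the factor back.\<close>

lemma continuous_map_product_cells:
  assumes C: "compact_space C" "Hausdorff_space C"
    and F: "\<And>e. e \<in> E \<Longrightarrow> continuous_map (prod_topology C (subtopology X (cell e))) V F"
  shows "continuous_map (prod_topology C X) V F"
proof -
  have "continuous_map X (mapping_space C V) (\<lambda>x. \<lambda>c\<in>topspace C. F (c,x))"
    by (intro continuous_map_weak continuous_map_curry' F)
  then have "continuous_map (prod_topology C X) (prod_topology C (mapping_space C V))
      (\<lambda>p. (fst p, \<lambda>c\<in>topspace C. F (c, snd p)))"
    by (intro continuous_map_pairedI continuous_map_fst continuous_map_comp[OF _ continuous_map_snd])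
  from continuous_map_comp[OF continuous_map_eval[OF C(2,1)] this] show ?thesis
    by (rule continuous_map_eq) auto
qed

text \<open>The factor \<open>W\<close> carries the time of a homotopy, so a homotopy of families of
  maps over \<open>X\<close> induces one between maps of mapping spaces. Over a closed cell the
  evaluation of \<open>g\<close> is jointly continuous.\<close>

lemma continuous_map_pointwise:
  assumes G: "\<And>e. e \<in> E \<Longrightarrow> continuous_map (prod_topology (subtopology X (cell e)) (prod_topology W Y)) V G"
  shows "continuous_map (prod_topology W (mapping_space X Y)) (mapping_space X V)
    (\<lambda>p. \<lambda>x\<in>topspace X. G (x, (fst p, snd p x)))"
proof -
  have "continuous_map (prod_topology W (mapping_space X Y)) (mapping_space X V)
    (\<lambda>p. \<lambda>x\<in>topspace X. (\<lambda>q. G (fst q, (fst (snd q), snd (snd q) (fst q)))) (x,p))"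
  proof (rule continuous_map_curry_cells)
    fix e assume e: "e \<in> E"
    let ?P = "prod_topology (subtopology X (cell e)) (prod_topology W (mapping_space X Y))"
    have "continuous_map ?P Y (\<lambda>q. snd (fst q, snd (snd q)) (fst (fst q, snd (snd q))))"
      by (intro continuous_map_comp[OF continuous_map_eval_compact[OF Hausdorff compactin_cell[OF e]]]
          continuous_map_pairedI cm_intros cm_proj)
    then show "continuous_map ?P V (\<lambda>q. G (fst q, (fst (snd q), snd (snd q) (fst q))))"
      by (intro continuous_map_comp[OF G[OF e]] continuous_map_pairedI continuous_map_fst cm_proj) simp
  qed
  then show ?thesis by simp
qed

end

lemma CW_complex_cw:
  assumes "CW_complex X E d"
  obtains \<phi> where "cw X E d \<phi>"
proof -
  have "\<forall>e\<in>E. \<exists>\<phi>. characteristic_map X E d e \<phi>" using assms by (simp add: CW_complex_def)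
  then obtain \<phi> where "\<forall>e\<in>E. characteristic_map X E d e (\<phi> e)" by metis
  then have "cw X E d \<phi>"
    using assms by (intro cw.intro) (auto simp: CW_complex_def)
  then show thesis by (rule that)
qed

section \<open>Inverting a family of self-maps over a complex\<close>

text \<open>If \<open>S\<close> is homotopic to the projection by \<open>Q\<close>, then a right inverse \<open>T\<close> of \<open>S\<close> on \<open>A\<close> with a
  homotopy \<open>H\<close> from the projection to \<open>S \<circ> T\<close> extends. The path \<open>C\<close> follows \<open>H\<close> and then \<open>Q \<circ> T\<close>. It is
  first extended with one free end, which yields the new \<open>T\<close>, and then its second half is cut off.\<close>

lemma right_inverse_extension:
  assumes ndr: "ndr_pair D A"
    and S: "continuous_map (prod_topology D Y) Y S"
    and Q: "continuous_map (prod_topology (prod_topology D Y) II) Y Q"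
    and Q0: "\<And>p. p \<in> topspace (prod_topology D Y) \<Longrightarrow> Q (p,0) = S p"
    and Q1: "\<And>p. p \<in> topspace (prod_topology D Y) \<Longrightarrow> Q (p,1) = snd p"
    and T: "continuous_map (prod_topology (subtopology D A) Y) Y T"
    and H: "continuous_map (prod_topology (prod_topology (subtopology D A) Y) II) Y H"
    and H0: "\<And>p. p \<in> A \<times> topspace Y \<Longrightarrow> H (p,0) = snd p"
    and H1: "\<And>p. p \<in> A \<times> topspace Y \<Longrightarrow> H (p,1) = S (fst p, T p)"
  shows "\<exists>T' H'. continuous_map (prod_topology D Y) Y T' \<and>
    continuous_map (prod_topology (prod_topology D Y) II) Y H' \<and>
    (\<forall>p \<in> A \<times> topspace Y. T' p = T p) \<and>
    (\<forall>p \<in> A \<times> topspace Y. \<forall>t \<in> {0..1}. H' (p,t) = H (p,t)) \<and>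
    (\<forall>p \<in> topspace (prod_topology D Y). H' (p,0) = snd p \<and> H' (p,1) = S (fst p, T' p))"
proof -
  let ?Z = "prod_topology D Y"
  let ?A = "A \<times> topspace Y"
  have AD: "A \<subseteq> topspace D" using ndr by (rule ndr_pair_subset)
  have ndrZ: "ndr_pair ?Z ?A" using ndr_pair_prod[OF ndr ndr_pair_empty[of Y]] by simp
  have sub: "subtopology ?Z ?A = prod_topology (subtopology D A) Y"
    by (simp add: prod_topology_subtopology_left)
  have tA: "topspace (prod_topology (subtopology D A) Y) = ?A" using AD by auto
  have TY: "T p \<in> topspace Y" if "p \<in> ?A" for p
    using continuous_map_in[OF T] that tA by blast
  define C where "C = (\<lambda>q. if snd q \<le> 1 then H q else Q ((fst (fst q), T (fst q)), snd q - 1))"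
  let ?J = "top_of_set {0..2::real}"
  let ?PA = "prod_topology (prod_topology (subtopology D A) Y) ?J"
  have csnd: "continuous_map ?PA euclideanreal snd"
    using continuous_map_into_fulltopology[OF continuous_map_snd] .
  have cC: "continuous_map ?PA Y C"
    unfolding C_def
  proof (rule continuous_map_cases_le[OF csnd])
    show "continuous_map (subtopology ?PA {x \<in> topspace ?PA. snd x \<le> 1}) Y H"
    proof -
      have "continuous_map (subtopology ?PA {x \<in> topspace ?PA. snd x \<le> 1}) Y (\<lambda>x. H (fst x, snd x))"
        by (intro continuous_map_comp[OF H] continuous_map_pairedI continuous_map_II_I
            continuous_map_from_subtopology continuous_map_fst csnd) auto
      then show ?thesis by simp
    qed
    show "continuous_map (subtopology ?PA {x \<in> topspace ?PA. 1 \<le> snd x}) Y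
      (\<lambda>q. Q ((fst (fst q), T (fst q)), snd q - 1))"
    proof (intro continuous_map_comp[OF Q] continuous_map_pairedI continuous_map_II_I
            continuous_map_from_subtopology continuous_map_diff csnd)
      show "continuous_map ?PA D (\<lambda>x. fst (fst x))"
        by (rule continuous_map_into_fulltopology[OF cm_proj(1)])
      show "continuous_map ?PA Y (\<lambda>x. T (fst x))" by (intro continuous_map_comp[OF T] continuous_map_fst)
    qed auto
    show "H x = Q ((fst (fst x), T (fst x)), snd x - 1)" if "x \<in> topspace ?PA" "snd x = 1" for x
      using that H1[of "fst x"] Q0[of "(fst (fst x), T (fst x))"] TY[of "fst x"] AD tA
      by (cases x) auto
  qed auto
  have C0: "C (p,0) = snd p" if "p \<in> ?A" for p using that H0 by (simp add: C_def)
  have C2: "C (p,2) = T p" if "p \<in> ?A" for p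
    using that Q1[of "(fst p, T p)"] TY[OF that] AD by (auto simp: C_def)
  show ?thesis
  proof (rule ndr_pair_HEP[OF ndrZ, of Y snd "\<lambda>q. C (fst q, 2 * snd q)"])
    show "continuous_map ?Z Y snd" by (rule continuous_map_snd)
    show "continuous_map (prod_topology (subtopology ?Z ?A) II) Y (\<lambda>q. C (fst q, 2 * snd q))"
      unfolding sub
      by (intro continuous_map_comp[OF cC] continuous_map_pairedI continuous_map_fst
          continuous_map_into_sub continuous_map_real_mult_left continuous_map_II_D[OF continuous_map_snd]) auto
    show "C (fst (p,0::real), 2 * snd (p,0::real)) = snd p" if "p \<in> ?A" for p using C0[OF that] by simp
    fix J assume J: "continuous_map (prod_topology ?Z II) Y J"
      and J0: "\<And>z. z \<in> topspace ?Z \<Longrightarrow> J (z,0) = snd z"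
      and JA: "\<And>a t. a \<in> ?A \<Longrightarrow> 0 \<le> t \<Longrightarrow> t \<le> 1 \<Longrightarrow> J (a,t) = C (fst (a,t), 2 * snd (a,t))"
    define T' where "T' = (\<lambda>z. J (z,1))"
    have cT': "continuous_map ?Z Y T'"
      unfolding T'_def by (intro continuous_map_comp[OF J] cm_intros) auto
    have T'A: "T' p = T p" if "p \<in> ?A" for p
      using JA[OF that, of 1] C2[OF that] by (simp add: T'_def)
    have T'Y: "T' z \<in> topspace Y" if "z \<in> topspace ?Z" for z
      using continuous_map_in[OF cT' that] .
    \<comment> \<open>The wall \<open>C (a, t * (2 - s))\<close> shortens the path from length 2 at
      \<open>s = 0\<close> to its first half, which is \<open>H\<close>, at \<open>s = 1\<close>.
      Its right end \<open>C (a, 2 - s)\<close> is \<open>Q\<close> run backwards over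
      \<open>T\<close>; the wall \<open>P1\<close> continues this to all of
      \<open>D \<times> Y\<close> by running \<open>Q\<close> backwards over \<open>T'\<close> until
      \<open>S\<close> is reached.\<close>
    show ?thesis
    proof (rule ndr_rel_fill[OF ndrZ J, of "\<lambda>q. snd (fst q)" "\<lambda>q. Q ((fst (fst q), T' (fst q)), 1 - snd q)"
          "\<lambda>q. C (fst (fst q), snd (fst q) * (2 - snd q))"])
      show "continuous_map (prod_topology ?Z II) Y (\<lambda>q. snd (fst q))" by (rule cm_proj)
      show "continuous_map (prod_topology ?Z II) Y (\<lambda>q. Q ((fst (fst q), T' (fst q)), 1 - snd q))"
        by (intro continuous_map_comp[OF Q] continuous_map_pairedI continuous_map_II_I cm_proj
            continuous_map_comp[OF cT'] continuous_map_fst continuous_map_diff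
            continuous_map_II_D[OF continuous_map_snd]) auto
      have le2: "0 \<le> t * (2 - s) \<and> t * (2 - s) \<le> 2" if "t \<in> {0..1}" "s \<in> {0..1}" for t s :: real
        using mult_mono[of t 1 "2 - s" 2] that by auto
      show "continuous_map (prod_topology (prod_topology (subtopology ?Z ?A) II) II) Y
        (\<lambda>q. C (fst (fst q), snd (fst q) * (2 - snd q)))"
        unfolding sub
      proof (intro continuous_map_comp[OF cC] continuous_map_pairedI continuous_map_into_sub)
        let ?P = "prod_topology (prod_topology (prod_topology (subtopology D A) Y) II) II"
        show "continuous_map ?P (prod_topology (subtopology D A) Y) (\<lambda>x. fst (fst x))" by (rule cm_proj)
        show "continuous_map ?P euclideanreal (\<lambda>q. snd (fst q) * (2 - snd q))"
          by (intro continuous_map_real_mult continuous_map_diff continuous_map_II_D[OF continuous_map_snd]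
            continuous_map_II_D[OF cm_proj(2)]) auto
        show "snd (fst x) * (2 - snd x) \<in> {0..2}" if "x \<in> topspace ?P" for x
          using le2[of "snd (fst x)" "snd x"] that by auto
      qed
      show "snd (fst (z, 0::real)) = J (z, 0)" if "z \<in> topspace ?Z" for z using J0[OF that] by simp
      show "Q ((fst (fst (z, 0::real)), T' (fst (z, 0::real))), 1 - snd (z, 0::real)) = J (z, 1)"
        if "z \<in> topspace ?Z" for z
        using Q1[of "(fst z, T' z)"] T'Y[OF that] that by (auto simp: T'_def)
      show "C (fst (fst ((a,t),0::real)), snd (fst ((a,t),0::real)) * (2 - snd ((a,t),0::real))) = J (a,t)"
        if "a \<in> ?A" "0 \<le> t" "t \<le> 1" for a t using JA[OF that] by (simp add: mult.commute)
      show "C (fst (fst ((a,0::real),s)), snd (fst ((a,0::real),s)) * (2 - snd ((a,0::real),s))) = snd (fst (a,s))"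
        if "a \<in> ?A" "0 \<le> s" "s \<le> 1" for a s using C0[OF that(1)] by simp
      show "C (fst (fst ((a,1::real),s)), snd (fst ((a,1::real),s)) * (2 - snd ((a,1::real),s)))
          = Q ((fst (fst (a,s)), T' (fst (a,s))), 1 - snd (a,s))"
        if "a \<in> ?A" "0 \<le> s" "s \<le> 1" for a s
      proof (cases "s = 1")
        case True
        then show ?thesis
          using H1[OF that(1)] Q0[of "(fst a, T a)"] TY[OF that(1)] that(1) AD T'A[OF that(1)]
          by (auto simp: C_def)
      next
        case False
        then show ?thesis using that T'A[OF that(1)] by (simp add: C_def)
      qed
      fix M assume M: "continuous_map (prod_topology ?Z II) Y M"
        and M0: "\<And>z. z \<in> topspace ?Z \<Longrightarrow> M (z,0) = snd (fst (z, 1::real))"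
        and M1: "\<And>z. z \<in> topspace ?Z \<Longrightarrow> M (z,1) = Q ((fst (fst (z, 1::real)), T' (fst (z, 1::real))), 1 - snd (z, 1::real))"
        and MA: "\<And>a t. a \<in> ?A \<Longrightarrow> 0 \<le> t \<Longrightarrow> t \<le> 1 \<Longrightarrow>
           M (a,t) = C (fst (fst ((a,t),1::real)), snd (fst ((a,t),1::real)) * (2 - snd ((a,t),1::real)))"
      show ?thesis
      proof (rule exI[of _ T'], rule exI[of _ M], intro conjI ballI cT' M T'A)
        show "M (p,t) = H (p,t)" if "p \<in> ?A" "t \<in> {0..1}" for p t
          using MA[OF that(1)] that by (simp add: C_def)
        show "M (p,0) = snd p" if "p \<in> topspace ?Z" for p using M0[OF that] by simp
        show "M (p,1) = S (fst p, T' p)" if "p \<in> topspace ?Z" for p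
          using M1[OF that] Q0[of "(fst p, T' p)"] T'Y[OF that] that by auto
      qed
    qed
  qed
qed

context cw
begin

lemma continuous_map_char_cell:
  "e \<in> E \<Longrightarrow> continuous_map (disc e) (subtopology X (cell e)) (\<phi> e)"
  by (rule continuous_map_into_sub[OF cont]) (auto simp: cell_def)

lemma right_inverse_on_cell:
  assumes e: "e \<in> E"
    and S: "\<And>e. e \<in> E \<Longrightarrow> continuous_map (prod_topology (subtopology X (cell e)) Y) Y S"
    and S0: "\<And>y. y \<in> topspace Y \<Longrightarrow> S (x0,y) = y"
    and x0: "x0 \<in> topspace X" and pc: "path_connected_space X"
  shows "\<exists>Q. continuous_map (prod_topology (prod_topology (disc e) Y) II) Y Q \<and>
    (\<forall>p \<in> topspace (prod_topology (disc e) Y). Q (p,0) = S (\<phi> e (fst p), snd p) \<and> Q (p,1) = snd p)"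
proof -
  let ?P = "prod_topology (prod_topology (disc e) Y) II"
  have "\<phi> e (\<lambda>_. 0) \<in> topspace X" using continuous_map_in[OF cont[OF e] zero_in_unit_disc] .
  then have "path_component_of X (\<phi> e (\<lambda>_. 0)) x0"
    using path_connected_space_imp_path_component_of[OF pc] x0 by blast
  then obtain \<gamma> where \<gamma>: "continuous_map II X \<gamma>" "\<gamma> 0 = \<phi> e (\<lambda>_. 0)" "\<gamma> 1 = x0"
    unfolding path_component_of_def pathin_def by blast
  define Q where "Q = (\<lambda>q. if snd q \<le> 1/2 then S (\<phi> e (\<lambda>i. (1 - 2 * snd q) * fst (fst q) i), snd (fst q))
      else S (\<gamma> (2 * snd q - 1), snd (fst q)))"
  have csnd: "continuous_map ?P euclideanreal snd" by (rule continuous_map_II_D[OF continuous_map_snd])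
  have "continuous_map ?P Y Q"
    unfolding Q_def
  proof (rule continuous_map_cases_le[OF csnd])
    let ?Q1 = "subtopology ?P {x \<in> topspace ?P. snd x \<le> 1/2}"
    have "continuous_map ?Q1 (disc e) (\<lambda>x i. fst (1 - 2 * snd x, fst (fst x)) * snd (1 - 2 * snd x, fst (fst x)) i)"
      by (intro continuous_map_comp[OF continuous_map_disc_scale] continuous_map_pairedI continuous_map_II_I
          continuous_map_from_subtopology cm_proj continuous_map_diff continuous_map_real_mult_left csnd) auto
    then have "continuous_map ?Q1 (disc e) (\<lambda>q i. (1 - 2 * snd q) * fst (fst q) i)" by simp
    then show "continuous_map ?Q1 Y (\<lambda>q. S (\<phi> e (\<lambda>i. (1 - 2 * snd q) * fst (fst q) i), snd (fst q)))"
      by (intro continuous_map_comp[OF S[OF e]] continuous_map_pairedI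
          continuous_map_comp[OF continuous_map_char_cell[OF e]] continuous_map_from_subtopology[OF cm_proj(2)])
    let ?Q2 = "subtopology ?P {x \<in> topspace ?P. 1/2 \<le> snd x}"
    \<comment> \<open>The path need not stay in one cell. Its image is compact, hence lies in
      finitely many closed cells, and \<open>S\<close> is continuous over it.\<close>
    have K: "compactin X (\<gamma> ` {0..1})"
      using image_compactin[OF _ \<gamma>(1), of "{0..1}"] by (simp add: compactin_subtopology)
    have c\<gamma>: "continuous_map II (subtopology X (\<gamma> ` {0..1})) \<gamma>"
      by (rule continuous_map_into_sub[OF \<gamma>(1)]) auto
    show "continuous_map ?Q2 Y (\<lambda>q. S (\<gamma> (2 * snd q - 1), snd (fst q)))"
      by (intro continuous_map_comp[OF continuous_map_compact_cells[OF S K]] continuous_map_pairedI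
          continuous_map_comp[OF c\<gamma>] continuous_map_II_I continuous_map_diff continuous_map_real_mult_left
          continuous_map_from_subtopology csnd cm_proj) auto
    show "S (\<phi> e (\<lambda>i. (1 - 2 * snd x) * fst (fst x) i), snd (fst x)) = S (\<gamma> (2 * snd x - 1), snd (fst x))"
      if "snd x = 1/2" for x unfolding that using \<gamma>(2) by simp
  qed auto
  moreover have "Q (p,0) = S (\<phi> e (fst p), snd p)" for p by (simp add: Q_def)
  moreover have "Q (p,1) = snd p" if "p \<in> topspace (prod_topology (disc e) Y)" for p
    using S0[of "snd p"] \<gamma>(3) that by (auto simp: Q_def)
  ultimately show ?thesis by (intro exI[of _ Q]) simp
qed

lemma right_inverse:
  assumes S: "\<And>e. e \<in> E \<Longrightarrow> continuous_map (prod_topology (subtopology X (cell e)) Y) Y S"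
    and S0: "\<And>y. y \<in> topspace Y \<Longrightarrow> S (x0,y) = y"
    and x0: "x0 \<in> topspace X" and pc: "path_connected_space X"
  obtains T H where
    "\<And>e. e \<in> E \<Longrightarrow> continuous_map (prod_topology (subtopology X (cell e)) Y) Y T"
    "\<And>e. e \<in> E \<Longrightarrow> continuous_map (prod_topology (subtopology X (cell e)) (prod_topology II Y)) Y H"
    "\<And>y. y \<in> topspace Y \<Longrightarrow> T (x0,y) = y"
    "\<And>x y. x \<in> topspace X \<Longrightarrow> y \<in> topspace Y \<Longrightarrow> H (x,(0,y)) = y"
    "\<And>x y. x \<in> topspace X \<Longrightarrow> y \<in> topspace Y \<Longrightarrow> H (x,(1,y)) = S (x, T (x,y))"
    "\<And>t y. 0 \<le> t \<Longrightarrow> t \<le> 1 \<Longrightarrow> y \<in> topspace Y \<Longrightarrow> H (x0,(t,y)) = y"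
proof -
  \<comment> \<open>\<open>G x\<close> is a pair: the homotopy at \<open>x\<close> as a function of
    time and point, and the self-map belonging to \<open>T\<close> at \<open>x\<close>. Everything
    is curried in \<open>x\<close>, so that changing the data over one open cell means changing a
    function of \<open>x\<close>.\<close>
  define P where "P = (\<lambda>e (G :: 'a \<Rightarrow> (real \<times> 'b \<Rightarrow> 'b) \<times> ('b \<Rightarrow> 'b)).
     continuous_map (prod_topology (subtopology X (cell e)) Y) Y (\<lambda>p. snd (G (fst p)) (snd p)) \<and>
     continuous_map (prod_topology (subtopology X (cell e)) (prod_topology II Y)) Y (\<lambda>p. fst (G (fst p)) (snd p)) \<and>
     (\<forall>x\<in>e. \<forall>y\<in>topspace Y. fst (G x) (0,y) = y \<and> fst (G x) (1,y) = S (x, snd (G x) y)) \<and>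
     (x0 \<in> e \<longrightarrow> (\<forall>y\<in>topspace Y. snd (G x0) y = y \<and> (\<forall>t\<in>{0..1}. fst (G x0) (t,y) = y))))"
  have loc: "P e G'" if e: "e \<in> E" and 1: "\<And>x. x \<in> e \<Longrightarrow> G x = G' x"
    and 2: "\<And>c x. c \<in> E \<Longrightarrow> d c < d e \<Longrightarrow> x \<in> c \<Longrightarrow> G x = G' x" and PG: "P e G" for e G G'
  proof -
    obtain F where F: "F \<subseteq> {c \<in> E. d c < d e}" "\<phi> e ` bdry e \<subseteq> \<Union>F"
      using boundary_cover[OF e] by blast
    have eq: "G x = G' x" if "x \<in> cell e" for x
    proof (cases "x \<in> e")
      case False
      then have "x \<in> \<phi> e ` bdry e" using that by (simp add: cell_eq[OF e])
      then have "x \<in> \<Union>F" using F(2) by (rule subsetD[rotated])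
      then obtain c where c: "c \<in> F" "x \<in> c" by (rule UnionE)
      have "c \<in> E" "d c < d e" using F(1) c(1) by auto
      then show ?thesis using 2[of c x] c(2) by simp
    qed (rule 1)
    have "continuous_map (prod_topology (subtopology X (cell e)) Y) Y (\<lambda>p. snd (G' (fst p)) (snd p))"
      by (rule continuous_map_eq[of _ _ "\<lambda>p. snd (G (fst p)) (snd p)"]) (use PG eq in \<open>auto simp: P_def\<close>)
    moreover have "continuous_map (prod_topology (subtopology X (cell e)) (prod_topology II Y)) Y
         (\<lambda>p. fst (G' (fst p)) (snd p))"
      by (rule continuous_map_eq[of _ _ "\<lambda>p. fst (G (fst p)) (snd p)"]) (use PG eq in \<open>auto simp: P_def\<close>)
    ultimately show ?thesis using PG 1 by (simp add: P_def)
  qed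
  have "\<exists>G. \<forall>e\<in>E. P e G"
  proof (rule cell_recursion[where C = "\<lambda>e. e" and \<delta> = d])
    show "e \<inter> c = {}" if "e \<in> E" "c \<in> E" "e \<noteq> c" for e c
      using cells_eq[OF that(1,2)] that(3) by blast
    show "P e G'" if "e \<in> E" "\<And>x. x \<in> e \<Longrightarrow> G x = G' x"
      "\<And>c x. c \<in> E \<Longrightarrow> d c < d e \<Longrightarrow> x \<in> c \<Longrightarrow> G x = G' x" "P e G" for e G G'
      using that by (rule loc)
    fix e G assume e: "e \<in> E" and lower: "\<And>c. c \<in> E \<Longrightarrow> d c < d e \<Longrightarrow> P c G"
    \<comment> \<open>\<open>x0\<close> may lie inside a cell of positive dimension. Before that
      cell is treated, the data at \<open>x0\<close> are preset to the stationary homotopy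
      \<open>snd\<close> and the identity. As \<open>x0\<close> lies in no other cell, what was
      achieved on lower cells is untouched.\<close>
    define G0 where "G0 = (if x0 \<in> e then G(x0 := (snd, \<lambda>y. y)) else G)"
    have G0: "P c G0" if c: "c \<in> E" "d c < d e" for c
    proof (rule loc[OF c(1) _ _ lower[OF c]])
      show "G x = G0 x" if "x \<in> c" for x
        using cells_eq[OF e c(1), of x] that c by (auto simp: G0_def)
      show "G x = G0 x" if "c' \<in> E" "d c' < d c" "x \<in> c'" for c' x
        using cells_eq[OF e that(1), of x] that c by (auto simp: G0_def)
    qed
    obtain F where F: "finite F" "F \<subseteq> {c \<in> E. d c < d e}" "\<phi> e ` bdry e \<subseteq> \<Union>F"
      using boundary_cover[OF e] by blast
    have FE: "c \<in> E" "d c < d e" if "c \<in> F" for c using F(2) that by auto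
    have Fc: "\<phi> e ` bdry e \<subseteq> (\<Union>c\<in>F. cell c)" using F(3) subset_cell FE(1) by blast
    \<comment> \<open>The preimage of \<open>x0\<close>, at most one point of the open disc, joins
      the boundary in the set on which the extension is prescribed; this preserves the preset
      data.\<close>
    define A0 where "A0 = {z \<in> odisc e. \<phi> e z = x0}"
    let ?A = "bdry e \<union> A0"
    have A0D: "A0 \<subseteq> topspace (disc e)" using disc_split(1)[of e] by (auto simp: A0_def)
    have A0: "A0 = {} \<or> (\<exists>z. A0 = {z})"
    proof (cases "A0 = {}")
      case False
      then obtain z where z: "z \<in> A0" by blast
      have "w = z" if "w \<in> A0" for w
        using inj_onD[OF inj_odisc[OF e], of w z] that z by (simp add: A0_def)
      then show ?thesis using z by blast
    qed simp
    have x0e: "x0 \<in> e" if "z \<in> A0" for z using that image_odisc[OF e] by (auto simp: A0_def)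
    have ndr: "ndr_pair (disc e) ?A"
    proof (cases "A0 = {}")
      case True
      then show ?thesis using ndr_disc_boundary by simp
    next
      case False
      then obtain z where z: "A0 = {z}" using A0 by blast
      show ?thesis unfolding z
        by (rule ndr_pair_Un_disjoint[OF ndr_disc_boundary ndr_disc_point])
           (use z A0D disc_split(2)[of e] in \<open>auto simp: A0_def\<close>)
    qed
    have cl: "closedin (disc e) (bdry e)" "closedin (disc e) A0"
      using ndr_pair_closedin[OF ndr_disc_boundary] A0 A0D Hausdorff_unit_disc
      by (auto simp: closedin_Hausdorff_finite)
    have G0x: "G0 (\<phi> e z) = (snd, \<lambda>y. y)" if "z \<in> A0" for z
      using x0e[OF that] that by (auto simp: G0_def A0_def)
    have cont_union: "continuous_map (prod_topology (subtopology (disc e) ?A) W) Y f"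
      if "continuous_map (prod_topology (subtopology (disc e) (bdry e)) W) Y f"
        "continuous_map (prod_topology (subtopology (disc e) A0) W) Y f" for W :: "'w topology" and f
      using that cl unfolding prod_topology_subtopology_left Sigma_Un_distrib1
      by (intro continuous_map_union_closed) (auto simp: closedin_prod_Times_iff)
    have T: "continuous_map (prod_topology (subtopology (disc e) ?A) Y) Y (\<lambda>p. snd (G0 (\<phi> e (fst p))) (snd p))"
    proof (rule cont_union)
      have "continuous_map (prod_topology (subtopology (disc e) (bdry e)) Y) Y
         (\<lambda>p. (\<lambda>p. snd (G0 (fst p)) (snd p)) (\<phi> e (fst p), snd p))"
        by (rule attach_boundary_continuous[OF cont[OF e] F(1) closedin_cell[OF FE(1)] Fc])
           (use G0 FE in \<open>auto simp: P_def\<close>)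
      then show "continuous_map (prod_topology (subtopology (disc e) (bdry e)) Y) Y
         (\<lambda>p. snd (G0 (\<phi> e (fst p))) (snd p))" by simp
      show "continuous_map (prod_topology (subtopology (disc e) A0) Y) Y
         (\<lambda>p. snd (G0 (\<phi> e (fst p))) (snd p))"
        by (rule continuous_map_eq[OF continuous_map_snd]) (auto simp: G0x)
    qed
    have H': "continuous_map (prod_topology (subtopology (disc e) ?A) (prod_topology II Y)) Y
        (\<lambda>p. fst (G0 (\<phi> e (fst p))) (snd p))"
    proof (rule cont_union)
      have "continuous_map (prod_topology (subtopology (disc e) (bdry e)) (prod_topology II Y)) Y
         (\<lambda>p. (\<lambda>p. fst (G0 (fst p)) (snd p)) (\<phi> e (fst p), snd p))"
        by (rule attach_boundary_continuous[OF cont[OF e] F(1) closedin_cell[OF FE(1)] Fc])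
           (use G0 FE in \<open>auto simp: P_def\<close>)
      then show "continuous_map (prod_topology (subtopology (disc e) (bdry e)) (prod_topology II Y)) Y
         (\<lambda>p. fst (G0 (\<phi> e (fst p))) (snd p))" by simp
      show "continuous_map (prod_topology (subtopology (disc e) A0) (prod_topology II Y)) Y
         (\<lambda>p. fst (G0 (\<phi> e (fst p))) (snd p))"
        by (rule continuous_map_eq[OF cm_proj(4)]) (auto simp: G0x)
    qed
    let ?H = "\<lambda>q. fst (G0 (\<phi> e (fst (fst q)))) (snd q, snd (fst q))"
    have "continuous_map (prod_topology (prod_topology (subtopology (disc e) ?A) Y) II) Y
        (\<lambda>q. (\<lambda>p. fst (G0 (\<phi> e (fst p))) (snd p)) (fst (fst q), (snd q, snd (fst q))))"
      by (intro continuous_map_comp[OF H'] continuous_map_pairedI cm_proj continuous_map_snd)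
    then have H: "continuous_map (prod_topology (prod_topology (subtopology (disc e) ?A) Y) II) Y ?H"
      by simp
    have HA: "fst (G0 (\<phi> e z)) (0,y) = y \<and> fst (G0 (\<phi> e z)) (1,y) = S (\<phi> e z, snd (G0 (\<phi> e z)) y)"
      if "z \<in> ?A" "y \<in> topspace Y" for z y
    proof (cases "z \<in> A0")
      case True
      then show ?thesis using that S0 G0x[OF True] by (auto simp: A0_def)
    next
      case False
      then have "\<phi> e z \<in> \<Union>F" using that(1) by (intro subsetD[OF F(3)] imageI) simp
      then obtain c where c: "c \<in> F" "\<phi> e z \<in> c" by (rule UnionE)
      then show ?thesis using G0[OF FE[OF c(1)]] that(2) by (simp add: P_def)
    qed
    have "\<exists>Q. continuous_map (prod_topology (prod_topology (disc e) Y) II) Y Q \<and>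
      (\<forall>p \<in> topspace (prod_topology (disc e) Y). Q (p,0) = S (\<phi> e (fst p), snd p) \<and> Q (p,1) = snd p)"
    proof (rule right_inverse_on_cell[OF e])
      show "continuous_map (prod_topology (subtopology X (cell c)) Y) Y S" if "c \<in> E" for c
        by (rule S[OF that])
      show "S (x0,y) = y" if "y \<in> topspace Y" for y by (rule S0[OF that])
      show "x0 \<in> topspace X" by (rule x0)
      show "path_connected_space X" by (rule pc)
    qed
    then obtain Q where Q: "continuous_map (prod_topology (prod_topology (disc e) Y) II) Y Q"
      and "\<forall>p \<in> topspace (prod_topology (disc e) Y). Q (p,0) = S (\<phi> e (fst p), snd p) \<and> Q (p,1) = snd p"
      by (elim exE conjE)
    then have Q01: "Q (p,0) = S (\<phi> e (fst p), snd p)" "Q (p,1) = snd p"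
      if "p \<in> topspace (prod_topology (disc e) Y)" for p using that by (cases p; simp)+
    have S': "continuous_map (prod_topology (disc e) Y) Y (\<lambda>p. S (\<phi> e (fst p), snd p))"
      by (intro continuous_map_comp[OF S[OF e]] continuous_map_pairedI continuous_map_snd
          continuous_map_comp[OF continuous_map_char_cell[OF e]] continuous_map_fst)
    let ?DY = "topspace (prod_topology (disc e) Y)"
    have "\<exists>T' H'. continuous_map (prod_topology (disc e) Y) Y T' \<and>
      continuous_map (prod_topology (prod_topology (disc e) Y) II) Y H' \<and>
      (\<forall>p \<in> ?A \<times> topspace Y. T' p = snd (G0 (\<phi> e (fst p))) (snd p)) \<and>
      (\<forall>p \<in> ?A \<times> topspace Y. \<forall>t \<in> {0..1}. H' (p,t) = ?H (p,t)) \<and>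
      (\<forall>p \<in> ?DY. H' (p,0) = snd p \<and>
         H' (p,1) = (\<lambda>p. S (\<phi> e (fst p), snd p)) (fst p, T' p))"
    proof (rule right_inverse_extension[OF ndr S' Q Q01 T H])
      show "?H (p,0) = snd p" if "p \<in> ?A \<times> topspace Y" for p using that HA by auto
      show "?H (p,1) = S (\<phi> e (fst (fst p, snd (G0 (\<phi> e (fst p))) (snd p))), snd (fst p, snd (G0 (\<phi> e (fst p))) (snd p)))"
        if "p \<in> ?A \<times> topspace Y" for p using that HA by auto
    qed
    then obtain T' H' where T': "continuous_map (prod_topology (disc e) Y) Y T'"
      and H': "continuous_map (prod_topology (prod_topology (disc e) Y) II) Y H'"
      and T'A: "\<forall>p \<in> ?A \<times> topspace Y. T' p = snd (G0 (\<phi> e (fst p))) (snd p)"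
      and H'A: "\<forall>p \<in> ?A \<times> topspace Y. \<forall>t \<in> {0..1}. H' (p,t) = ?H (p,t)"
      and H'01: "\<forall>p \<in> ?DY. H' (p,0) = snd p \<and> H' (p,1) = S (\<phi> e (fst p), T' p)"
      unfolding fst_conv snd_conv by (elim exE conjE)
    have T'A: "T' (z,y) = snd (G0 (\<phi> e z)) y" if "z \<in> ?A" "y \<in> topspace Y" for z y
      using bspec[OF T'A, of "(z,y)"] that by simp
    have H'A: "H' ((z,y),t) = fst (G0 (\<phi> e z)) (t,y)" if "z \<in> ?A" "y \<in> topspace Y" "0 \<le> t" "t \<le> 1" for z y t
      using bspec[OF bspec[OF H'A, of "(z,y)"], of t] that by simp
    have H'0: "H' ((z,y),0) = y" and H'1: "H' ((z,y),1) = S (\<phi> e z, T' (z,y))"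
      if "z \<in> topspace (disc e)" "y \<in> topspace Y" for z y
      using bspec[OF H'01, of "(z,y)"] that by simp_all
    define g where "g = (\<lambda>z. (\<lambda>q. H' ((z, snd q), fst q), \<lambda>y. T' (z,y)))"
    define G' where "G' = attach (\<phi> e) (odisc e) g G0"
    have G'out: "G' x = G0 x" if "x \<notin> e" for x
      using that attach_outside[of x "\<phi> e" "odisc e"] image_odisc[OF e] by (simp add: G'_def)
    have G'in: "G' (\<phi> e z) = g z" if "z \<in> odisc e" for z
      using attach_inside[OF inj_odisc[OF e] that] by (simp add: G'_def)
    have G'b: "G' (\<phi> e z) = G0 (\<phi> e z)" if "z \<in> bdry e" for z
      using that odisc_bdry_disjoint[OF e] image_odisc[OF e] by (intro G'out) blast
    have G'T: "snd (G' (\<phi> e z)) y = T' (z,y)" if "z \<in> topspace (disc e)" "y \<in> topspace Y" for z y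
    proof (cases "z \<in> odisc e")
      case True
      then show ?thesis using G'in[OF True] by (simp add: g_def)
    next
      case False
      then have "z \<in> bdry e" using that(1) disc_split(1)[of e] by blast
      then show ?thesis using G'b[of z] T'A[of z y] that by simp
    qed
    have G'H: "fst (G' (\<phi> e z)) (t,y) = H' ((z,y),t)"
      if "z \<in> topspace (disc e)" "y \<in> topspace Y" "0 \<le> t" "t \<le> 1" for z y t
    proof (cases "z \<in> odisc e")
      case True
      then show ?thesis using G'in[OF True] by (simp add: g_def)
    next
      case False
      then have "z \<in> bdry e" using that(1) disc_split(1)[of e] by blast
      then show ?thesis using G'b[of z] H'A[of z y t] that by simp
    qed
    have "P e G'"
      unfolding P_def
    proof (intro conjI ballI impI)
      show "continuous_map (prod_topology (subtopology X (cell e)) Y) Y (\<lambda>p. snd (G' (fst p)) (snd p))"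
        unfolding cell_def
        by (rule continuous_map_prod_quotient[OF compact_unit_disc Hausdorff cont[OF e]],
            rule continuous_map_eq[OF T']) (auto simp: G'T)
      have "continuous_map (prod_topology (disc e) (prod_topology II Y)) Y (\<lambda>p. H' ((fst p, snd (snd p)), fst (snd p)))"
        by (intro continuous_map_comp[OF H'] continuous_map_pairedI continuous_map_fst cm_proj)
      then have "continuous_map (prod_topology (disc e) (prod_topology II Y)) Y
          (\<lambda>p. fst (G' (fst (\<phi> e (fst p), snd p))) (snd (\<phi> e (fst p), snd p)))"
        by (rule continuous_map_eq) (auto simp: G'H)
      then show "continuous_map (prod_topology (subtopology X (cell e)) (prod_topology II Y)) Y (\<lambda>p. fst (G' (fst p)) (snd p))"
        unfolding cell_def
        by (rule continuous_map_prod_quotient[OF compact_unit_disc Hausdorff cont[OF e]])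
      fix x y assume x: "x \<in> e" and y: "y \<in> topspace Y"
      obtain z where z: "z \<in> odisc e" "x = \<phi> e z" using x image_odisc[OF e] by blast
      then have zD: "z \<in> topspace (disc e)" using disc_split(1)[of e] by blast
      show "fst (G' x) (0,y) = y" "fst (G' x) (1,y) = S (x, snd (G' x) y)"
        using zD y H'0[of z y] H'1[of z y] by (auto simp: z(2) G'H G'T)
    next
      fix y assume x0: "x0 \<in> e" and y: "y \<in> topspace Y"
      obtain z where z: "z \<in> odisc e" "x0 = \<phi> e z" using x0 image_odisc[OF e] by blast
      then have zD: "z \<in> topspace (disc e)" and zA: "z \<in> A0" using disc_split(1)[of e] by (auto simp: A0_def)
      show "snd (G' x0) y = y" using T'A[of z y] zA y G0x[OF zA] G'T[OF zD y] by (simp add: z(2))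
      show "fst (G' x0) (t,y) = y" if "t \<in> {0..1}" for t
        using H'A[of z y t] zA y G0x[OF zA] G'H[OF zD y, of t] that by (simp add: z(2))
    qed
    moreover have "G' x = G x" if "x \<notin> e" for x
      using G'out[OF that] that by (auto simp: G0_def)
    ultimately show "\<exists>G'. (\<forall>x. x \<notin> e \<longrightarrow> G' x = G x) \<and> P e G'" by blast
  qed
  then obtain G where G: "\<And>e. e \<in> E \<Longrightarrow> P e G" by blast
  have ex: "\<exists>e\<in>E. x \<in> e" if "x \<in> topspace X" for x using that cover by blast
  show thesis
  proof (rule that[of "\<lambda>p. snd (G (fst p)) (snd p)" "\<lambda>p. fst (G (fst p)) (snd p)"])
    show "snd (G (fst (x0, y))) (snd (x0, y)) = y" if "y \<in> topspace Y" for y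
      using ex[OF x0] G that by (auto simp: P_def)
    show "fst (G (fst (x0, (t, y)))) (snd (x0, (t, y))) = y" if "0 \<le> t" "t \<le> 1" "y \<in> topspace Y" for t y
      using ex[OF x0] G that by (auto simp: P_def)
    show "fst (G (fst (x, (0, y)))) (snd (x, (0::real, y))) = y"
      "fst (G (fst (x, (1, y)))) (snd (x, (1::real, y))) = S (x, snd (G (fst (x, y))) (snd (x, y)))"
      if "x \<in> topspace X" "y \<in> topspace Y" for x y
      using ex[OF that(1)] G that by (auto simp: P_def)
  qed (use G in \<open>auto simp: P_def\<close>)
qed

end

section \<open>The diagonal of a complex\<close>

text \<open>Homotopy extension with the subspace \<open>Z \<times> {0} \<union> A \<times> I\<close>
  itself as target.\<close>

lemma ndr_pair_retraction:
  assumes ndr: "ndr_pair Z A"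
  shows "\<exists>r. continuous_map (prod_topology Z II) (prod_topology Z II) r \<and>
    (\<forall>z\<in>topspace Z. r (z,0) = (z,0)) \<and> (\<forall>a\<in>A. \<forall>t\<in>{0..1}. r (a,t) = (a,t)) \<and>
    (\<forall>p\<in>topspace (prod_topology Z II). snd (r p) = 0 \<or> fst (r p) \<in> A)"
proof -
  let ?P = "prod_topology Z II"
  let ?M = "{p. snd p = 0 \<or> fst p \<in> A}"
  show ?thesis
  proof (rule ndr_pair_HEP[OF ndr, of "subtopology ?P ?M" "\<lambda>z. (z,0)" "\<lambda>p. p"])
    show "continuous_map Z (subtopology ?P ?M) (\<lambda>z. (z,0))"
      by (intro continuous_map_into_sub continuous_map_pairedI) (auto intro: continuous_map_id[unfolded id_def])
    show "continuous_map (prod_topology (subtopology Z A) II) (subtopology ?P ?M) (\<lambda>p. p)"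
      unfolding prod_topology_subtopology_left
      by (intro continuous_map_into_sub continuous_map_from_subtopology continuous_map_id[unfolded id_def]) auto
    fix r assume r: "continuous_map ?P (subtopology ?P ?M) r"
      and r0: "\<And>z. z \<in> topspace Z \<Longrightarrow> r (z,0) = (z,0)"
      and rA: "\<And>a t. a \<in> A \<Longrightarrow> 0 \<le> t \<Longrightarrow> t \<le> 1 \<Longrightarrow> r (a,t) = (a,t)"
    have "continuous_map ?P ?P r" using continuous_map_into_fulltopology[OF r] .
    moreover have "snd (r p) = 0 \<or> fst (r p) \<in> A" if "p \<in> topspace ?P" for p
      using continuous_map_in[OF r that] by simp
    ultimately show ?thesis using r0 rA by (intro exI[of _ r]) auto
  qed simp
qed

context cw
begin

abbreviation bdry2 :: "'a set \<Rightarrow> 'a set \<Rightarrow> ((nat \<Rightarrow> real) \<times> (nat \<Rightarrow> real)) set" where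
  "bdry2 e c \<equiv> topspace (disc e) \<times> bdry c \<union> bdry e \<times> topspace (disc c)"

text \<open>The product of two distinct open cells misses the diagonal, so retracting onto bottom
  and walls suffices there. For \<open>e = c\<close> the cylinder over the diagonal of the disc has
  to be kept as well.\<close>

lemma cell_pair_retraction:
  assumes e: "e \<in> E" and c: "c \<in> E"
  shows "\<exists>r. continuous_map (prod_topology (prod_topology (disc e) (disc c)) II)
      (prod_topology (prod_topology (disc e) (disc c)) II) r \<and>
    (\<forall>b\<in>topspace (disc e) \<times> topspace (disc c). r (b,0) = (b,0)) \<and>
    (\<forall>b\<in>bdry2 e c. \<forall>t\<in>{0..1}. r (b,t) = (b,t)) \<and>
    (e = c \<longrightarrow> (\<forall>z\<in>topspace (disc e). \<forall>t\<in>{0..1}. r ((z,z),t) = ((z,z),t))) \<and>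
    (\<forall>p\<in>topspace (prod_topology (prod_topology (disc e) (disc c)) II).
       snd (r p) = 0 \<or> fst (r p) \<in> bdry2 e c \<or> e = c \<and> fst (fst (r p)) = snd (fst (r p)))"
proof (cases "e = c")
  case False
  have "ndr_pair (prod_topology (disc e) (disc c)) (bdry2 e c)"
    by (rule ndr_pair_prod[OF ndr_disc_boundary ndr_disc_boundary])
  from ndr_pair_retraction[OF this] show ?thesis using False by simp
next
  case True
  let ?D = "disc e"
  let ?P = "prod_topology (prod_topology ?D ?D) II"
  show ?thesis
  proof (rule disc_diagonal_retraction[of "d e"])
    fix r assume r: "continuous_map ?P ?P r"
      and r0: "\<And>b. b \<in> topspace ?D \<times> topspace ?D \<Longrightarrow> r (b,0) = (b,0)"
      and rb: "\<And>z z' t. \<lbrakk>z \<in> topspace ?D; z' \<in> topspace ?D; 0 \<le> t; t \<le> 1;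
        z \<in> bdry e \<or> z' \<in> bdry e\<rbrakk> \<Longrightarrow> r ((z,z'),t) = ((z,z'),t)"
      and rd: "\<And>z t. \<lbrakk>z \<in> topspace ?D; 0 \<le> t; t \<le> 1\<rbrakk> \<Longrightarrow> r ((z,z),t) = ((z,z),t)"
      and ro: "\<And>z z' t. \<lbrakk>z \<in> topspace ?D; z' \<in> topspace ?D; 0 \<le> t; t \<le> 1\<rbrakk> \<Longrightarrow>
       snd (r ((z,z'),t)) = 0 \<or> fst (fst (r ((z,z'),t))) \<in> bdry e
       \<or> snd (fst (r ((z,z'),t))) \<in> bdry e
       \<or> fst (fst (r ((z,z'),t))) = snd (fst (r ((z,z'),t)))"
    have bD: "bdry e \<subseteq> topspace ?D" by (rule disc_boundary_subset)
    have 1: "r (b,t) = (b,t)" if "b \<in> bdry2 e e" "t \<in> {0..1}" for b t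
    proof -
      obtain z z' where b: "b = (z,z')" by (cases b)
      show ?thesis unfolding b by (rule rb) (use that bD in \<open>auto simp: b\<close>)
    qed
    have 2: "snd (r p) = 0 \<or> fst (r p) \<in> bdry2 e e \<or> fst (fst (r p)) = snd (fst (r p))"
      if p: "p \<in> topspace ?P" for p
    proof -
      obtain z z' t where pz: "p = ((z,z'),t)" by (metis surj_pair)
      obtain w w' s where rp: "r p = ((w,w'),s)" by (metis surj_pair)
      have "w \<in> topspace ?D" "w' \<in> topspace ?D"
        using continuous_map_in[OF r p] by (simp_all add: rp)
      moreover have "s = 0 \<or> w \<in> bdry e \<or> w' \<in> bdry e \<or> w = w'"
        using ro[of z z' t] p rp by (simp add: pz)
      ultimately show ?thesis by (auto simp: rp)
    qed
    show ?thesis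
      unfolding True[symmetric]
      by (rule exI[of _ r]) (use r r0 rd 1 2 in \<open>simp del: topspace_prod_topology\<close>)
  qed
qed

text \<open>\<open>G x t\<close> stands for the value at \<open>(x,t)\<close> of a retraction of
  \<open>X \<times> X \<times> I\<close> onto the bottom together with the cylinder over the
  diagonal. It is curried in \<open>x\<close> so that \<open>attach\<close> can redefine it on one
  product of open cells.\<close>

definition diag_data :: "('a \<times> 'a \<Rightarrow> real \<Rightarrow> ('a \<times> 'a) \<times> real) \<Rightarrow> 'a \<times> 'a \<Rightarrow> bool" where
  "diag_data G x \<longleftrightarrow> G x 0 = (x,0) \<and> (fst x = snd x \<longrightarrow> (\<forall>t\<in>{0..1}. G x t = (x,t))) \<and>
     (\<forall>t\<in>{0..1}. snd (G x t) = 0 \<or> fst (fst (G x t)) = snd (fst (G x t)))"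

lemma cell_lower:
  assumes e: "e \<in> E" and x: "x \<in> cell e"
  shows "x \<in> e \<or> (\<exists>c\<in>E. d c < d e \<and> x \<in> c)"
proof (cases "x \<in> e")
  case False
  obtain F where F: "F \<subseteq> {c \<in> E. d c < d e}" "\<phi> e ` bdry e \<subseteq> \<Union>F"
    using boundary_cover[OF e] by blast
  have "x \<in> \<phi> e ` bdry e" using False x by (simp add: cell_eq[OF e])
  then have "x \<in> \<Union>F" using F(2) by (rule subsetD[rotated])
  then obtain c where c: "c \<in> F" "x \<in> c" by (rule UnionE)
  then show ?thesis using F(1) by auto
qed simp

text \<open>Over a product of closed discs the new map is \<open>R\<close> after \<open>r\<close>:
  the retraction \<open>r\<close> ends in bottom, walls and diagonal cylinder, and \<open>R\<close>
  uses the map already constructed on the walls and just \<open>\<psi>\<close> on the other two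
  parts.\<close>

lemma diagonal_retraction:
  "\<exists>G. (\<forall>e\<in>E. \<forall>c\<in>E. continuous_map
       (prod_topology (subtopology (prod_topology X X) (cell e \<times> cell c)) II)
       (prod_topology (prod_topology X X) II) (\<lambda>p. G (fst p) (snd p))) \<and>
     (\<forall>x\<in>topspace X \<times> topspace X. diag_data G x)"
proof -
  let ?XX = "prod_topology X X"
  let ?V = "prod_topology ?XX II"
  have HXX: "Hausdorff_space ?XX" using Hausdorff by (simp add: Hausdorff_space_prod_topology)
  define P where "P = (\<lambda>(e,c) G. continuous_map (prod_topology (subtopology ?XX (cell e \<times> cell c)) II) ?V
       (\<lambda>p. G (fst p) (snd p)) \<and> (\<forall>x\<in>e \<times> c. diag_data G x))"
  have PD: "diag_data G x" if "P (a,b) G" "x \<in> a \<times> b" for a b G x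
    using that(1) unfolding P_def prod.case by (elim conjE) (rule bspec[OF _ that(2)])
  have loc: "P i G'" if i: "i \<in> E \<times> E" and 1: "\<And>x. x \<in> fst i \<times> snd i \<Longrightarrow> G x = G' x"
    and 2: "\<And>j x. j \<in> E \<times> E \<Longrightarrow> d (fst j) + d (snd j) < d (fst i) + d (snd i) \<Longrightarrow>
        x \<in> fst j \<times> snd j \<Longrightarrow> G x = G' x" and PG: "P i G" for i G G'
  proof -
    obtain e c where ec: "i = (e,c)" "e \<in> E" "c \<in> E" using i by blast
    have eq: "G (x,y) = G' (x,y)" if x: "x \<in> cell e" and y: "y \<in> cell c" for x y
    proof -
      obtain a where a: "a \<in> E" "x \<in> a" "a = e \<or> d a < d e" using cell_lower[OF ec(2) x] ec(2) by blast
      obtain b where b: "b \<in> E" "y \<in> b" "b = c \<or> d b < d c" using cell_lower[OF ec(3) y] ec(3) by blast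
      show ?thesis
      proof (cases "a = e \<and> b = c")
        case True
        then show ?thesis using 1[of "(x,y)"] a b by (simp add: ec)
      next
        case False
        then have "d a + d b < d e + d c" using a(3) b(3) by auto
        then show ?thesis using 2[of "(a,b)" "(x,y)"] a b by (simp add: ec)
      qed
    qed
    have "continuous_map (prod_topology (subtopology ?XX (cell e \<times> cell c)) II) ?V (\<lambda>p. G' (fst p) (snd p))"
      by (rule continuous_map_eq[of _ _ "\<lambda>p. G (fst p) (snd p)"]) (use PG eq in \<open>auto simp: P_def ec\<close>)
    moreover have "diag_data G' x" if "x \<in> e \<times> c" for x
    proof -
      have "diag_data G x" by (rule PD[OF _ that]) (use PG in \<open>simp add: ec(1)\<close>)
      moreover have "G x = G' x" by (rule 1) (use that in \<open>simp add: ec(1)\<close>)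
      ultimately show ?thesis unfolding diag_data_def by simp
    qed
    ultimately show ?thesis unfolding P_def ec(1) prod.case by blast
  qed
  have "\<exists>G. \<forall>i\<in>E \<times> E. P i G"
  proof (rule cell_recursion[where C = "\<lambda>i. fst i \<times> snd i" and \<delta> = "\<lambda>i. d (fst i) + d (snd i)"])
    show "fst i \<times> snd i \<inter> fst j \<times> snd j = {}" if "i \<in> E \<times> E" "j \<in> E \<times> E" "i \<noteq> j" for i j
    proof (rule ccontr)
      assume "fst i \<times> snd i \<inter> fst j \<times> snd j \<noteq> {}"
      then obtain x y where "x \<in> fst i" "x \<in> fst j" "y \<in> snd i" "y \<in> snd j" by auto
      then have "fst i = fst j" "snd i = snd j"
        using cells_eq[of "fst i" "fst j" x] cells_eq[of "snd i" "snd j" y] that(1,2) by auto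
      then show False using that(3) by (simp add: prod_eq_iff)
    qed
    show "P i G'" if "i \<in> E \<times> E" "\<And>x. x \<in> fst i \<times> snd i \<Longrightarrow> G x = G' x"
      "\<And>j x. j \<in> E \<times> E \<Longrightarrow> d (fst j) + d (snd j) < d (fst i) + d (snd i) \<Longrightarrow>
        x \<in> fst j \<times> snd j \<Longrightarrow> G x = G' x" "P i G" for i G G'
      using that by (rule loc)
    fix i G assume i: "i \<in> E \<times> E"
      and PG: "\<And>j. j \<in> E \<times> E \<Longrightarrow> d (fst j) + d (snd j) < d (fst i) + d (snd i) \<Longrightarrow> P j G"
    obtain e c where ec: "i = (e,c)" and e: "e \<in> E" and c: "c \<in> E" using i by blast
    let ?D = "prod_topology (disc e) (disc c)"
    define \<psi> where "\<psi> = (\<lambda>b. (\<phi> e (fst b), \<phi> c (snd b)))"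
    have cD: "compact_space ?D" by (simp add: compact_space_prod_topology compact_unit_disc)
    have c\<psi>: "continuous_map ?D ?XX \<psi>"
      unfolding \<psi>_def
      by (intro continuous_map_pairedI continuous_map_comp[OF cont[OF e]] continuous_map_comp[OF cont[OF c]]
          continuous_map_fst continuous_map_snd)
    have im\<psi>: "\<psi> ` topspace ?D = cell e \<times> cell c" by (force simp: \<psi>_def cell_def)
    let ?B = "bdry2 e c"
    have bdD: "bdry e \<subseteq> topspace (disc e)" "bdry c \<subseteq> topspace (disc c)" by (rule disc_boundary_subset)+
    have ndrB: "ndr_pair ?D ?B" by (rule ndr_pair_prod[OF ndr_disc_boundary ndr_disc_boundary])
    obtain Fe where Fe: "finite Fe" "Fe \<subseteq> {a \<in> E. d a < d e}" "\<phi> e ` bdry e \<subseteq> \<Union>Fe"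
      using boundary_cover[OF e] by blast
    obtain Fc where Fc: "finite Fc" "Fc \<subseteq> {a \<in> E. d a < d c}" "\<phi> c ` bdry c \<subseteq> \<Union>Fc"
      using boundary_cover[OF c] by blast
    \<comment> \<open>A boundary point of the product of discs has at least one coordinate in a
      lower cell, while the other may still lie in the open cell \<open>e\<close> or
      \<open>c\<close>. Hence all pairs except \<open>(e,c)\<close> itself; each has a smaller sum
      of dimensions.\<close>
    define F where "F = (insert e Fe \<times> insert c Fc) - {(e,c)}"
    have F: "finite F" using Fe(1) Fc(1) by (simp add: F_def)
    have Fl: "a \<in> E" "b \<in> E" "d a + d b < d e + d c" if "(a,b) \<in> F" for a b
    proof -
      have "a = e \<or> a \<in> E \<and> d a < d e" "b = c \<or> b \<in> E \<and> d b < d c" "\<not> (a = e \<and> b = c)"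
        using that Fe(2) Fc(2) unfolding F_def by blast+
      then show "a \<in> E" "b \<in> E" "d a + d b < d e + d c" using e c by auto
    qed
    have PF: "P (a,b) G" if "(a,b) \<in> F" for a b
      using PG[of "(a,b)"] Fl[OF that] by (simp add: ec)
    have \<psi>B: "\<exists>a b. (a,b) \<in> F \<and> \<psi> q \<in> a \<times> b" if q: "q \<in> ?B" for q
    proof -
      obtain z z' where zz: "q = (z,z')" by (cases q)
      have z: "z \<in> topspace (disc e)" "z' \<in> topspace (disc c)" using q bdD by (auto simp: zz)
      have in1: "\<exists>a\<in>Fe. \<phi> e z \<in> a" if "z \<in> bdry e"
      proof -
        have "\<phi> e z \<in> \<Union>Fe" using that by (intro subsetD[OF Fe(3)] imageI)
        then show ?thesis by (rule UnionE) (rule bexI)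
      qed
      have in2: "\<exists>a\<in>Fc. \<phi> c z' \<in> a" if "z' \<in> bdry c"
      proof -
        have "\<phi> c z' \<in> \<Union>Fc" using that by (intro subsetD[OF Fc(3)] imageI)
        then show ?thesis by (rule UnionE) (rule bexI)
      qed
      have o1: "\<phi> e z \<in> e" if "z \<notin> bdry e"
      proof -
        have "z \<in> odisc e" using that z(1) disc_split(1)[of e] by blast
        then show ?thesis using image_odisc[OF e] by blast
      qed
      have o2: "\<phi> c z' \<in> c" if "z' \<notin> bdry c"
      proof -
        have "z' \<in> odisc c" using that z(2) disc_split(1)[of c] by blast
        then show ?thesis using image_odisc[OF c] by blast
      qed
      have "\<exists>a. a \<in> insert e Fe \<and> \<phi> e z \<in> a \<and> (z \<in> bdry e \<longrightarrow> a \<in> Fe)"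
        using in1 o1 by (cases "z \<in> bdry e") auto
      then obtain a where a: "a \<in> insert e Fe" "\<phi> e z \<in> a" "z \<in> bdry e \<longrightarrow> a \<in> Fe" by (elim exE conjE)
      have "\<exists>b. b \<in> insert c Fc \<and> \<phi> c z' \<in> b \<and> (z' \<in> bdry c \<longrightarrow> b \<in> Fc)"
        using in2 o2 by (cases "z' \<in> bdry c") auto
      then obtain b where b: "b \<in> insert c Fc" "\<phi> c z' \<in> b" "z' \<in> bdry c \<longrightarrow> b \<in> Fc" by (elim exE conjE)
      have "e \<notin> Fe" "c \<notin> Fc" using Fe(2) Fc(2) by auto
      then have "(a,b) \<noteq> (e,c)" using a(3) b(3) q by (auto simp: zz)
      then have "(a,b) \<in> F \<and> \<psi> q \<in> a \<times> b" using a b by (auto simp: F_def \<psi>_def zz)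
      then show ?thesis by (intro exI)
    qed
    have dB: "diag_data G (\<psi> q)" if "q \<in> ?B" for q
    proof -
      obtain a b where ab: "(a,b) \<in> F" "\<psi> q \<in> a \<times> b" using \<psi>B[OF \<open>q \<in> ?B\<close>] by (elim exE conjE)
      show ?thesis by (rule PD[OF PF[OF ab(1)] ab(2)])
    qed
    have contB: "continuous_map (prod_topology (subtopology ?D ?B) II) ?V (\<lambda>p. G (\<psi> (fst p)) (snd p))"
    proof -
      have "continuous_map (prod_topology (subtopology ?D ?B) II) ?V
         (\<lambda>p. (\<lambda>p. G (fst p) (snd p)) (\<psi> (fst p), snd p))"
      proof (rule attach_boundary_continuous[OF c\<psi> F, where C = "\<lambda>(a,b). cell a \<times> cell b"])
        fix j assume j: "j \<in> F"
        obtain a b where ab: "j = (a,b)" by (cases j)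
        show "closedin ?XX (case j of (a, b) \<Rightarrow> cell a \<times> cell b)"
          using closedin_cell Fl j by (simp add: ab closedin_prod_Times_iff)
        show "continuous_map (prod_topology (subtopology ?XX (case j of (a, b) \<Rightarrow> cell a \<times> cell b)) II) ?V
          (\<lambda>p. G (fst p) (snd p))"
          using PF j by (simp add: ab P_def)
      next
        show "\<psi> ` ?B \<subseteq> (\<Union>j\<in>F. case j of (a, b) \<Rightarrow> cell a \<times> cell b)"
        proof (rule image_subsetI)
          fix q assume q: "q \<in> ?B"
          obtain a b where ab: "(a,b) \<in> F" "\<psi> q \<in> a \<times> b" using \<psi>B[OF q] by (elim exE conjE)
          have "\<psi> q \<in> cell a \<times> cell b"
            using ab(2) subset_cell[OF Fl(1)[OF ab(1)]] subset_cell[OF Fl(2)[OF ab(1)]] by auto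
          then show "\<psi> q \<in> (\<Union>j\<in>F. case j of (a, b) \<Rightarrow> cell a \<times> cell b)"
            using ab(1) by (intro UN_I[of "(a,b)"]) auto
        qed
      qed
      then show ?thesis by simp
    qed
    have "\<exists>r. continuous_map (prod_topology ?D II) (prod_topology ?D II) r \<and>
      (\<forall>b\<in>topspace (disc e) \<times> topspace (disc c). r (b,0) = (b,0)) \<and>
      (\<forall>b\<in>?B. \<forall>t\<in>{0..1}. r (b,t) = (b,t)) \<and>
      (e = c \<longrightarrow> (\<forall>z\<in>topspace (disc e). \<forall>t\<in>{0..1}. r ((z,z),t) = ((z,z),t))) \<and>
      (\<forall>p\<in>topspace (prod_topology ?D II).
         snd (r p) = 0 \<or> fst (r p) \<in> ?B \<or> e = c \<and> fst (fst (r p)) = snd (fst (r p)))"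
      by (rule cell_pair_retraction[OF e c])
    then obtain r where r: "continuous_map (prod_topology ?D II) (prod_topology ?D II) r"
      and r0: "\<forall>b\<in>topspace (disc e) \<times> topspace (disc c). r (b,0) = (b,0)"
      and rB: "\<forall>b\<in>?B. \<forall>t\<in>{0..1}. r (b,t) = (b,t)"
      and rd: "e = c \<longrightarrow> (\<forall>z\<in>topspace (disc e). \<forall>t\<in>{0..1}. r ((z,z),t) = ((z,z),t))"
      and ro: "\<forall>p\<in>topspace (prod_topology ?D II).
         snd (r p) = 0 \<or> fst (r p) \<in> ?B \<or> e = c \<and> fst (fst (r p)) = snd (fst (r p))"
      by (elim exE conjE)
    define \<Delta> where "\<Delta> = (if e = c then (\<lambda>z. (z,z)) ` topspace (disc e) else {})"
    \<comment> \<open>The three closed parts overlap, for instance where the diagonal meets the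
      walls. There \<open>diag_data\<close> of the old \<open>G\<close> makes the prescriptions
      agree.\<close>
    define R where "R = (\<lambda>p. if snd p = 0 then (\<psi> (fst p), 0) else if fst p \<in> ?B then G (\<psi> (fst p)) (snd p)
        else (\<psi> (fst p), snd p))"
    have RB: "R (b,t) = G (\<psi> b) t" if "b \<in> ?B" for b t
      using dB[OF that] that by (simp add: R_def diag_data_def)
    have R\<Delta>: "R (b,t) = (\<psi> b,t)" if "b \<in> \<Delta>" "t \<in> {0..1}" for b t
    proof (cases "b \<in> ?B")
      case True
      have "fst (\<psi> b) = snd (\<psi> b)" using that(1) by (auto simp: \<Delta>_def \<psi>_def split: if_splits)
      then show ?thesis using dB[OF True] RB[OF True] that(2) by (simp add: diag_data_def)
    qed (simp add: R_def)
    let ?M0 = "topspace ?D \<times> {0::real}" and ?MB = "?B \<times> topspace II" and ?M\<Delta> = "\<Delta> \<times> topspace II"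
    let ?DI = "prod_topology ?D II"
    have cont_id: "continuous_map ?DI ?V (\<lambda>p. (\<psi> (fst p), snd p))"
      by (intro continuous_map_pairedI continuous_map_comp[OF c\<psi>] continuous_map_fst continuous_map_snd)
    have cl0: "closedin ?DI ?M0"
      using closedin_topspace[of ?D] closed_subset[of "{0::real}" "{0..1}"]
      by (simp only: closedin_prod_Times_iff) simp
    have clB: "closedin ?DI ?MB"
      using ndr_pair_closedin[OF ndrB] closedin_topspace[of II] by (simp only: closedin_prod_Times_iff) simp
    have "closedin ?D \<Delta>"
      using Hausdorff_unit_disc[of "d e"] by (auto simp: \<Delta>_def Hausdorff_space_closedin_diagonal)
    then have cl\<Delta>: "closedin ?DI ?M\<Delta>"
      using closedin_topspace[of II] by (simp only: closedin_prod_Times_iff) simp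
    have cR: "continuous_map (subtopology ?DI (?M0 \<union> ?MB \<union> ?M\<Delta>)) ?V R"
    proof (intro continuous_map_union_closed closedin_Un cl0 clB cl\<Delta>)
      show "continuous_map (subtopology ?DI ?M0) ?V R"
        by (rule continuous_map_eq[OF continuous_map_from_subtopology[OF cont_id]]) (auto simp: R_def)
      show "continuous_map (subtopology ?DI ?MB) ?V R"
        using contB unfolding prod_topology_subtopology_left
        by (rule continuous_map_eq) (use RB in \<open>auto\<close>)
      show "continuous_map (subtopology ?DI ?M\<Delta>) ?V R"
        by (rule continuous_map_eq[OF continuous_map_from_subtopology[OF cont_id]]) (use R\<Delta> in auto)
    qed
    have rM: "r p \<in> ?M0 \<union> ?MB \<union> ?M\<Delta>" if p: "p \<in> topspace ?DI" for p
    proof -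
      have rp: "r p \<in> topspace ?DI" by (rule continuous_map_in[OF r p])
      obtain z z' t where zz: "r p = ((z,z'),t)" by (metis surj_pair)
      have "t = 0 \<or> (z,z') \<in> ?B \<or> e = c \<and> z = z'" using bspec[OF ro p] by (simp add: zz)
      then show ?thesis using rp by (auto simp: zz \<Delta>_def)
    qed
    have cRr: "continuous_map ?DI ?V (\<lambda>p. R (r p))"
      by (rule continuous_map_comp[OF cR continuous_map_into_sub[OF r rM]])
    define G' where "G' = attach \<psi> (odisc e \<times> odisc c) (\<lambda>b t. R (r (b,t))) G"
    have \<psi>m: "\<psi> = map_prod (\<phi> e) (\<phi> c)" by (simp add: \<psi>_def fun_eq_iff)
    have im\<psi>o: "\<psi> ` (odisc e \<times> odisc c) = e \<times> c"
      unfolding \<psi>m by (rule map_prod_surj_on[OF image_odisc[OF e] image_odisc[OF c]])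
    have inj\<psi>: "inj_on \<psi> (odisc e \<times> odisc c)"
      unfolding \<psi>m by (rule map_prod_inj_on[OF inj_odisc[OF e] inj_odisc[OF c]])
    have G'out: "G' x = G x" if "x \<notin> e \<times> c" for x
      using that attach_outside[of x \<psi> "odisc e \<times> odisc c"] im\<psi>o by (simp add: G'_def)
    have G'in: "G' (\<psi> b) t = R (r (b,t))" if "b \<in> odisc e \<times> odisc c" for b t
      using fun_cong[OF attach_inside[OF inj\<psi> that, of "\<lambda>b t. R (r (b,t))" G], of t] by (simp only: G'_def)
    have G'D: "G' (\<psi> b) t = R (r (b,t))" if b: "b \<in> topspace ?D" and t: "t \<in> {0..1}" for b t
    proof (cases "b \<in> odisc e \<times> odisc c")
      case True
      then show ?thesis by (rule G'in)
    next
      case False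
      then have bB: "b \<in> ?B" using b disc_split(1)[of e] disc_split(1)[of c] by (cases b) auto
      obtain a a' where ab: "(a,a') \<in> F" "\<psi> b \<in> a \<times> a'" using \<psi>B[OF bB] by (elim exE conjE)
      have "\<psi> b \<notin> e \<times> c"
      proof
        assume "\<psi> b \<in> e \<times> c"
        then have "a = e" "a' = c"
          using cells_eq[OF Fl(1)[OF ab(1)] e, of "fst (\<psi> b)"] cells_eq[OF Fl(2)[OF ab(1)] c, of "snd (\<psi> b)"] ab(2) by auto
        then show False using ab(1) by (simp add: F_def)
      qed
      then have "G' (\<psi> b) = G (\<psi> b)" by (rule G'out)
      moreover have "r (b,t) = (b,t)" using bspec[OF bspec[OF rB bB] t] .
      ultimately show ?thesis using RB[OF bB] by simp
    qed
    have "P (e,c) G'"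
      unfolding P_def prod.case
    proof (intro conjI ballI)
      have "continuous_map ?DI ?V (\<lambda>p. (\<lambda>p. G' (fst p) (snd p)) (\<psi> (fst p), snd p))"
        by (rule continuous_map_eq[OF cRr]) (use G'D in auto)
      then show "continuous_map (prod_topology (subtopology ?XX (cell e \<times> cell c)) II) ?V (\<lambda>p. G' (fst p) (snd p))"
        unfolding im\<psi>[symmetric] by (rule continuous_map_prod_quotient[OF cD HXX c\<psi>])
      fix x assume "x \<in> e \<times> c"
      then obtain b where b: "b \<in> odisc e \<times> odisc c" "x = \<psi> b" using im\<psi>o by blast
      have bD: "b \<in> topspace ?D" using b(1) disc_split(1)[of e] disc_split(1)[of c] by auto
      have bB: "b \<notin> ?B" using b(1) disc_split(2)[of e] disc_split(2)[of c] by auto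
      show "diag_data G' x"
        unfolding diag_data_def
      proof (intro conjI impI ballI)
        have "r (b,0) = (b,0)" using bspec[OF r0, of b] bD by simp
        then show "G' x 0 = (x,0)" using G'in[OF b(1), of 0] by (simp add: b(2) R_def)
      next
        fix t :: real assume eq: "fst x = snd x" and t: "t \<in> {0..1}"
        obtain z z' where zz: "b = (z,z')" by (cases b)
        have x: "fst x \<in> e" "snd x \<in> c" using \<open>x \<in> e \<times> c\<close> by auto
        then have "e = c" using cells_eq[OF e c, of "fst x"] eq by simp
        moreover have "z = z'"
          using inj_onD[OF inj_odisc[OF e], of z z'] eq b \<open>e = c\<close> by (simp add: zz \<psi>_def)
        ultimately have "r (b,t) = (b,t)" "b \<in> \<Delta>"
          using rd t bD by (auto simp: zz \<Delta>_def)
        then show "G' x t = (x,t)" using G'in[OF b(1), of t] R\<Delta>[OF _ t] by (simp add: b(2))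
      next
        fix t :: real assume t: "t \<in> {0..1}"
        have p: "(b,t) \<in> topspace ?DI" using bD t by simp
        obtain b' t' where bt: "r (b,t) = (b',t')" by (cases "r (b,t)")
        have t': "t' \<in> {0..1}" using continuous_map_in[OF r p] by (simp add: bt)
        have G'x: "G' x t = R (b',t')" using G'in[OF b(1), of t] by (simp add: b(2) bt)
        have "(b',t') \<in> ?M0 \<union> ?MB \<union> ?M\<Delta>" using rM[OF p] by (simp only: bt)
        then consider "t' = 0" | "b' \<in> ?B" | "b' \<in> \<Delta>" by auto
        then show "snd (G' x t) = 0 \<or> fst (fst (G' x t)) = snd (fst (G' x t))"
        proof cases
          case 1
          then show ?thesis by (simp add: G'x R_def)
        next
          case 2
          then show ?thesis using dB[OF 2] t' by (simp add: G'x RB diag_data_def)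
        next
          case 3
          have "fst (\<psi> b') = snd (\<psi> b')" using 3 by (auto simp: \<Delta>_def \<psi>_def split: if_splits)
          then show ?thesis by (simp add: G'x R\<Delta>[OF 3 t'])
        qed
      qed
    qed
    then show "\<exists>G'. (\<forall>x. x \<notin> fst i \<times> snd i \<longrightarrow> G' x = G x) \<and> P i G'"
      using G'out by (intro exI[of _ G']) (simp add: ec)
  qed
  then obtain G where G: "\<forall>i\<in>E \<times> E. P i G" by blast
  have "diag_data G x" if x: "x \<in> topspace X \<times> topspace X" for x
  proof -
    have "fst x \<in> \<Union>E" "snd x \<in> \<Union>E" using x cover by auto
    then obtain e c where ec: "e \<in> E" "fst x \<in> e" "c \<in> E" "snd x \<in> c" by (elim UnionE)
    have "P (e,c) G" using G ec by auto
    then show ?thesis by (rule PD) (use ec in \<open>simp add: mem_Times_iff\<close>)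
  qed
  moreover have "continuous_map (prod_topology (subtopology ?XX (cell e \<times> cell c)) II) ?V
       (\<lambda>p. G (fst p) (snd p))" if "e \<in> E" "c \<in> E" for e c
    using bspec[OF G, of "(e,c)"] that by (simp add: P_def)
  ultimately show ?thesis by (intro exI[of _ G]) simp
qed

end

section \<open>Mapping spaces are well-pointed\<close>

text \<open>Lets two paths in a Hausdorff space that agree at all positive times be identified at
  time 0.\<close>

lemma zero_in_closure: "(0::real) \<in> II closure_of {0<..1}"
  unfolding in_closure_of
proof (intro conjI allI impI)
  fix T assume T: "(0::real) \<in> T \<and> openin II T"
  then obtain V where V: "open V" "T = {0..1} \<inter> V" by (auto simp: openin_open)
  then obtain \<epsilon> where \<epsilon>: "\<epsilon> > 0" "\<And>y. dist y 0 < \<epsilon> \<Longrightarrow> y \<in> V" using T by (auto simp: open_dist)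
  then have "min 1 (\<epsilon>/2) \<in> {0<..1} \<and> min 1 (\<epsilon>/2) \<in> T" by (auto simp: V min_def)
  then show "\<exists>y. y \<in> {0<..1} \<and> y \<in> T" by blast
qed simp

context cw
begin

text \<open>The retraction \<open>G\<close> of \<open>X \<times> X \<times> I\<close> moves a point near the diagonal to the diagonal. Following its second
  coordinate and then its first coordinate backwards moves \<open>y\<close> to \<open>x\<close>. The supremum \<open>U g\<close> below measures
  how far the graphs of \<open>f\<close> and \<open>g\<close> are apart and vanishes only for \<open>g = f\<close>.\<close>

lemma ndr_mapping_space:
  assumes A: "compact_space A" "Hausdorff_space A" "topspace A \<noteq> {}" and f: "continuous_map A X f"
  shows "ndr_pair (mapping_space A X) {restrict f (topspace A)}"
proof -
  let ?XX = "prod_topology X X"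
  let ?V = "prod_topology ?XX II"
  obtain G where G: "\<forall>e\<in>E. \<forall>c\<in>E. continuous_map
       (prod_topology (subtopology ?XX (cell e \<times> cell c)) II) ?V (\<lambda>p. G (fst p) (snd p))"
     and dd: "\<forall>x\<in>topspace X \<times> topspace X. diag_data G x"
    using diagonal_retraction by (elim exE conjE)
  define L where "L = f ` topspace A"
  have L: "compactin X L" unfolding L_def
    using A(1) f by (intro image_compactin[of A]) (simp_all flip: compact_space_def)
  let ?SL = "subtopology X L"
  \<comment> \<open>\<open>G\<close> is continuous only over products of closed cells. The first
    variable runs through the compact set \<open>L\<close>, which finitely many closed cells cover;
    the second runs through all of \<open>X\<close>, which is handled in \<open>c2\<close> with
    \<open>L \<times> I\<close> as the compact Hausdorff factor.\<close>
  have c1: "continuous_map (prod_topology ?SL (prod_topology II (subtopology X (cell c)))) ?V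
      (\<lambda>p. G (fst p, snd (snd p)) (fst (snd p)))" if c: "c \<in> E" for c
  proof (rule continuous_map_compact_cells[OF _ L])
    fix e assume e: "e \<in> E"
    let ?P = "prod_topology (subtopology X (cell e)) (prod_topology II (subtopology X (cell c)))"
    have 1: "continuous_map ?P (prod_topology (subtopology ?XX (cell e \<times> cell c)) II)
        (\<lambda>p. ((fst p, snd (snd p)), fst (snd p)))"
    proof (intro continuous_map_pairedI cm_proj(3) continuous_map_into_sub)
      show "continuous_map ?P X fst" by (rule continuous_map_into_fulltopology[OF continuous_map_fst])
      show "continuous_map ?P X (\<lambda>x. snd (snd x))" by (rule continuous_map_into_fulltopology[OF cm_proj(4)])
    qed auto
    show "continuous_map ?P ?V (\<lambda>p. G (fst p, snd (snd p)) (fst (snd p)))"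
      using continuous_map_comp[OF bspec[OF bspec[OF G e] c] 1] by simp
  qed
  have HSL: "Hausdorff_space ?SL" "compact_space ?SL"
    using Hausdorff L by (simp_all add: Hausdorff_space_subtopology compact_space_subtopology)
  have c2: "continuous_map (prod_topology (prod_topology ?SL II) X) ?V (\<lambda>q. G (fst (fst q), snd q) (snd (fst q)))"
  proof (rule continuous_map_product_cells)
    show "compact_space (prod_topology ?SL II)" "Hausdorff_space (prod_topology ?SL II)"
      using HSL by (simp_all add: compact_space_prod_topology Hausdorff_space_prod_topology
          Hausdorff_space_subtopology compact_space_subtopology)
    fix c assume c: "c \<in> E"
    let ?P = "prod_topology (prod_topology ?SL II) (subtopology X (cell c))"
    have "continuous_map ?P (prod_topology ?SL (prod_topology II (subtopology X (cell c))))
       (\<lambda>q. (fst (fst q), (snd (fst q), snd q)))"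
      by (intro continuous_map_pairedI cm_proj continuous_map_snd)
    from continuous_map_comp[OF c1[OF c] this]
    show "continuous_map ?P ?V (\<lambda>q. G (fst (fst q), snd q) (snd (fst q)))" by simp
  qed
  let ?W = "mapping_space A X"
  let ?C = "prod_topology A II"
  define \<Phi> where "\<Phi> = (\<lambda>q. G (f (fst (fst q)), snd q (fst (fst q))) (snd (fst q)))"
  have fL: "continuous_map A ?SL f" by (rule continuous_map_into_sub[OF f]) (simp add: L_def)
  have ev: "continuous_map (prod_topology A ?W) X (\<lambda>p. snd p (fst p))"
    by (rule continuous_map_eval[OF A(2,1)])
  have c\<Phi>: "continuous_map (prod_topology ?C ?W) ?V \<Phi>"
  proof -
    have 1: "continuous_map (prod_topology ?C ?W) A (\<lambda>q. fst (fst q))" by (rule cm_proj)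
    have "continuous_map (prod_topology ?C ?W) X (\<lambda>q. snd (fst (fst q), snd q) (fst (fst (fst q), snd q)))"
      by (rule continuous_map_comp[OF ev continuous_map_pairedI[OF 1 continuous_map_snd]])
    then have 2: "continuous_map (prod_topology ?C ?W) X (\<lambda>q. snd q (fst (fst q)))" by simp
    have "continuous_map (prod_topology ?C ?W) (prod_topology (prod_topology ?SL II) X)
       (\<lambda>q. ((f (fst (fst q)), snd (fst q)), snd q (fst (fst q))))"
      by (intro continuous_map_pairedI continuous_map_comp[OF fL 1] 2 cm_proj)
    from continuous_map_comp[OF c2 this] show ?thesis by (simp add: \<Phi>_def)
  qed
  have D: "diag_data G (f x, g x)" if "x \<in> topspace A" "g \<in> topspace ?W" for x g
    using bspec[OF dd, of "(f x, g x)"] continuous_map_in[OF f that(1)]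
      continuous_map_in[OF mapping_space_continuous[OF that(2)] that(1)] by simp
  have \<Phi>0: "\<Phi> ((x,0),g) = ((f x, g x),0)" if "x \<in> topspace A" "g \<in> topspace ?W" for x g
    using D[OF that] by (simp add: \<Phi>_def diag_data_def)
  have \<Phi>d: "snd (\<Phi> ((x,t),g)) = 0 \<or> fst (fst (\<Phi> ((x,t),g))) = snd (fst (\<Phi> ((x,t),g)))"
    if "x \<in> topspace A" "g \<in> topspace ?W" "0 \<le> t" "t \<le> 1" for x g t
    using D[OF that(1,2)] that(3,4) by (simp add: \<Phi>_def diag_data_def)
  have \<Phi>f: "\<Phi> ((x,t), restrict f (topspace A)) = ((f x, f x), t)"
    if "x \<in> topspace A" "0 \<le> t" "t \<le> 1" for x t
  proof -
    have "diag_data G (f x, f x)" using bspec[OF dd, of "(f x, f x)"] continuous_map_in[OF f that(1)] by simp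
    then show ?thesis using that by (simp add: \<Phi>_def diag_data_def)
  qed
  \<comment> \<open>The height lost under the retraction. If less than \<open>t\<close> is lost at
    time \<open>t\<close>, the remaining height is positive and the point is on the diagonal. So
    \<open>U g = 0\<close> gives the diagonal at all positive times, and \<open>U g < 1\<close>
    gives it at time 1.\<close>
  define F where "F = (\<lambda>q. snd (fst q) - snd (\<Phi> q))"
  have cF: "continuous_map (prod_topology ?C ?W) euclideanreal F"
    unfolding F_def
    by (intro continuous_map_diff continuous_map_II_D[OF cm_proj(2)] continuous_map_II_D[OF continuous_map_sndI[OF c\<Phi>]])
  have C: "compact_space ?C" "topspace ?C \<noteq> {}"
    using A by (auto simp: compact_space_prod_topology compact_space_subtopology)
  define U where "U = (\<lambda>g. SUP c\<in>topspace ?C. F (c,g))"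
  have FU: "F ((x,t),g) \<le> U g" if "x \<in> topspace A" "0 \<le> t" "t \<le> 1" "g \<in> topspace ?W" for x t g
    unfolding U_def by (rule continuous_map_Sup_compact(3)[OF C cF]) (use that in auto)
  obtain a where a: "a \<in> topspace A" using A(3) by blast
  have U0: "0 \<le> U g" if "g \<in> topspace ?W" for g
    using FU[OF a _ _ that, of 0] \<Phi>0[OF a that] by (simp add: F_def)
  have cU: "continuous_map ?W euclideanreal U"
    using continuous_map_Sup_compact(1)[OF C cF] by (simp add: U_def)
  let ?f = "restrict f (topspace A)"
  have fW: "?f \<in> topspace ?W" using f by (simp add: topspace_mapping_space continuous_map_eq)
  have Uf: "U ?f = 0"
  proof -
    obtain c where "c \<in> topspace ?C" "U ?f = F (c, ?f)"
      using continuous_map_Sup_compact(2)[OF C cF fW] by (auto simp: U_def)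
    then show ?thesis by (cases c) (auto simp: F_def \<Phi>f)
  qed
  have Ueq: "g = ?f" if g: "g \<in> topspace ?W" and "U g = 0" for g
  proof
    fix x show "g x = ?f x"
    proof (cases "x \<in> topspace A")
      case True
      have cx: "continuous_map II ?V (\<lambda>t. \<Phi> ((x,t),g))"
        using True g by (intro continuous_map_comp[OF c\<Phi>] continuous_map_pairedI) (auto intro: continuous_map_id[unfolded id_def])
      have "fst (fst (\<Phi> ((x,t),g))) = snd (fst (\<Phi> ((x,t),g)))" if "t \<in> {0<..1}" for t
        using FU[OF True _ _ g, of t] \<Phi>d[OF True g, of t] that \<open>U g = 0\<close> by (auto simp: F_def)
      then have "fst (fst (\<Phi> ((x,0),g))) = snd (fst (\<Phi> ((x,0),g)))"
        using forall_in_closure_of_eq[OF zero_in_closure Hausdorff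
          continuous_map_fstI[OF continuous_map_fstI[OF cx]] continuous_map_sndI[OF continuous_map_fstI[OF cx]]]
        by blast
      then show ?thesis using \<Phi>0[OF True g] True by simp
    next
      case False
      then show ?thesis using g by (auto simp: topspace_mapping_space extensional_def)
    qed
  qed
  \<comment> \<open>Full speed for \<open>U \<le> 1/2\<close>, standstill for
    \<open>U \<ge> 1\<close>. The midpoint \<open>s = 1/2\<close>, where the two halves of the path
    have to meet on the diagonal, is thus reached only if \<open>U < 1\<close>.\<close>
  define s where "s = (\<lambda>p. fst p * min 1 (max 0 (2 - 2 * U (snd p))))"
  have s01: "0 \<le> s p" "s p \<le> 1" if "0 \<le> fst p" "fst p \<le> 1" for p
    using that unfolding s_def by (auto intro: mult_nonneg_nonneg mult_le_one)
  define h where "h = (\<lambda>q. if s (snd q) \<le> 1/2 then snd (fst (\<Phi> ((fst q, 2 * s (snd q)), snd (snd q))))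
      else fst (fst (\<Phi> ((fst q, 2 - 2 * s (snd q)), snd (snd q)))))"
  let ?Q = "prod_topology A (prod_topology II ?W)"
  have cs: "continuous_map ?Q euclideanreal (\<lambda>q. s (snd q))"
    unfolding s_def
    by (intro continuous_map_real_mult continuous_map_real_min continuous_map_real_max continuous_map_diff
        continuous_map_II_D[OF cm_proj(3)] continuous_map_comp[OF cU] cm_proj) auto
  have ch: "continuous_map ?Q X h"
    unfolding h_def
  proof (rule continuous_map_cases_le[OF cs])
    let ?Q1 = "subtopology ?Q {q \<in> topspace ?Q. s (snd q) \<le> 1/2}"
    have "continuous_map ?Q1 ?V (\<lambda>q. \<Phi> ((fst q, 2 * s (snd q)), snd (snd q)))"
      by (intro continuous_map_comp[OF c\<Phi>] continuous_map_pairedI continuous_map_II_I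
          continuous_map_real_mult_left continuous_map_from_subtopology[OF cs]
          continuous_map_from_subtopology[OF continuous_map_fst] continuous_map_from_subtopology[OF cm_proj(4)])
         (use s01 in auto)
    then show "continuous_map ?Q1 X (\<lambda>q. snd (fst (\<Phi> ((fst q, 2 * s (snd q)), snd (snd q)))))"
      by (rule continuous_map_sndI[OF continuous_map_fstI])
    let ?Q2 = "subtopology ?Q {q \<in> topspace ?Q. 1/2 \<le> s (snd q)}"
    have "continuous_map ?Q2 ?V (\<lambda>q. \<Phi> ((fst q, 2 - 2 * s (snd q)), snd (snd q)))"
      by (intro continuous_map_comp[OF c\<Phi>] continuous_map_pairedI continuous_map_II_I continuous_map_diff
          continuous_map_real_mult_left continuous_map_from_subtopology[OF cs] continuous_map_canonical_const
          continuous_map_from_subtopology[OF continuous_map_fst] continuous_map_from_subtopology[OF cm_proj(4)])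
         (use s01 in auto)
    then show "continuous_map ?Q2 X (\<lambda>q. fst (fst (\<Phi> ((fst q, 2 - 2 * s (snd q)), snd (snd q)))))"
      by (rule continuous_map_fstI[OF continuous_map_fstI])
    show "snd (fst (\<Phi> ((fst q, 2 * s (snd q)), snd (snd q)))) = fst (fst (\<Phi> ((fst q, 2 - 2 * s (snd q)), snd (snd q))))"
      if q: "q \<in> topspace ?Q" and sq: "s (snd q) = 1/2" for q
    proof -
      obtain x t g where xtg: "q = (x,(t,g))" by (metis surj_pair)
      have x: "x \<in> topspace A" "0 \<le> t" "t \<le> 1" "g \<in> topspace ?W" using q by (auto simp: xtg)
      have "U g < 1"
      proof (rule ccontr)
        assume "\<not> U g < 1"
        then have "max 0 (2 - 2 * U g) = 0" by simp
        then have "s (snd q) = 0" by (simp add: s_def xtg)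
        then show False using sq by simp
      qed
      have "F ((x,1),g) \<le> U g" by (rule FU) (use x in auto)
      then have "snd (\<Phi> ((x,1),g)) \<noteq> 0" using \<open>U g < 1\<close> by (simp add: F_def)
      then have "fst (fst (\<Phi> ((x,1),g))) = snd (fst (\<Phi> ((x,1),g)))" using \<Phi>d[OF x(1,4), of 1] by simp
      then show ?thesis unfolding sq unfolding xtg by simp
    qed
  qed auto
  show ?thesis
  proof (rule ndr_pairI)
    show "continuous_map ?W euclideanreal (\<lambda>g. 2 * U g)" by (intro continuous_map_real_mult_left cU)
    show "0 \<le> 2 * U g" if "g \<in> topspace ?W" for g using U0[OF that] by simp
    show "{?f} = {g \<in> topspace ?W. 2 * U g = 0}" 
    proof (intro equalityI subsetI)
      fix g assume "g \<in> {g \<in> topspace ?W. 2 * U g = 0}"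
      then have "g = ?f" by (intro Ueq) simp_all
      then show "g \<in> {?f}" by (rule ssubst) (rule singletonI)
    next
      fix g assume "g \<in> {?f}"
      then have "g = ?f" by (rule singletonD)
      then show "g \<in> {g \<in> topspace ?W. 2 * U g = 0}" by (rule ssubst) (simp only: mem_Collect_eq fW Uf mult_zero_right simp_thms)
    qed
    show "continuous_map (prod_topology II ?W) ?W (\<lambda>p. \<lambda>x\<in>topspace A. h (x,p))"
      by (rule continuous_map_curry'[OF ch])
    show "(\<lambda>x\<in>topspace A. h (x,(0,g))) = g" if "g \<in> topspace ?W" for g
    proof -
      have "(\<lambda>x\<in>topspace A. h (x,(0,g))) = restrict g (topspace A)"
        using that by (intro restrict_ext) (simp add: h_def s_def \<Phi>0)
      then show ?thesis using mapping_space_ext[OF that] by simp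
    qed
    show "(\<lambda>x\<in>topspace A. h (x,(t,g))) = g" if "g \<in> {?f}" "0 \<le> t" "t \<le> 1" for g t
    proof -
      have "(\<lambda>x\<in>topspace A. h (x,(t,g))) = restrict f (topspace A)"
        using that s01[of "(t,g)"] by (intro restrict_ext) (simp add: h_def \<Phi>f)
      then show ?thesis using that by simp
    qed
    show "(\<lambda>x\<in>topspace A. h (x,(1,g))) \<in> {?f}" if g: "g \<in> topspace ?W" and "2 * U g < 1" for g
    proof -
      have s1: "s (1,g) = 1" using that by (simp add: s_def)
      have "(\<lambda>x\<in>topspace A. h (x,(1,g))) = ?f"
        using g by (intro restrict_ext) (simp add: h_def s1 \<Phi>0)
      then show ?thesis by simp
    qed
  qed
qed

end

section \<open>Vertical and based homotopy equivalences of mapping spaces\<close>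

text \<open>Being a map over \<open>Y\<close> for the evaluation at \<open>x0\<close>. Only points
  of the mapping space are inspected, so the predicate is invariant under changes outside it, as the
  rule \<open>homotopic_with\<close> requires.\<close>

definition vert :: "'a topology \<Rightarrow> 'b topology \<Rightarrow> 'a \<Rightarrow> (('a \<Rightarrow> 'b) \<Rightarrow> 'a \<Rightarrow> 'b) \<Rightarrow> bool" where
  "vert X Y x0 q \<longleftrightarrow> (\<forall>g\<in>topspace (mapping_space X Y). q g x0 = g x0)"

lemma homotopic_with_vertI:
  assumes "continuous_map (prod_topology II (mapping_space X Y)) (mapping_space X Y) h"
    and "\<And>g. g \<in> topspace (mapping_space X Y) \<Longrightarrow> h (0,g) = p g"
    and "\<And>g. g \<in> topspace (mapping_space X Y) \<Longrightarrow> h (1,g) = q g"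
    and "\<And>t g. 0 \<le> t \<Longrightarrow> t \<le> 1 \<Longrightarrow> g \<in> topspace (mapping_space X Y) \<Longrightarrow> h (t,g) x0 = g x0"
  shows "homotopic_with (vert X Y x0) (mapping_space X Y) (mapping_space X Y) p q"
proof (subst homotopic_with)
  show "vert X Y x0 h \<longleftrightarrow> vert X Y x0 k" if "\<And>g. g \<in> topspace (mapping_space X Y) \<Longrightarrow> h g = k g" for h k
    using that by (simp add: vert_def)
qed (use assms in \<open>auto simp: vert_def intro!: exI[of _ h]\<close>)

context cw
begin

definition pointwise :: "('a \<times> 'b \<Rightarrow> 'c) \<Rightarrow> ('a \<Rightarrow> 'b) \<Rightarrow> 'a \<Rightarrow> 'c" where
  "pointwise S g = (\<lambda>x\<in>topspace X. S (x, g x))"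

lemma continuous_map_pointwise1:
  assumes S: "\<And>e. e \<in> E \<Longrightarrow> continuous_map (prod_topology (subtopology X (cell e)) Y) V S"
  shows "continuous_map (mapping_space X Y) (mapping_space X V) (pointwise S)"
proof -
  have c1: "continuous_map (prod_topology II (mapping_space X Y)) (mapping_space X V)
    (\<lambda>p. \<lambda>x\<in>topspace X. (\<lambda>q. S (fst q, snd (snd q))) (x, (fst p, snd p x)))"
  proof (rule continuous_map_pointwise)
    fix e assume e: "e \<in> E"
    have "continuous_map (prod_topology (subtopology X (cell e)) (prod_topology II Y))
        (prod_topology (subtopology X (cell e)) Y) (\<lambda>q. (fst q, snd (snd q)))"
      by (rule continuous_map_pairedI[OF continuous_map_fst cm_proj(4)])
    from continuous_map_comp[OF S[OF e] this]
    show "continuous_map (prod_topology (subtopology X (cell e)) (prod_topology II Y)) V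
        (\<lambda>q. S (fst q, snd (snd q)))" .
  qed
  have c2: "continuous_map (mapping_space X Y) (prod_topology II (mapping_space X Y)) (\<lambda>g. (0,g))"
    by (intro continuous_map_pairedI) (auto intro: continuous_map_id[unfolded id_def])
  show ?thesis using continuous_map_comp[OF c1 c2] by (simp add: pointwise_def[abs_def])
qed

lemma pointwise_right_inverse:
  assumes S: "\<And>e. e \<in> E \<Longrightarrow> continuous_map (prod_topology (subtopology X (cell e)) Y) Y S"
    and S0: "\<And>y. y \<in> topspace Y \<Longrightarrow> S (x0,y) = y"
    and x0: "x0 \<in> topspace X" and pc: "path_connected_space X"
  shows "\<exists>T. (\<forall>e\<in>E. continuous_map (prod_topology (subtopology X (cell e)) Y) Y T) \<and>
    (\<forall>y\<in>topspace Y. T (x0,y) = y) \<and>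
    homotopic_with (vert X Y x0) (mapping_space X Y) (mapping_space X Y) (pointwise S \<circ> pointwise T) id"
proof (rule right_inverse[OF S S0 x0 pc])
  fix T H assume T: "\<And>e. e \<in> E \<Longrightarrow> continuous_map (prod_topology (subtopology X (cell e)) Y) Y T"
    and H: "\<And>e. e \<in> E \<Longrightarrow> continuous_map (prod_topology (subtopology X (cell e)) (prod_topology II Y)) Y H"
    and T0: "\<And>y. y \<in> topspace Y \<Longrightarrow> T (x0,y) = y"
    and H0: "\<And>x y. x \<in> topspace X \<Longrightarrow> y \<in> topspace Y \<Longrightarrow> H (x,(0,y)) = y"
    and H1: "\<And>x y. x \<in> topspace X \<Longrightarrow> y \<in> topspace Y \<Longrightarrow> H (x,(1,y)) = S (x, T (x,y))"
    and Hx: "\<And>t y. 0 \<le> t \<Longrightarrow> t \<le> 1 \<Longrightarrow> y \<in> topspace Y \<Longrightarrow> H (x0,(t,y)) = y"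
  let ?M = "mapping_space X Y"
  have gY: "g x \<in> topspace Y" if "g \<in> topspace ?M" "x \<in> topspace X" for g x
    using continuous_map_in[OF mapping_space_continuous[OF that(1)] that(2)] .
  have "homotopic_with (vert X Y x0) ?M ?M id (pointwise S \<circ> pointwise T)"
  proof (rule homotopic_with_vertI)
    show "continuous_map (prod_topology II ?M) ?M (\<lambda>p. \<lambda>x\<in>topspace X. H (x, (fst p, snd p x)))"
      by (rule continuous_map_pointwise[OF H])
    fix g assume g: "g \<in> topspace ?M"
    have "(\<lambda>x\<in>topspace X. H (x, (0, g x))) = restrict g (topspace X)"
      using g by (intro restrict_ext) (simp add: H0 gY)
    then show "(\<lambda>x\<in>topspace X. H (x, (fst (0::real,g), snd (0::real,g) x))) = id g"
      using mapping_space_ext[OF g] by simp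
    show "(\<lambda>x\<in>topspace X. H (x, (fst (1::real,g), snd (1::real,g) x))) = (pointwise S \<circ> pointwise T) g"
      unfolding pointwise_def o_def using g by (intro restrict_ext) (simp add: H1 gY)
    show "(\<lambda>x\<in>topspace X. H (x, (fst (t,g), snd (t,g) x))) x0 = g x0" if "0 \<le> t" "t \<le> 1" for t
      using Hx[OF that gY[OF g x0]] x0 by simp
  qed
  then show ?thesis using T T0 homotopic_with_sym by blast
qed

lemma vert_comp: "vert X Y x0 p \<Longrightarrow> vert X Y x0 q \<Longrightarrow> continuous_map (mapping_space X Y) (mapping_space X Y) q
    \<Longrightarrow> vert X Y x0 (p \<circ> q)"
  unfolding vert_def o_def by (simp add: continuous_map_in)

lemma vert_pointwise:
  assumes "\<And>y. y \<in> topspace Y \<Longrightarrow> S (x0,y) = y" "x0 \<in> topspace X"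
  shows "vert X Y x0 (pointwise S)"
  unfolding vert_def pointwise_def
  using assms continuous_map_in[OF mapping_space_continuous _, of _ X Y x0] by simp

text \<open>With \<open>T\<close> a right inverse of \<open>S\<close> and \<open>R\<close> a right
  inverse of \<open>T\<close>, one has \<open>R \<simeq> S \<circ> T \<circ> R \<simeq> S\<close>,
  whence \<open>T \<circ> S \<simeq> T \<circ> R \<simeq> id\<close>.\<close>

lemma vertical_equivalence:
  assumes S: "\<And>e. e \<in> E \<Longrightarrow> continuous_map (prod_topology (subtopology X (cell e)) Y) Y S"
    and S0: "\<And>y. y \<in> topspace Y \<Longrightarrow> S (x0,y) = y"
    and x0: "x0 \<in> topspace X" and pc: "path_connected_space X"
  shows "\<exists>h. continuous_map (mapping_space X Y) (mapping_space X Y) h \<and> vert X Y x0 h \<and>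
    homotopic_with (vert X Y x0) (mapping_space X Y) (mapping_space X Y) (pointwise S \<circ> h) id \<and>
    homotopic_with (vert X Y x0) (mapping_space X Y) (mapping_space X Y) (h \<circ> pointwise S) id"
proof -
  let ?M = "mapping_space X Y"
  let ?hw = "homotopic_with (vert X Y x0) ?M ?M"
  obtain T where T: "\<forall>e\<in>E. continuous_map (prod_topology (subtopology X (cell e)) Y) Y T"
    "\<forall>y\<in>topspace Y. T (x0,y) = y" and ST: "?hw (pointwise S \<circ> pointwise T) id"
  proof -
    have "\<exists>T. (\<forall>e\<in>E. continuous_map (prod_topology (subtopology X (cell e)) Y) Y T) \<and>
      (\<forall>y\<in>topspace Y. T (x0,y) = y) \<and> ?hw (pointwise S \<circ> pointwise T) id"
      by (rule pointwise_right_inverse[OF _ _ x0 pc]; (rule S S0); assumption)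
    then show thesis using that by (elim exE conjE)
  qed
  have T': "\<And>e. e \<in> E \<Longrightarrow> continuous_map (prod_topology (subtopology X (cell e)) Y) Y T"
    "\<And>y. y \<in> topspace Y \<Longrightarrow> T (x0,y) = y" using T by auto
  obtain T2 where T2: "\<forall>e\<in>E. continuous_map (prod_topology (subtopology X (cell e)) Y) Y T2"
    "\<forall>y\<in>topspace Y. T2 (x0,y) = y" and TT: "?hw (pointwise T \<circ> pointwise T2) id"
  proof -
    have "\<exists>R. (\<forall>e\<in>E. continuous_map (prod_topology (subtopology X (cell e)) Y) Y R) \<and>
      (\<forall>y\<in>topspace Y. R (x0,y) = y) \<and> ?hw (pointwise T \<circ> pointwise R) id"
      by (rule pointwise_right_inverse[OF _ _ x0 pc]; (rule T'); assumption)
    then show thesis using that by (elim exE conjE)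
  qed
  let ?S = "pointwise S" and ?T = "pointwise T" and ?R = "pointwise T2"
  have c: "continuous_map ?M ?M ?S" "continuous_map ?M ?M ?T" "continuous_map ?M ?M ?R"
    using S T(1) T2(1) by (auto intro!: continuous_map_pointwise1)
  have v: "vert X Y x0 ?S" "vert X Y x0 ?T" "vert X Y x0 ?R"
    using S0 T(2) T2(2) x0 by (auto intro!: vert_pointwise)
  \<comment> \<open>Verticality of a composite is deduced from the inner map taking values in the
    mapping space, so continuity is added to the predicate before composing on the left.\<close>
  have 1: "?hw (?S \<circ> (?T \<circ> ?R)) (?S \<circ> id)"
    by (rule homotopic_with_compose_continuous_map_left[OF homotopic_with_mono[OF TT, where Q = "\<lambda>q. vert X Y x0 q \<and> continuous_map ?M ?M q"] c(1)])
       (auto intro: vert_comp v)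
  have 2: "?hw ((?S \<circ> ?T) \<circ> ?R) (id \<circ> ?R)"
    by (rule homotopic_with_compose_continuous_map_right[OF ST c(3)]) (auto intro: vert_comp v c)
  have "?hw ?R ?S"
    using homotopic_with_trans[OF homotopic_with_symD[OF 2]] 1 by (simp add: o_assoc)
  then have "?hw (?T \<circ> ?R) (?T \<circ> ?S)"
    by (intro homotopic_with_compose_continuous_map_left[OF homotopic_with_mono[where Q = "\<lambda>q. vert X Y x0 q \<and> continuous_map ?M ?M q"] c(2)])
       (auto intro: vert_comp v)
  then have "?hw (?T \<circ> ?S) id"
    using homotopic_with_trans[OF homotopic_with_symD TT] by blast
  then show ?thesis using c(2) v(2) ST by blast
qed

end

text \<open>The homotopy on the two axes moves \<open>e\<close> along \<open>j\<close> and rests on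
  \<open>{x0}\<close> times the mapping space; \<open>eq\<close> makes the two prescriptions agree
  at \<open>(x0, e)\<close>. The axis at rest is what makes an extension of this homotopy
  vertical.\<close>

lemma continuous_on_axes:
  assumes X: "compact_space X" "Hausdorff_space X" and x0: "closedin X {x0}" and e: "closedin (mapping_space X Y) {e}"
    and j: "continuous_map II (mapping_space X Y) j"
    and eq: "\<And>s. 0 \<le> s \<Longrightarrow> s \<le> 1 \<Longrightarrow> j s x0 = e x0"
  shows "continuous_map (prod_topology (subtopology (prod_topology X (mapping_space X Y))
       (topspace X \<times> {e} \<union> {x0} \<times> topspace (mapping_space X Y))) II) Y
     (\<lambda>p. if snd (fst p) = e then j (snd p) (fst (fst p)) else snd (fst p) x0)"
proof -
  let ?M = "mapping_space X Y"
  let ?P = "prod_topology (prod_topology X ?M) II"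
  let ?F = "\<lambda>p. if snd (fst p) = e then j (snd p) (fst (fst p)) else snd (fst p) x0"
  have x0X: "x0 \<in> topspace X" using closedin_subset[OF x0] by simp
  have 1: "continuous_map ?P Y (\<lambda>p. j (snd p) (fst (fst p)))"
  proof -
    have "continuous_map ?P Y (\<lambda>p. snd (fst (fst p), j (snd p)) (fst (fst (fst p), j (snd p))))"
      by (rule continuous_map_comp[OF continuous_map_eval[OF X(2,1)]
          continuous_map_pairedI[OF cm_proj(1) continuous_map_comp[OF j continuous_map_snd]]])
    then show ?thesis by simp
  qed
  have 2: "continuous_map ?P Y (\<lambda>p. snd (fst p) x0)"
    by (rule continuous_map_comp[OF continuous_map_evaluation[OF x0X] cm_proj(2)])
  have "continuous_map (subtopology ?P ((topspace X \<times> {e}) \<times> topspace II \<union> ({x0} \<times> topspace ?M) \<times> topspace II)) Y ?F"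
  proof (rule continuous_map_union_closed)
    show "closedin ?P ((topspace X \<times> {e}) \<times> topspace II)" "closedin ?P (({x0} \<times> topspace ?M) \<times> topspace II)"
      using e x0 closedin_topspace[of II] closedin_topspace[of X] closedin_topspace[of ?M]
      by (simp_all only: closedin_prod_Times_iff) simp_all
    show "continuous_map (subtopology ?P ((topspace X \<times> {e}) \<times> topspace II)) Y ?F"
      by (rule continuous_map_eq[OF continuous_map_from_subtopology[OF 1]]) auto
    show "continuous_map (subtopology ?P (({x0} \<times> topspace ?M) \<times> topspace II)) Y ?F"
      by (rule continuous_map_eq[OF continuous_map_from_subtopology[OF 2]]) (auto simp: eq)
  qed
  then show ?thesis by (simp add: prod_topology_subtopology_left Sigma_Un_distrib1)
qed

text \<open>The correction of \<open>h\<close> follows the path of the base point under the homotopy \<open>h \<circ> k \<simeq> id\<close>. Then the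
  new homotopy runs the base point along a path and back, and this loop is straightened.\<close>

lemma pointed_inverse:
  assumes X: "compact_space X" "Hausdorff_space X" and x0: "ndr_pair X {x0}"
    and e: "ndr_pair (mapping_space X Y) {e1}" "ndr_pair (mapping_space X Y) {e2}"
    and k: "continuous_map (mapping_space X Y) (mapping_space X Y) k" "vert X Y x0 k" "k e1 = e2"
    and h: "continuous_map (mapping_space X Y) (mapping_space X Y) h"
    and hk: "homotopic_with (vert X Y x0) (mapping_space X Y) (mapping_space X Y) (h \<circ> k) id"
    and hv: "vert X Y x0 h"
  shows "\<exists>h'. continuous_map (mapping_space X Y) (mapping_space X Y) h' \<and> vert X Y x0 h' \<and> h' e2 = e1 \<and>
    homotopic_with (vert X Y x0) (mapping_space X Y) (mapping_space X Y) h h' \<and>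
    homotopic_with (\<lambda>q. vert X Y x0 q \<and> q e1 = e1) (mapping_space X Y) (mapping_space X Y) (h' \<circ> k) id"
proof -
  let ?M = "mapping_space X Y"
  let ?Z = "prod_topology X ?M"
  have eM: "e1 \<in> topspace ?M" "e2 \<in> topspace ?M" and x0X: "x0 \<in> topspace X"
    using ndr_pair_subset[OF e(1)] ndr_pair_subset[OF e(2)] ndr_pair_subset[OF x0] by auto
  obtain J where J: "continuous_map (prod_topology II ?M) ?M J" "\<forall>g. J (0,g) = (h \<circ> k) g" "\<forall>g. J (1,g) = id g"
    "\<forall>t\<in>{0..1}. vert X Y x0 (\<lambda>g. J (t,g))"
    using hk unfolding homotopic_with_def by (elim exE conjE)
  have Jx: "J (t,g) x0 = g x0" if "0 \<le> t" "t \<le> 1" "g \<in> topspace ?M" for t g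
    using bspec[OF J(4), of t] that by (simp add: vert_def)
  have cj: "continuous_map II ?M (\<lambda>t. J (t,e1))"
    using eM by (intro continuous_map_comp[OF J(1)] continuous_map_pairedI) (auto intro: continuous_map_id[unfolded id_def])
  have ke: "e2 x0 = e1 x0" using k(2,3) eM by (auto simp: vert_def)
  have kM: "k g \<in> topspace ?M" if "g \<in> topspace ?M" for g using continuous_map_in[OF k(1) that] .
  have kx: "k g x0 = g x0" if "g \<in> topspace ?M" for g using k(2) that by (simp add: vert_def)
  \<comment> \<open>Homotopies of self-maps of the mapping space are extended in adjoint form, as
    maps on \<open>X \<times> ?M \<times> I\<close>. The axis over \<open>x0\<close> keeps them
    vertical, and the other axis prescribes the track of one point: \<open>?A2\<close> serves to
    correct \<open>h\<close>, \<open>?A1\<close> to straighten the homotopy to the identity.\<close>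
  let ?A2 = "topspace X \<times> {e2} \<union> {x0} \<times> topspace ?M"
  let ?A1 = "topspace X \<times> {e1} \<union> {x0} \<times> topspace ?M"
  have ndr2: "ndr_pair ?Z ?A2" and ndr1: "ndr_pair ?Z ?A1"
    using ndr_pair_prod[OF x0 e(2)] ndr_pair_prod[OF x0 e(1)] by simp_all
  let ?G = "\<lambda>e p. if snd (fst p) = e then J (snd p, e1) (fst (fst p)) else snd (fst p) x0"
  have cG: "continuous_map (prod_topology (subtopology ?Z (topspace X \<times> {e} \<union> {x0} \<times> topspace ?M)) II) Y (?G e)"
    if "closedin ?M {e}" "e x0 = e1 x0" for e
    by (rule continuous_on_axes[OF X ndr_pair_closedin[OF x0] that(1) cj]) (use Jx eM that in simp)
  have evh: "continuous_map ?Z Y (\<lambda>z. h (snd z) (fst z))"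
  proof -
    have "continuous_map ?Z Y (\<lambda>z. snd (fst z, h (snd z)) (fst (fst z, h (snd z))))"
      by (rule continuous_map_comp[OF continuous_map_eval[OF X(2,1)]
          continuous_map_pairedI[OF continuous_map_fst continuous_map_comp[OF h continuous_map_snd]]])
    then show ?thesis by simp
  qed
  have GF: "?G e2 (a,0) = h (snd a) (fst a)" if "a \<in> ?A2" for a
  proof (cases "snd a = e2")
    case True
    then show ?thesis using J(2) k(3) by simp
  next
    case False
    then have "fst a = x0" "snd a \<in> topspace ?M" using that by auto
    then show ?thesis using False hv by (simp add: vert_def)
  qed
  show ?thesis
  proof (rule ndr_pair_HEP[OF ndr2 evh cG[OF ndr_pair_closedin[OF e(2)] ke] GF])
    fix H assume H: "continuous_map (prod_topology ?Z II) Y H"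
      and H0: "\<And>z. z \<in> topspace ?Z \<Longrightarrow> H (z,0) = h (snd z) (fst z)"
      and HA: "\<And>a t. a \<in> ?A2 \<Longrightarrow> 0 \<le> t \<Longrightarrow> t \<le> 1 \<Longrightarrow> H (a,t) = ?G e2 (a,t)"
    define M where "M = (\<lambda>p. \<lambda>x\<in>topspace X. H ((x, snd p), fst p))"
    have cM: "continuous_map (prod_topology II ?M) ?M M"
    proof -
      have "continuous_map (prod_topology X (prod_topology II ?M)) Y (\<lambda>q. H ((fst q, snd (snd q)), fst (snd q)))"
        by (intro continuous_map_comp[OF H] continuous_map_pairedI continuous_map_fst cm_proj)
      from continuous_map_curry'[OF this] show ?thesis by (simp add: M_def)
    qed
    have M0: "M (0,g) = h g" if g: "g \<in> topspace ?M" for g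
    proof -
      have "M (0,g) = restrict (h g) (topspace X)"
        unfolding M_def using g by (intro restrict_ext) (simp add: H0)
      then show ?thesis using mapping_space_ext[OF continuous_map_in[OF h g]] by simp
    qed
    have Hx: "H ((x0,g),t) = g x0" if "0 \<le> t" "t \<le> 1" "g \<in> topspace ?M" for g t
      using HA[of "(x0,g)" t] that Jx[OF that(1,2) eM(1)] ke by simp
    have He: "H ((x,e2),t) = J (t,e1) x" if "0 \<le> t" "t \<le> 1" "x \<in> topspace X" for x t
      using HA[of "(x,e2)" t] that by simp
    have Mx: "M (t,g) x0 = g x0" if "0 \<le> t" "t \<le> 1" "g \<in> topspace ?M" for g t
      using Hx[OF that] x0X by (simp add: M_def)
    have Me: "M (1,e2) = e1"
    proof -
      have "M (1,e2) = restrict e1 (topspace X)"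
        unfolding M_def using J(3) by (intro restrict_ext) (simp add: He)
      then show ?thesis using mapping_space_ext[OF eM(1)] by simp
    qed
    define h' where "h' = (\<lambda>g. M (1,g))"
    have ch': "continuous_map ?M ?M h'"
      unfolding h'_def by (intro continuous_map_comp[OF cM] continuous_map_pairedI)
        (auto intro: continuous_map_id[unfolded id_def])
    have hh': "homotopic_with (vert X Y x0) ?M ?M h h'"
      by (rule homotopic_with_vertI[OF cM]) (use M0 Mx in \<open>auto simp: h'_def\<close>)
    define N where "N = (\<lambda>q. if snd q \<le> 1/2 then H ((fst (fst q), k (snd (fst q))), 1 - 2 * snd q)
        else J (2 * snd q - 1, snd (fst q)) (fst (fst q)))"
    let ?P = "prod_topology ?Z II"
    have csnd: "continuous_map ?P euclideanreal snd" by (rule continuous_map_II_D[OF continuous_map_snd])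
    have cN: "continuous_map ?P Y N"
      unfolding N_def
    proof (rule continuous_map_cases_le[OF csnd])
      let ?P1 = "subtopology ?P {q \<in> topspace ?P. snd q \<le> 1/2}"
      show "continuous_map ?P1 Y (\<lambda>q. H ((fst (fst q), k (snd (fst q))), 1 - 2 * snd q))"
        by (intro continuous_map_comp[OF H] continuous_map_pairedI continuous_map_II_I continuous_map_diff
            continuous_map_real_mult_left continuous_map_from_subtopology[OF csnd] continuous_map_canonical_const
            continuous_map_from_subtopology[OF cm_proj(1)]
            continuous_map_comp[OF k(1)] continuous_map_from_subtopology[OF cm_proj(2)]) auto
      let ?P2 = "subtopology ?P {q \<in> topspace ?P. 1/2 \<le> snd q}"
      have "continuous_map ?P2 ?M (\<lambda>q. J (2 * snd q - 1, snd (fst q)))"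
        by (intro continuous_map_comp[OF J(1)] continuous_map_pairedI continuous_map_II_I continuous_map_diff
            continuous_map_real_mult_left continuous_map_from_subtopology[OF csnd] continuous_map_canonical_const
            continuous_map_from_subtopology[OF cm_proj(2)]) auto
      then have "continuous_map ?P2 (prod_topology X ?M) (\<lambda>q. (fst (fst q), J (2 * snd q - 1, snd (fst q))))"
        by (intro continuous_map_pairedI continuous_map_from_subtopology[OF cm_proj(1)])
      from continuous_map_comp[OF continuous_map_eval[OF X(2,1)] this]
      show "continuous_map ?P2 Y (\<lambda>q. J (2 * snd q - 1, snd (fst q)) (fst (fst q)))" by simp
      show "H ((fst (fst q), k (snd (fst q))), 1 - 2 * snd q) = J (2 * snd q - 1, snd (fst q)) (fst (fst q))"
        if "q \<in> topspace ?P" "snd q = 1/2" for q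
      proof -
        have "fst (fst q) \<in> topspace X" "snd (fst q) \<in> topspace ?M" using that(1) by auto
        then have "H ((fst (fst q), k (snd (fst q))), 0) = J (0, snd (fst q)) (fst (fst q))"
          using H0[of "(fst (fst q), k (snd (fst q)))"] J(2) kM by simp
        then show ?thesis unfolding that(2) by simp
      qed
    qed auto
    show ?thesis
    proof (rule ndr_straighten[OF ndr1 cN cG[OF ndr_pair_closedin[OF e(1)] refl]])
      show "N (a,t) = ?G e1 (a, \<bar>2 * t - 1\<bar>)" if a: "a \<in> ?A1" and t: "0 \<le> t" "t \<le> 1" for a t
      proof (cases "snd a = e1")
        case True
        then have x: "fst a \<in> topspace X" using a x0X by auto
        show ?thesis
        proof (cases "t \<le> 1/2")
          case True
          then have "\<bar>2 * t - 1\<bar> = 1 - 2 * t" by simp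
          then show ?thesis using He[OF _ _ x, of "1 - 2 * t"] t True \<open>snd a = e1\<close> k(3) by (simp add: N_def)
        next
          case False
          then show ?thesis using \<open>snd a = e1\<close> by (simp add: N_def)
        qed
      next
        case False
        then have g: "fst a = x0" "snd a \<in> topspace ?M" using a by auto
        show ?thesis
          using Hx[OF _ _ kM[OF g(2)], of "1 - 2 * t"] kx[OF g(2)] Jx[OF _ _ g(2), of "2 * t - 1"] False g t
          by (auto simp: N_def)
      qed
      fix M' assume M': "continuous_map ?P Y M'" and M'0: "\<And>z. z \<in> topspace ?Z \<Longrightarrow> M' (z,0) = N (z,0)"
        and M'1: "\<And>z. z \<in> topspace ?Z \<Longrightarrow> M' (z,1) = N (z,1)"
        and M'A: "\<And>a t. a \<in> ?A1 \<Longrightarrow> 0 \<le> t \<Longrightarrow> t \<le> 1 \<Longrightarrow> M' (a,t) = ?G e1 (a,1)"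
      define K where "K = (\<lambda>p. \<lambda>x\<in>topspace X. M' ((x, snd p), fst p))"
      have cK: "continuous_map (prod_topology II ?M) ?M K"
      proof -
        have "continuous_map (prod_topology X (prod_topology II ?M)) Y (\<lambda>q. M' ((fst q, snd (snd q)), fst (snd q)))"
          by (intro continuous_map_comp[OF M'] continuous_map_pairedI continuous_map_fst cm_proj)
        from continuous_map_curry'[OF this] show ?thesis by (simp add: K_def)
      qed
      have K0: "K (0,g) = (h' \<circ> k) g" if g: "g \<in> topspace ?M" for g
        unfolding K_def h'_def M_def o_def
        using g by (intro restrict_ext) (simp add: M'0 N_def)
      have K1: "K (1,g) = id g" if g: "g \<in> topspace ?M" for g
      proof -
        have "K (1,g) = restrict g (topspace X)"
          unfolding K_def using g J(3) by (intro restrict_ext) (simp add: M'1 N_def)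
        then show ?thesis using mapping_space_ext[OF g] by simp
      qed
      have Kx: "K (t,g) x0 = g x0" if "0 \<le> t" "t \<le> 1" "g \<in> topspace ?M" for t g
        using M'A[of "(x0,g)" t] that x0X J(3) by (auto simp: K_def)
      have Ke: "K (t,e1) = e1" if "0 \<le> t" "t \<le> 1" for t
      proof -
        have "K (t,e1) = restrict e1 (topspace X)"
          unfolding K_def using that J(3) by (intro restrict_ext) (simp add: M'A)
        then show ?thesis using mapping_space_ext[OF eM(1)] by simp
      qed
      have "homotopic_with (\<lambda>q. vert X Y x0 q \<and> q e1 = e1) ?M ?M (h' \<circ> k) id"
      proof (subst homotopic_with)
        show "(vert X Y x0 p \<and> p e1 = e1) \<longleftrightarrow> (vert X Y x0 q \<and> q e1 = e1)"
          if "\<And>g. g \<in> topspace ?M \<Longrightarrow> p g = q g" for p q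
          using that eM by (simp add: vert_def)
      qed (use cK K0 K1 Kx Ke in \<open>auto simp: vert_def intro!: exI[of _ K]\<close>)
      moreover have "vert X Y x0 h'" using Mx[of 1] by (simp add: vert_def h'_def)
      ultimately show ?thesis using ch' hh' Me by (intro exI[of _ h']) (simp add: h'_def)
    qed
  qed
qed

section \<open>Path components\<close>

lemma path_component_of_image:
  assumes "continuous_map M N k" "path_component_of M a b"
  shows "path_component_of N (k a) (k b)"
proof -
  obtain g where "pathin M g" "g 0 = a" "g 1 = b" using assms(2) unfolding path_component_of_def by blast
  then show ?thesis
    unfolding path_component_of_def pathin_def using continuous_map_comp[OF assms(1)]
    by (intro exI[of _ "\<lambda>t. k (g t)"]) auto
qed

lemma path_component_of_homotopy:
  assumes H: "continuous_map (prod_topology II M) N H" and g: "g \<in> topspace M" and t: "0 \<le> t" "t \<le> 1"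
  shows "path_component_of N (H (t,g)) (H (1,g))"
proof -
  have "continuous_map II (prod_topology II M) (\<lambda>s. (t + s * (1 - t), g))"
  proof (intro continuous_map_pairedI continuous_map_II_I)
    show "continuous_map II euclideanreal (\<lambda>s. t + s * (1 - t))"
      by (intro continuous_map_add continuous_map_real_mult_right continuous_map_II_D[OF continuous_map_id[unfolded id_def]]) simp
    show "0 \<le> t + s * (1 - t)" if "s \<in> topspace II" for s using that t by simp
    show "t + s * (1 - t) \<le> 1" if "s \<in> topspace II" for s
      using that t mult_right_mono[of s 1 "1 - t"] by simp
  qed (use g in simp)
  from continuous_map_comp[OF H this] have "pathin N (\<lambda>s. H (t + s * (1 - t), g))"
    by (simp add: pathin_def)
  then show ?thesis unfolding path_component_of_def by (intro exI[of _ "\<lambda>s. H (t + s * (1 - t), g)"]) simp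
qed

lemma continuous_map_path_component:
  assumes k: "continuous_map M N k" and b: "path_component_of N b (k a)"
  shows "continuous_map (subtopology M (path_component_of_set M a)) (subtopology N (path_component_of_set N b)) k"
proof (rule continuous_map_into_sub[OF continuous_map_from_subtopology[OF k]])
  fix g assume "g \<in> topspace (subtopology M (path_component_of_set M a))"
  then have "path_component_of N (k a) (k g)" by (intro path_component_of_image[OF k]) simp
  then show "k g \<in> path_component_of_set N b" using path_component_of_trans[OF b] by simp
qed

text \<open>Every track ends at \<open>id g = g\<close>, so it stays in the path component of
  \<open>g\<close> and the homotopy restricts. The assumption on \<open>Q\<close> trades a predicate
  on the whole space for one on the component, such as being a based map over the base.\<close>

lemma homotopic_with_path_component:
  assumes h: "homotopic_with P M M q id"
    and Q: "\<And>j. P j \<Longrightarrow> continuous_map (subtopology M (path_component_of_set M a)) (subtopology M (path_component_of_set M a)) j \<Longrightarrow> Q j"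
  shows "homotopic_with Q (subtopology M (path_component_of_set M a)) (subtopology M (path_component_of_set M a)) q id"
proof -
  let ?C = "path_component_of_set M a"
  let ?N = "subtopology M ?C"
  obtain H where H: "continuous_map (prod_topology II M) M H" "\<forall>g. H (0,g) = q g" "\<forall>g. H (1,g) = id g"
    "\<forall>t\<in>{0..1}. P (\<lambda>g. H (t,g))"
    using h unfolding homotopic_with_def by (elim exE conjE)
  have "continuous_map (prod_topology II ?N) ?N H"
  proof (rule continuous_map_into_sub)
    have "continuous_map (prod_topology II ?N) (prod_topology II M) (\<lambda>p. (fst p, snd p))"
      by (intro continuous_map_pairedI continuous_map_fst continuous_map_into_fulltopology[OF continuous_map_snd])
    from continuous_map_comp[OF H(1) this] show "continuous_map (prod_topology II ?N) M H" by simp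
    fix p assume "p \<in> topspace (prod_topology II ?N)"
    then obtain t g where p: "p = (t,g)" "0 \<le> t" "t \<le> 1" "g \<in> topspace M" "path_component_of M a g" by auto
    have "path_component_of M (H (t,g)) g"
      using path_component_of_homotopy[OF H(1) p(4,2,3)] H(3) by simp
    then have "path_component_of M a (H (t,g))"
      using path_component_of_trans[OF p(5)] path_component_of_sym[of M "H (t,g)" g] by blast
    then show "H p \<in> ?C" by (simp add: p(1))
  qed
  moreover have "Q (\<lambda>g. H (t,g))" if "t \<in> {0..1}" for t
  proof (rule Q)
    show "P (\<lambda>g. H (t,g))" using H(4) that by blast
    show "continuous_map ?N ?N (\<lambda>g. H (t,g))"
      using that by (intro continuous_map_comp[OF \<open>continuous_map (prod_topology II ?N) ?N H\<close>] continuous_map_pairedI)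
        (auto intro: continuous_map_id[unfolded id_def])
  qed
  ultimately show ?thesis
    unfolding homotopic_with_def using H(2,3) by (intro exI[of _ H]) simp
qed

lemma mapping_point_in:
  "continuous_map X Y f \<Longrightarrow> mapping_point X f \<in> topspace (mapping_space X Y)"
  by (simp add: mapping_point_def topspace_mapping_space continuous_map_eq)

lemma topspace_mapping_component:
  "topspace (mapping_component X Y f) = path_component_of_set (mapping_space X Y) (mapping_point X f)"
  unfolding mapping_component_def topspace_subtopology
  using path_component_of_subset_topspace[of "mapping_space X Y"] by blast

lemma mapping_component_subset:
  "g \<in> topspace (mapping_component X Y f) \<Longrightarrow> g \<in> topspace (mapping_space X Y)"
  unfolding mapping_component_def by simp

section \<open>Sections and cyclic maps\<close>

lemma nondegenerate_basepoint_ndr: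
  assumes "nondegenerate_basepoint X x0"
  shows "ndr_pair X {x0}"
proof -
  obtain u h where u: "continuous_map X II u" "{x \<in> topspace X. u x = 0} = {x0}"
    and h: "continuous_map (prod_topology II X) X h" "\<forall>x\<in>topspace X. h (0, x) = x"
      "\<forall>t\<in>{0..1}. h (t, x0) = x0" "\<forall>x\<in>topspace X. u x < 1 \<longrightarrow> h (1, x) = x0"
    using assms unfolding nondegenerate_basepoint_def by (elim exE conjE)
  show ?thesis
  proof (rule ndr_pairI[OF continuous_map_II_D[OF u(1)] _ u(2)[symmetric] h(1)])
    show "0 \<le> u z" if "z \<in> topspace X" for z using continuous_map_in[OF u(1) that] by simp
  qed (use h in auto)
qed

text \<open>The section is the adjoint of \<open>\<Gamma>\<close>. It takes \<open>y0\<close> to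
  \<open>f\<close>, and since \<open>Y\<close> is path connected its image stays in the component of
  \<open>f\<close>.\<close>

lemma cyclic_imp_section:
  assumes X: "x0 \<in> topspace X" and Y: "path_connected_space Y" "y0 \<in> topspace Y"
    and cyc: "cyclic_map X x0 Y y0 f"
  shows "has_section (mapping_component X Y f) Y (evaluation x0)"
proof -
  obtain \<Gamma> where \<Gamma>: "continuous_map (prod_topology X Y) Y \<Gamma>"
    "\<forall>(x, y) \<in> wedge_set X x0 Y y0. \<Gamma> (x, y) = (if y = y0 then f x else y)" and f0: "f x0 = y0"
    using cyc unfolding cyclic_map_def based_map_def by blast
  let ?M = "mapping_space X Y"
  define s where "s = (\<lambda>y. \<lambda>x\<in>topspace X. \<Gamma> (x,y))"
  have cs: "continuous_map Y ?M s" unfolding s_def by (rule continuous_map_curry'[OF \<Gamma>(1)])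
  have "\<Gamma> (x,y0) = f x" if "x \<in> topspace X" for x
    using bspec[OF \<Gamma>(2), of "(x,y0)"] that by (simp add: wedge_set_def)
  then have "s y0 = mapping_point X f"
    unfolding s_def mapping_point_def by (intro restrict_ext) simp
  then have "path_component_of ?M (mapping_point X f) (s y)" if "y \<in> topspace Y" for y
    using path_component_of_image[OF cs path_connected_space_imp_path_component_of[OF Y(1,2) that]] by simp
  then have "continuous_map Y (mapping_component X Y f) s"
    unfolding mapping_component_def by (intro continuous_map_into_sub[OF cs]) simp
  moreover have "evaluation x0 (s y) = y" if "y \<in> topspace Y" for y
    using bspec[OF \<Gamma>(2), of "(x0,y)"] that X f0 by (auto simp: evaluation_def s_def wedge_set_def)
  ultimately show ?thesis unfolding has_section_def by blast
qed

text \<open>A section \<open>s\<close> provides a path from \<open>s y0\<close> to \<open>f\<close> which moves the base point along a loop \<open>l\<close>. Preceding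
  it by \<open>s \<circ> l\<close> backwards makes this loop null-homotopic, so that \<open>s y0\<close> and \<open>f\<close> are homotopic rel base point.\<close>

lemma section_imp_cyclic:
  assumes X: "compact_space X" "Hausdorff_space X" "ndr_pair X {x0}" and Y: "ndr_pair Y {y0}"
    and f: "based_map X x0 Y y0 f"
    and sec: "has_section (mapping_component X Y f) Y (evaluation x0)"
  shows "cyclic_map X x0 Y y0 f"
proof -
  let ?M = "mapping_space X Y"
  let ?f = "mapping_point X f"
  have x0: "x0 \<in> topspace X" and y0: "y0 \<in> topspace Y"
    using ndr_pair_subset[OF X(3)] ndr_pair_subset[OF Y] by auto
  obtain s where s: "continuous_map Y (mapping_component X Y f) s"
    "\<forall>y\<in>topspace Y. evaluation x0 (s y) = y"
    using sec unfolding has_section_def by blast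
  have cs: "continuous_map Y ?M s"
    using s(1) unfolding mapping_component_def by (rule continuous_map_into_fulltopology)
  have sx0: "s y x0 = y" if "y \<in> topspace Y" for y using s(2) that by (simp add: evaluation_def)
  have "s y0 \<in> topspace (mapping_component X Y f)" by (rule continuous_map_in[OF s(1) y0])
  then have "path_component_of ?M (s y0) ?f"
    unfolding topspace_mapping_component by (simp add: path_component_of_sym)
  then obtain \<alpha> where \<alpha>: "continuous_map II ?M \<alpha>" "\<alpha> 0 = s y0" "\<alpha> 1 = ?f"
    unfolding path_component_of_def pathin_def by blast
  define l where "l = (\<lambda>t. \<alpha> t x0)"
  have cl: "continuous_map II Y l"
    unfolding l_def by (rule continuous_map_comp[OF continuous_map_evaluation[OF x0] \<alpha>(1)])
  have l1: "l 1 = y0" using f x0 by (simp add: l_def \<alpha>(3) mapping_point_def based_map_def)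
  have ev: "continuous_map (prod_topology X ?M) Y (\<lambda>p. snd p (fst p))"
    by (rule continuous_map_eval[OF X(2,1)])
  let ?P = "prod_topology X II"
  have csnd: "continuous_map ?P euclideanreal snd" by (rule continuous_map_II_D[OF continuous_map_snd])
  define N where "N = (\<lambda>p. if snd p \<le> 1/2 then s (l (1 - 2 * snd p)) (fst p) else \<alpha> (2 * snd p - 1) (fst p))"
  have cN: "continuous_map ?P Y N"
    unfolding N_def
  proof (rule continuous_map_cases_le[OF csnd])
    let ?P1 = "subtopology ?P {p \<in> topspace ?P. snd p \<le> 1/2}"
    have "continuous_map ?P1 II (\<lambda>p. 1 - 2 * snd p)"
      by (intro continuous_map_II_I continuous_map_diff continuous_map_real_mult_left
          continuous_map_from_subtopology[OF csnd] continuous_map_canonical_const) auto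
    from continuous_map_comp[OF cs continuous_map_comp[OF cl this]]
    have "continuous_map ?P1 (prod_topology X ?M) (\<lambda>p. (fst p, s (l (1 - 2 * snd p))))"
      by (intro continuous_map_pairedI continuous_map_from_subtopology[OF continuous_map_fst])
    from continuous_map_comp[OF ev this]
    show "continuous_map ?P1 Y (\<lambda>p. s (l (1 - 2 * snd p)) (fst p))" by simp
    let ?P2 = "subtopology ?P {p \<in> topspace ?P. 1/2 \<le> snd p}"
    have "continuous_map ?P2 II (\<lambda>p. 2 * snd p - 1)"
      by (intro continuous_map_II_I continuous_map_diff continuous_map_real_mult_left
          continuous_map_from_subtopology[OF csnd] continuous_map_canonical_const) auto
    from continuous_map_comp[OF \<alpha>(1) this]
    have "continuous_map ?P2 (prod_topology X ?M) (\<lambda>p. (fst p, \<alpha> (2 * snd p - 1)))"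
      by (intro continuous_map_pairedI continuous_map_from_subtopology[OF continuous_map_fst])
    from continuous_map_comp[OF ev this]
    show "continuous_map ?P2 Y (\<lambda>p. \<alpha> (2 * snd p - 1) (fst p))" by simp
    \<comment> \<open>As \<open>s\<close> is a section, \<open>l 0 = s y0 x0 = y0\<close>; thus
      \<open>l\<close> is a loop and the two halves of \<open>N\<close> meet at
      \<open>s y0\<close>.\<close>
    have "s (l 0) = \<alpha> 0" using \<alpha>(2) sx0[OF y0] by (simp add: l_def)
    then show "s (l (1 - 2 * snd p)) (fst p) = \<alpha> (2 * snd p - 1) (fst p)" if "snd p = 1/2" for p
      unfolding that by simp
  qed auto
  have clA: "continuous_map (prod_topology (subtopology X {x0}) II) Y (\<lambda>p. l (snd p))"
    by (rule continuous_map_comp[OF cl continuous_map_snd])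
  have Nl: "N (a,t) = (\<lambda>p. l (snd p)) (a, \<bar>2 * t - 1\<bar>)" if "a \<in> {x0}" "0 \<le> t" "t \<le> 1" for a t
  proof (cases "t \<le> 1/2")
    case True
    then have "\<bar>2 * t - 1\<bar> = 1 - 2 * t" by simp
    moreover have "l (1 - 2 * t) \<in> topspace Y" using continuous_map_in[OF cl] True that(2) by simp
    ultimately show ?thesis using True that(1) sx0 by (simp add: N_def)
  next
    case False
    then show ?thesis using that(1) by (simp add: N_def l_def)
  qed
  have "\<exists>M. continuous_map ?P Y M \<and> (\<forall>x\<in>topspace X. M (x,0) = s y0 x \<and> M (x,1) = f x) \<and>
      (\<forall>t\<in>{0..1}. M (x0,t) = y0)"
  proof (rule ndr_straighten[OF X(3) cN clA Nl])
    fix M assume M: "continuous_map ?P Y M" "\<And>z. z \<in> topspace X \<Longrightarrow> M (z,0) = N (z,0)"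
      "\<And>z. z \<in> topspace X \<Longrightarrow> M (z,1) = N (z,1)"
      "\<And>a t. a \<in> {x0} \<Longrightarrow> 0 \<le> t \<Longrightarrow> t \<le> 1 \<Longrightarrow> M (a,t) = l (snd (a,1::real))"
    show ?thesis
      using M l1 \<alpha>(3) by (intro exI[of _ M]) (auto simp: N_def mapping_point_def)
  qed
  then obtain M where M: "continuous_map ?P Y M" "\<forall>x\<in>topspace X. M (x,0) = s y0 x \<and> M (x,1) = f x"
    "\<forall>t\<in>{0..1}. M (x0,t) = y0" by (elim exE conjE)
  let ?Z = "prod_topology X Y"
  let ?A = "topspace X \<times> {y0} \<union> {x0} \<times> topspace Y"
  have ndr: "ndr_pair ?Z ?A" using ndr_pair_prod[OF X(3) Y] by simp
  have cF: "continuous_map ?Z Y (\<lambda>p. s (snd p) (fst p))"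
    using continuous_map_comp[OF ev continuous_map_pairedI[OF continuous_map_fst continuous_map_comp[OF cs continuous_map_snd]]]
    by simp
  let ?G = "\<lambda>q. if snd (fst q) = y0 then M (fst (fst q), snd q) else snd (fst q)"
  have cG: "continuous_map (prod_topology (subtopology ?Z ?A) II) Y ?G"
  proof -
    let ?Q = "prod_topology ?Z II"
    have "continuous_map (subtopology ?Q ((topspace X \<times> {y0}) \<times> topspace II \<union> ({x0} \<times> topspace Y) \<times> topspace II)) Y ?G"
    proof (rule continuous_map_union_closed)
      show "closedin ?Q ((topspace X \<times> {y0}) \<times> topspace II)" "closedin ?Q (({x0} \<times> topspace Y) \<times> topspace II)"
        using ndr_pair_closedin[OF X(3)] ndr_pair_closedin[OF Y] closedin_topspace[of II]
          closedin_topspace[of X] closedin_topspace[of Y]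
        by (simp_all only: closedin_prod_Times_iff) simp_all
      have 1: "continuous_map ?Q Y (\<lambda>q. M (fst (fst q), snd q))"
        by (intro continuous_map_comp[OF M(1)] continuous_map_pairedI cm_proj continuous_map_snd)
      show "continuous_map (subtopology ?Q ((topspace X \<times> {y0}) \<times> topspace II)) Y ?G"
        by (rule continuous_map_eq[OF continuous_map_from_subtopology[OF 1]]) auto
      show "continuous_map (subtopology ?Q (({x0} \<times> topspace Y) \<times> topspace II)) Y ?G"
        by (rule continuous_map_eq[OF continuous_map_from_subtopology[OF cm_proj(2)]]) (use M(3) in auto)
    qed
    then show ?thesis by (simp add: prod_topology_subtopology_left Sigma_Un_distrib1)
  qed
  have GF: "?G (a,0) = s (snd a) (fst a)" if "a \<in> ?A" for a
    using that M(2) sx0 x0 by auto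
  show ?thesis
  proof (rule ndr_pair_HEP[OF ndr cF cG GF])
    fix H assume H: "continuous_map (prod_topology ?Z II) Y H"
      and HA: "\<And>a t. a \<in> ?A \<Longrightarrow> 0 \<le> t \<Longrightarrow> t \<le> 1 \<Longrightarrow> H (a,t) = ?G (a,t)"
    have cH: "continuous_map ?Z Y (\<lambda>p. H (p,1))"
      by (intro continuous_map_comp[OF H] continuous_map_pairedI) (auto intro: continuous_map_id[unfolded id_def])
    have "H ((x,y),1) = (if y = y0 then f x else y)" if "(x,y) \<in> wedge_set X x0 Y y0" for x y
    proof -
      have "x \<in> topspace X" using that x0 by (auto simp: wedge_set_def)
      then show ?thesis using HA[of "(x,y)" 1] that M(2) by (auto simp: wedge_set_def)
    qed
    then show ?thesis unfolding cyclic_map_def using f cH by (intro conjI exI[of _ "\<lambda>p. H (p,1)"]) auto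
  qed
qed

section \<open>Equivalences obtained from sections and cyclic maps\<close>

context cw
begin

lemma section_imp_homotopy_equivalent:
  assumes x0: "x0 \<in> topspace X" and pc: "path_connected_space X" and y0: "y0 \<in> topspace Y"
    and sec: "has_section (mapping_component X Y f) Y (evaluation x0)"
  shows "mapping_component X Y f homotopy_equivalent_space mapping_component X Y (\<lambda>_. y0)"
proof -
  let ?M = "mapping_space X Y"
  let ?f = "mapping_point X f" and ?z = "mapping_point X (\<lambda>_. y0)"
  obtain s where s: "continuous_map Y (mapping_component X Y f) s"
    "\<forall>y\<in>topspace Y. evaluation x0 (s y) = y"
    using sec unfolding has_section_def by blast
  have cs: "continuous_map Y ?M s"
    using s(1) unfolding mapping_component_def by (rule continuous_map_into_fulltopology)
  let ?S = "\<lambda>p. s (snd p) (fst p)"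
  have S: "continuous_map (prod_topology (subtopology X (cell e)) Y) Y ?S" if "e \<in> E" for e
    using continuous_map_comp[OF continuous_map_eval_compact[OF Hausdorff compactin_cell[OF that]]
        continuous_map_pairedI[OF continuous_map_fst continuous_map_comp[OF cs continuous_map_snd]]]
    by simp
  have S0: "?S (x0,y) = y" if "y \<in> topspace Y" for y using s(2) that by (simp add: evaluation_def)
  have "\<exists>h. continuous_map ?M ?M h \<and> vert X Y x0 h \<and>
    homotopic_with (vert X Y x0) ?M ?M (pointwise ?S \<circ> h) id \<and>
    homotopic_with (vert X Y x0) ?M ?M (h \<circ> pointwise ?S) id"
    by (rule vertical_equivalence[OF _ _ x0 pc]; (rule S S0); assumption)
  then obtain h where h: "continuous_map ?M ?M h"
    "homotopic_with (vert X Y x0) ?M ?M (pointwise ?S \<circ> h) id"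
    "homotopic_with (vert X Y x0) ?M ?M (h \<circ> pointwise ?S) id" by (elim exE conjE)
  let ?k = "pointwise ?S"
  have k: "continuous_map ?M ?M ?k" by (rule continuous_map_pointwise1[OF S])
  have zM: "?z \<in> topspace ?M" using y0 by (intro mapping_point_in) simp
  have "?k ?z = restrict (s y0) (topspace X)"
    unfolding pointwise_def mapping_point_def by (intro restrict_ext) simp
  also have "\<dots> = s y0" using mapping_space_ext[OF continuous_map_in[OF cs y0]] .
  finally have kz: "path_component_of ?M ?f (?k ?z)"
    using continuous_map_in[OF s(1) y0] by (simp add: topspace_mapping_component)
  \<comment> \<open>The track of the constant map under the homotopy from
    \<open>h \<circ> ?k\<close> to the identity shows that \<open>h\<close> returns
    \<open>?k ?z\<close>, which is \<open>s y0\<close>, and with it the component of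
    \<open>f\<close>, to the component of the constant map.\<close>
  have "homotopic_with (\<lambda>_. True) ?M ?M (h \<circ> ?k) id"
    using h(3) by (rule homotopic_with_mono) simp
  then obtain H where H: "continuous_map (prod_topology II ?M) ?M H" "\<forall>g. H (0,g) = (h \<circ> ?k) g" "\<forall>g. H (1,g) = id g"
    unfolding homotopic_with_def by (elim exE conjE)
  have "path_component_of ?M (h (?k ?z)) ?z"
    using path_component_of_homotopy[OF H(1) zM, of 0] H(2,3) by simp
  moreover have "path_component_of ?M (h (?k ?z)) (h ?f)"
    using path_component_of_image[OF h(1) kz] path_component_of_sym by metis
  ultimately have hf: "path_component_of ?M ?z (h ?f)"
    using path_component_of_sym path_component_of_trans by metis
  have "continuous_map (mapping_component X Y (\<lambda>_. y0)) (mapping_component X Y f) ?k"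
    "continuous_map (mapping_component X Y f) (mapping_component X Y (\<lambda>_. y0)) h"
    unfolding mapping_component_def
    by (rule continuous_map_path_component[OF k], rule kz) (rule continuous_map_path_component[OF h(1)], rule hf)
  moreover have "homotopic_with (\<lambda>_. True) (mapping_component X Y f) (mapping_component X Y f) (?k \<circ> h) id"
    unfolding mapping_component_def by (rule homotopic_with_path_component[OF h(2)]) simp
  moreover have "homotopic_with (\<lambda>_. True) (mapping_component X Y (\<lambda>_. y0)) (mapping_component X Y (\<lambda>_. y0)) (h \<circ> ?k) id"
    unfolding mapping_component_def by (rule homotopic_with_path_component[OF h(3)]) simp
  ultimately show ?thesis unfolding homotopy_equivalent_space_def by blast
qed

text \<open>\<open>\<Gamma>\<close> induces a map \<open>k\<close> that sends the constant map
  exactly to \<open>f\<close>, but its vertical inverse ignores base points. By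
  \<open>pointed_inverse\<close>, \<open>k\<close> has a based left inverse \<open>h'\<close>, and
  \<open>h'\<close> in turn has a based left inverse \<open>k'\<close>. Through based maps
  \<open>k \<simeq> k' \<circ> h' \<circ> k \<simeq> k'\<close>, so
  \<open>k \<circ> h' \<simeq> k' \<circ> h' \<simeq> id\<close>.\<close>

lemma cyclic_imp_fibre_homotopy_equivalent:
  fixes Y :: "'b topology"
  assumes X: "compact_space X" "ndr_pair X {x0}" and pc: "path_connected_space X" and y0: "y0 \<in> topspace Y"
    and e: "ndr_pair (mapping_space X Y) {mapping_point X f}" "ndr_pair (mapping_space X Y) {mapping_point X (\<lambda>_. y0)}"
    and cyc: "cyclic_map X x0 Y y0 f"
  shows "fibre_homotopy_equivalent
      (mapping_component X Y f) (mapping_point X f) (evaluation x0)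
      (mapping_component X Y (\<lambda>_. y0)) (mapping_point X (\<lambda>_. y0)) (evaluation x0)"
proof -
  let ?M = "mapping_space X Y"
  let ?f = "mapping_point X f" and ?z = "mapping_point X (\<lambda>_. y0)"
  let ?hw = "homotopic_with (vert X Y x0) ?M ?M"
  have x0: "x0 \<in> topspace X" using ndr_pair_subset[OF X(2)] by simp
  obtain \<Gamma> where \<Gamma>: "continuous_map (prod_topology X Y) Y \<Gamma>"
    "\<forall>(x, y) \<in> wedge_set X x0 Y y0. \<Gamma> (x, y) = (if y = y0 then f x else y)" and f0: "f x0 = y0"
    using cyc unfolding cyclic_map_def based_map_def by blast
  have S: "continuous_map (prod_topology (subtopology X (cell e)) Y) Y \<Gamma>" if "e \<in> E" for e
    unfolding prod_topology_subtopology_left by (rule continuous_map_from_subtopology[OF \<Gamma>(1)])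
  have S0: "\<Gamma> (x0,y) = y" if "y \<in> topspace Y" for y
    using bspec[OF \<Gamma>(2), of "(x0,y)"] that x0 f0 by (auto simp: wedge_set_def)
  let ?k = "pointwise \<Gamma>"
  have "\<exists>h. continuous_map ?M ?M h \<and> vert X Y x0 h \<and> ?hw (?k \<circ> h) id \<and> ?hw (h \<circ> ?k) id"
    by (rule vertical_equivalence[OF _ _ x0 pc]; (rule S S0); assumption)
  then obtain h where h: "continuous_map ?M ?M h" "vert X Y x0 h" "?hw (?k \<circ> h) id" "?hw (h \<circ> ?k) id"
    by (elim exE conjE)
  have k: "continuous_map ?M ?M ?k" by (rule continuous_map_pointwise1[OF S])
  have kv: "vert X Y x0 ?k" by (rule vert_pointwise[OF S0 x0])
  have "\<Gamma> (x,y0) = f x" if "x \<in> topspace X" for x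
    using bspec[OF \<Gamma>(2), of "(x,y0)"] that by (simp add: wedge_set_def)
  then have kz: "?k ?z = ?f"
    unfolding pointwise_def mapping_point_def by (intro restrict_ext) simp
  let ?b = "\<lambda>e q. vert X Y x0 q \<and> q e = e"
  obtain h' where h': "continuous_map ?M ?M h'" "vert X Y x0 h'" "h' ?f = ?z" "?hw h h'"
    "homotopic_with (?b ?z) ?M ?M (h' \<circ> ?k) id"
    using pointed_inverse[OF X(1) Hausdorff X(2) e(2) e(1) k kv kz h(1) h(4) h(2)] by (elim exE conjE)
  \<comment> \<open>The second use of \<open>pointed_inverse\<close> starts from a vertical homotopy
    between \<open>?k \<circ> h'\<close> and the identity. It comes from
    \<open>h \<simeq> h'\<close>, which is why \<open>pointed_inverse\<close> also records that
    homotopy.\<close>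
  have "?hw (?k \<circ> h) (?k \<circ> h')"
    by (intro homotopic_with_compose_continuous_map_left[OF homotopic_with_mono[OF h'(4), where Q = "\<lambda>q. vert X Y x0 q \<and> continuous_map ?M ?M q"] k])
       (auto intro: vert_comp kv)
  then have kh': "?hw (?k \<circ> h') id"
    using homotopic_with_trans[OF homotopic_with_symD h(3)] by blast
  obtain k' where k': "continuous_map ?M ?M k'" "vert X Y x0 k'" "k' ?z = ?f"
    "homotopic_with (?b ?f) ?M ?M (k' \<circ> h') id"
    using pointed_inverse[OF X(1) Hausdorff X(2) e(1) e(2) h'(1-3) k kh' kv] by (elim exE conjE)
  let ?c = "\<lambda>q. vert X Y x0 q \<and> q ?z = ?f"
  have 1: "homotopic_with ?c ?M ?M (k' \<circ> (h' \<circ> ?k)) (k' \<circ> id)"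
    by (rule homotopic_with_compose_continuous_map_left[OF homotopic_with_mono[OF h'(5), where Q = "\<lambda>q. ?b ?z q \<and> continuous_map ?M ?M q"] k'(1)])
       (auto intro: vert_comp k' simp: k'(3))
  have 2: "homotopic_with ?c ?M ?M ((k' \<circ> h') \<circ> ?k) (id \<circ> ?k)"
    by (rule homotopic_with_compose_continuous_map_right[OF k'(4) k]) (auto intro: vert_comp kv k simp: kz)
  have "homotopic_with ?c ?M ?M ?k k'"
    using homotopic_with_trans[OF homotopic_with_symD[OF 2]] 1 by (simp add: o_assoc)
  then have "homotopic_with (?b ?f) ?M ?M (?k \<circ> h') (k' \<circ> h')"
    by (rule homotopic_with_compose_continuous_map_right[OF _ h'(1)]) (auto intro: vert_comp h' simp: h'(3))
  then have kh: "homotopic_with (?b ?f) ?M ?M (?k \<circ> h') id"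
    using homotopic_with_trans k'(4) by blast
  have fM: "?f \<in> topspace ?M" "?z \<in> topspace ?M" using ndr_pair_subset[OF e(1)] ndr_pair_subset[OF e(2)] by auto
  have ck: "continuous_map (mapping_component X Y (\<lambda>_. y0)) (mapping_component X Y f) ?k"
    unfolding mapping_component_def
    by (rule continuous_map_path_component[OF k]) (simp add: kz path_component_of_refl fM)
  have ch: "continuous_map (mapping_component X Y f) (mapping_component X Y (\<lambda>_. y0)) h'"
    unfolding mapping_component_def
    by (rule continuous_map_path_component[OF h'(1)]) (simp add: h'(3) path_component_of_refl fM)
  have over: "based_map_over (mapping_component X Y a) e (evaluation x0) (mapping_component X Y b) e' (evaluation x0) q"
    if "continuous_map (mapping_component X Y a) (mapping_component X Y b) q" "q e = e'" "vert X Y x0 q" for a b q e e'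
    unfolding based_map_over_def based_map_def evaluation_def
    using that mapping_component_subset unfolding vert_def by blast
  show ?thesis
    unfolding fibre_homotopy_equivalent_def
  proof (intro exI conjI)
    show "based_map_over (mapping_component X Y f) ?f (evaluation x0) (mapping_component X Y (\<lambda>_. y0)) ?z (evaluation x0) h'"
      by (rule over[OF ch h'(3,2)])
    show "based_map_over (mapping_component X Y (\<lambda>_. y0)) ?z (evaluation x0) (mapping_component X Y f) ?f (evaluation x0) ?k"
      by (rule over[OF ck kz kv])
    show "homotopic_with (based_map_over (mapping_component X Y f) ?f (evaluation x0) (mapping_component X Y f) ?f (evaluation x0))
       (mapping_component X Y f) (mapping_component X Y f) (?k \<circ> h') id"
      unfolding mapping_component_def
      by (rule homotopic_with_path_component[OF kh])
         (use over[unfolded mapping_component_def] in blast)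
    show "homotopic_with (based_map_over (mapping_component X Y (\<lambda>_. y0)) ?z (evaluation x0) (mapping_component X Y (\<lambda>_. y0)) ?z (evaluation x0))
       (mapping_component X Y (\<lambda>_. y0)) (mapping_component X Y (\<lambda>_. y0)) (h' \<circ> ?k) id"
      unfolding mapping_component_def
      by (rule homotopic_with_path_component[OF h'(5)])
         (use over[unfolded mapping_component_def] in blast)
  qed
qed

end

text \<open>The constant maps form a section of the evaluation on the component of the constant map,
  and a map over \<open>Y\<close> carries it to a section on the component of
  \<open>f\<close>.\<close>

lemma fibre_homotopy_equivalent_imp_section:
  assumes x0: "x0 \<in> topspace X" and Y: "path_connected_space Y" "y0 \<in> topspace Y"
    and feq: "fibre_homotopy_equivalent
      (mapping_component X Y f) (mapping_point X f) (evaluation x0)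
      (mapping_component X Y (\<lambda>_. y0)) (mapping_point X (\<lambda>_. y0)) (evaluation x0)"
  shows "has_section (mapping_component X Y f) Y (evaluation x0)"
proof -
  let ?M = "mapping_space X Y"
  let ?c = "\<lambda>y. \<lambda>x\<in>topspace X. y"
  obtain k where "based_map_over (mapping_component X Y (\<lambda>_. y0)) (mapping_point X (\<lambda>_. y0)) (evaluation x0)
      (mapping_component X Y f) (mapping_point X f) (evaluation x0) k"
    using feq unfolding fibre_homotopy_equivalent_def by blast
  then have k: "continuous_map (mapping_component X Y (\<lambda>_. y0)) (mapping_component X Y f) k"
    "\<forall>g\<in>topspace (mapping_component X Y (\<lambda>_. y0)). evaluation x0 (k g) = evaluation x0 g"
    unfolding based_map_over_def based_map_def by blast+
  have cc: "continuous_map Y ?M ?c"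
    using continuous_map_curry'[where X = X and W = Y and Y = Y and F = snd, OF continuous_map_snd] by simp
  have "path_component_of ?M (mapping_point X (\<lambda>_. y0)) (?c y)" if "y \<in> topspace Y" for y
    using path_component_of_image[OF cc path_connected_space_imp_path_component_of[OF Y that]]
    by (simp add: mapping_point_def)
  then have c: "continuous_map Y (mapping_component X Y (\<lambda>_. y0)) ?c"
    unfolding mapping_component_def by (intro continuous_map_into_sub[OF cc]) simp
  have "evaluation x0 (k (?c y)) = y" if "y \<in> topspace Y" for y
    using k(2) continuous_map_in[OF c that] x0 by (simp add: evaluation_def)
  then show ?thesis
    unfolding has_section_def using continuous_map_comp[OF k(1) c] by (intro exI[of _ "\<lambda>y. k (?c y)"]) simp
qed

theorem theorem3p7:
  fixes X :: "'a topology" and Y :: "'b topology"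
    and E\<^sub>X :: "'a set set" and d\<^sub>X :: "'a set \<Rightarrow> nat"
    and E\<^sub>Y :: "'b set set" and d\<^sub>Y :: "'b set \<Rightarrow> nat"
    and x0 :: 'a and y0 :: 'b and f :: "'a \<Rightarrow> 'b"
  assumes "CW_complex X E\<^sub>X d\<^sub>X" and "countable E\<^sub>X" and "connected_space X"
    and "nondegenerate_basepoint X x0"
    and "CW_complex Y E\<^sub>Y d\<^sub>Y" and "countable E\<^sub>Y" and "connected_space Y"
    and "nondegenerate_basepoint Y y0"
    and "based_map X x0 Y y0 f"
  shows "(has_section (mapping_component X Y f) Y (evaluation x0) \<longrightarrow>
            mapping_component X Y f homotopy_equivalent_space mapping_component X Y (\<lambda>_. y0)) \<and>
         (finite E\<^sub>X \<longrightarrow>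
            (cyclic_map X x0 Y y0 f \<longleftrightarrow>
               has_section (mapping_component X Y f) Y (evaluation x0)) \<and>
            (has_section (mapping_component X Y f) Y (evaluation x0) \<longleftrightarrow>
               fibre_homotopy_equivalent
                 (mapping_component X Y f) (mapping_point X f) (evaluation x0)
                 (mapping_component X Y (\<lambda>_. y0)) (mapping_point X (\<lambda>_. y0)) (evaluation x0)))"
proof -
  obtain \<phi> where X: "cw X E\<^sub>X d\<^sub>X \<phi>" using CW_complex_cw[OF assms(1)] .
  obtain \<psi> where Y: "cw Y E\<^sub>Y d\<^sub>Y \<psi>" using CW_complex_cw[OF assms(5)] .
  have x0: "ndr_pair X {x0}" "x0 \<in> topspace X" and y0: "ndr_pair Y {y0}" "y0 \<in> topspace Y"
    using nondegenerate_basepoint_ndr[OF assms(4)] nondegenerate_basepoint_ndr[OF assms(8)]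
      ndr_pair_subset[OF nondegenerate_basepoint_ndr[OF assms(4)]]
      ndr_pair_subset[OF nondegenerate_basepoint_ndr[OF assms(8)]] by simp_all
  have pX: "path_connected_space X" and pY: "path_connected_space Y"
    using cw.path_connected[OF X] cw.path_connected[OF Y] assms(3,7) by auto
  have H: "Hausdorff_space X" by (rule cw.Hausdorff[OF X])
  let ?sec = "has_section (mapping_component X Y f) Y (evaluation x0)"
  let ?feq = "fibre_homotopy_equivalent
                 (mapping_component X Y f) (mapping_point X f) (evaluation x0)
                 (mapping_component X Y (\<lambda>_. y0)) (mapping_point X (\<lambda>_. y0)) (evaluation x0)"
  have f: "continuous_map X Y f" using assms(9) by (simp add: based_map_def)
  have BA: "cyclic_map X x0 Y y0 f" if "finite E\<^sub>X" ?sec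
    by (rule section_imp_cyclic[OF cw.compact_finite[OF X that(1)] H x0(1) y0(1) assms(9) that(2)])
  have AB: ?sec if "cyclic_map X x0 Y y0 f"
    by (rule cyclic_imp_section[OF x0(2) pY y0(2) that])
  \<comment> \<open>(C) is reached from (B) by way of (A): a section only provides some point
    \<open>s y0\<close> in the component of \<open>f\<close>, whereas \<open>\<Gamma>\<close>
    carries the base point of one mapping space exactly to that of the other.\<close>
  have AC: ?feq if fin: "finite E\<^sub>X" and cyc: "cyclic_map X x0 Y y0 f"
  proof -
    have cX: "compact_space X" by (rule cw.compact_finite[OF X fin])
    have ne: "topspace X \<noteq> {}" using x0(2) by blast
    have "ndr_pair (mapping_space X Y) {mapping_point X g}" if "continuous_map X Y g" for g
      unfolding mapping_point_def by (rule cw.ndr_mapping_space[OF Y cX H ne that])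
    then show ?thesis
      using f y0(2) by (intro cw.cyclic_imp_fibre_homotopy_equivalent[OF X cX x0(1) pX y0(2) _ _ cyc]) simp_all
  qed
  have CB: ?sec if ?feq
    by (rule fibre_homotopy_equivalent_imp_section[OF x0(2) pY y0(2) that])
  show ?thesis
    using cw.section_imp_homotopy_equivalent[OF X x0(2) pX y0(2)] BA AB AC CB by blast
qed

end
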